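(* Let $\lambda,\mu\in\mathbb{C}$. Then, as complex vector spaces, $$\mathrm{Ext}^1_{\mathcal{O}}(L(\mu),L(\lambda))\cong\begin{cases}\mathbb{C}, & \text{if } \lambda-\mu\in\{2,3,4\} \text{ and } \lambda\mu\neq 0;\\ \mathbb{C}, & \text{if } (\lambda,\mu)=(0,-1),\ (0,-2),\ (-1,0) \text{ or } (4,-1);\\ \mathbb{C}, & \text{if } (\lambda,\mu)=\left(\frac{5\pm\sqrt{19}}{2},\frac{-7\pm\sqrt{19}}{2}\right);\\ 0, & \text{otherwise,}\end{cases}$$ where in the third line the same sign is taken in both entries.
   Context: All vector spaces and Lie algebras are over $\mathbb{C}$. Let $\mathfrak{W}=\mathrm{Der}_{\mathbb{C}}\,\mathbb{C}[x]$, the Lie algebra with basis $d_i=x^{i+1}\frac{\partial}{\partial x}$, $i\in\mathbb{Z}_{\ge -1}$, and bracket $[d_i,d_j]=(j-i)d_{i+j}$. Put $\mathfrak{h}=\mathbb{C}d_0$, $\mathfrak{W}^+=\mathrm{span}\{d_i\mid i\in\mathbb{Z}_{>0}\}$ and $\mathfrak{b}=\mathfrak{h}\oplus\mathfrak{W}^+$. A $\mathfrak{W}$-module $M$ is a weight module if $M=\bigoplus_{\lambda\in\mathbb{C}}M_\lambda$, where $M_\lambda=\{v\in M\mid d_0v=\lambda v\}$. Category $\mathcal{O}$ is the full subcategory of the category of left $U(\mathfrak{W})$-modules whose objects are the modules $M$ such that (a) $M$ is a finitely generated $U(\mathfrak{W})$-module; (b) $M$ is a weight module; (c) for each $v\in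 M$, the subspace $U(\mathfrak{W}^+)v$ is finite dimensional. For $\lambda\in\mathbb{C}$ let $\mathbb{C}_\lambda=\mathbb{C}v_\lambda$ be the one-dimensional $\mathfrak{b}$-module with $\mathfrak{W}^+v_\lambda=0$, $d_0v_\lambda=\lambda v_\lambda$. The Verma module is $\Delta(\lambda)=U(\mathfrak{W})\otimes_{U(\mathfrak{b})}\mathbb{C}_\lambda$, and $L(\lambda)$ is its unique simple quotient. For $M,N\in\mathcal{O}$, $\mathrm{Ext}^1_{\mathcal{O}}(M,N)$ is the space of equivalence classes of short exact sequences $0\to N\to K\to M\to 0$ with $K\in\mathcal{O}$. *)

theory Defs
  imports
    Complex_Main
    "HOL-Library.Poly_Mapping"
    "HOL-Library.Product_Plus"
    "HOL-Library.Nat_Bijection"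
    "HOL-Computational_Algebra.Polynomial"
begin

section \<open>The Lie algebra of derivations of the polynomial ring\<close>

typedef witt = "{D :: complex poly \<Rightarrow> complex poly.
    (\<forall>p q. D (p + q) = D p + D q) \<and>
    (\<forall>c p. D (smult c p) = smult c (D p)) \<and>
    (\<forall>p q. D (p * q) = D p * q + p * D q)}"
  morphisms der Abs_witt
  by (rule exI[of _ "\<lambda>_. 0"]) simp

setup_lifting type_definition_witt

instantiation witt :: ab_group_add
begin
lift_definition zero_witt :: witt is "\<lambda>_. 0" by simp
lift_definition plus_witt :: "witt \<Rightarrow> witt \<Rightarrow> witt" is "\<lambda>D E p. D p + E p"
  by (simp add: algebra_simps smult_add_right)
lift_definition uminus_witt :: "witt \<Rightarrow> witt" is "\<lambda>D p. - D p"
  by (simp add: algebra_simps)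
lift_definition minus_witt :: "witt \<Rightarrow> witt \<Rightarrow> witt" is "\<lambda>D E p. D p - E p"
  by (simp add: algebra_simps smult_diff_right)
instance by standard (transfer; simp add: fun_eq_iff algebra_simps)+
end

lift_definition witt_scale :: "complex \<Rightarrow> witt \<Rightarrow> witt" is "\<lambda>c D p. smult c (D p)"
  by (simp add: algebra_simps smult_add_right)

global_interpretation witt: vector_space witt_scale
  by standard (transfer; simp add: fun_eq_iff smult_add_right smult_add_left)+

lift_definition bracket :: "witt \<Rightarrow> witt \<Rightarrow> witt" is "\<lambda>D E p. D (E p) - E (D p)"
  by (simp add: algebra_simps smult_diff_right)

text \<open>\<open>d i\<close> is \<open>x\<^sup>i\<^sup>+\<^sup>1 (d/dx)\<close>; it is only meaningful for \<open>i \<ge> -1\<close>.\<close>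

lift_definition d :: "int \<Rightarrow> witt" is "\<lambda>i p. monom 1 (nat (i + 1)) * pderiv p"
  by (simp add: pderiv_add pderiv_smult pderiv_mult algebra_simps)

lemma bracket_d:
  assumes "i \<ge> -1" "j \<ge> -1"
  shows "bracket (d i) (d j) = witt_scale (of_int (j - i)) (d (i + j))"
proof -
  obtain m n where mn: "i = int m - 1" "j = int n - 1"
    using assms by (metis add.commute diff_add_cancel le_add_diff_inverse nat_0_le
        diff_ge_0_iff_ge diff_minus_eq_add)
  show ?thesis
  proof (cases "m + n = 0")
    case True
    then have "der (bracket (d i) (d j)) = der (witt_scale (of_int (j - i)) (d (i + j)))"
      unfolding mn by (simp add: fun_eq_iff bracket.rep_eq d.rep_eq witt_scale.rep_eq zero_witt.rep_eq)
    then show ?thesis by (simp add: der_inject)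
  next
    case False
    have e: "nat (int m + int n - 1) = m + n - 1" by linarith
    have "monom 1 m * pderiv (monom 1 n * pderiv p) - monom 1 n * pderiv (monom 1 m * pderiv p)
        = smult (of_int (int n - int m)) (monom 1 (m + n - 1) * pderiv p)" for p :: "complex poly"
    proof -
      have 1: "monom 1 a * pderiv (monom 1 b) = (monom (of_nat b) (a + b - 1) :: complex poly)" for a b
        by (cases b) (simp_all add: pderiv_monom mult_monom)
      have "monom 1 m * pderiv (monom 1 n * pderiv p) - monom 1 n * pderiv (monom 1 m * pderiv p)
        = (monom 1 m * pderiv (monom 1 n) - monom 1 n * pderiv (monom 1 m)) * pderiv p"
        by (simp add: pderiv_mult algebra_simps)
      also have "monom 1 m * pderiv (monom 1 n) - monom 1 n * pderiv (monom 1 m)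
        = smult (of_int (int n - int m)) (monom (1::complex) (m + n - 1))"
        by (simp add: 1 add.commute smult_monom diff_monom)
      finally show ?thesis by simp
    qed
    then have "der (bracket (d i) (d j)) = der (witt_scale (of_int (j - i)) (d (i + j)))"
      unfolding mn by (simp add: fun_eq_iff e bracket.rep_eq d.rep_eq witt_scale.rep_eq)
    then show ?thesis by (simp add: der_inject)
  qed
qed

lemma der_eq: "der D p = der D [:0, 1:] * pderiv p"
proof -
  have add: "der D (p + q) = der D p + der D q"
    and scl: "der D (smult c p) = smult c (der D p)"
    and mul: "der D (p * q) = der D p * q + p * der D q" for p q c
    using der[of D] by auto
  have 1: "der D 1 = 0" using mul[of 1 1] by simp
  have c: "der D [:c:] = 0" for c using scl[of c 1] 1 by simp
  show ?thesis
  proof (induction p)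
    case 0 then show ?case using c[of 0] by simp
  next
    case (pCons a p)
    have e: "pCons a p = [:a:] + [:0, 1:] * p" by simp
    show ?case unfolding e add mul c pCons.IH by (simp add: pderiv_add pderiv_mult pderiv_pCons algebra_simps)
  qed
qed

lemma span_d: "witt.span (d ` {-1..}) = UNIV"
proof -
  have "D \<in> witt.span (d ` {-1..})" for D
  proof -
    let ?f = "der D [:0, 1:]"
    let ?S = "\<Sum>n\<le>degree ?f. witt_scale (coeff ?f n) (d (int n - 1))"
    have "?S = D"
    proof -
      have sum: "der (\<Sum>n\<in>A. g n) p = (\<Sum>n\<in>A. der (g n) p)" for g and A :: "nat set" and p
        by (induction A rule: infinite_finite_induct) (simp_all add: zero_witt.rep_eq plus_witt.rep_eq)
      have "der ?S p = (\<Sum>n\<le>degree ?f. monom (coeff ?f n) n) * pderiv p" for p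
        by (simp add: sum witt_scale.rep_eq d.rep_eq sum_distrib_right smult_monom
            flip: mult_smult_left)
      then have "der ?S p = der D p" for p
        using der_eq[of D p] by (simp add: poly_as_sum_of_monoms)
      then show ?thesis by (simp add: der_inject[symmetric] fun_eq_iff)
    qed
    moreover have "?S \<in> witt.span (d ` {-1..})"
      by (intro witt.span_sum witt.span_scale witt.span_base) auto
    ultimately show ?thesis by (rule subst)
  qed
  then show ?thesis by blast
qed

lemma inj_on_d: "inj_on d {-1..}"
proof (rule inj_onI)
  fix i j :: int assume ij: "i \<in> {-1..}" "j \<in> {-1..}" "d i = d j"
  then have "der (d i) [:0, 1:] = der (d j) [:0, 1:]" by simp
  then have "degree (monom (1::complex) (nat (i + 1))) = degree (monom (1::complex) (nat (j + 1)))"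
    by (simp add: d.rep_eq pderiv_pCons)
  then show "i = j" using ij by (simp add: degree_monom_eq)
qed

lemma independent_d: "witt.independent (d ` {-1..})"
proof -
  have "(\<forall>b\<in>S. u b = 0)" if S: "finite S" "S \<subseteq> d ` {-1..}" "(\<Sum>b\<in>S. witt_scale (u b) b) = 0" for S u
  proof
    fix b assume b: "b \<in> S"
    then obtain i where i: "i \<ge> -1" "b = d i" using S by auto
    have sum: "der (\<Sum>n\<in>A. g n) p = (\<Sum>n\<in>A. der (g n) p)" for g and A :: "witt set" and p
      by (induction A rule: infinite_finite_induct) (simp_all add: zero_witt.rep_eq plus_witt.rep_eq)
    have k: "coeff (der b' [:0, 1:]) (nat (i + 1)) = (if b' = b then 1 else 0)" if b': "b' \<in> S" for b'
    proof -
      obtain j where j: "j \<ge> -1" "b' = d j" using S(2) b' by auto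
      have "nat (j + 1) = nat (i + 1) \<longleftrightarrow> j = i" using i(1) j(1) by auto
      also have "\<dots> \<longleftrightarrow> b' = b" using i j inj_on_eq_iff[OF inj_on_d, of j i] by simp
      finally have "nat (j + 1) = nat (i + 1) \<longleftrightarrow> b' = b" .
      then show ?thesis by (simp add: j(2) d.rep_eq pderiv_pCons coeff_monom)
    qed
    have "0 = coeff (der (\<Sum>b\<in>S. witt_scale (u b) b) [:0, 1:]) (nat (i + 1))"
      unfolding S(3) by (simp add: zero_witt.rep_eq)
    also have "\<dots> = (\<Sum>b'\<in>S. u b' * coeff (der b' [:0, 1:]) (nat (i + 1)))"
      by (simp add: sum witt_scale.rep_eq coeff_sum)
    also have "\<dots> = (\<Sum>b'\<in>S. if b' = b then u b' else 0)"
      by (intro sum.cong) (simp_all add: k)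
    also have "\<dots> = u b" using S b by simp
    finally show "u b = 0" by simp
  qed
  then show ?thesis unfolding witt.independent_explicit_module by blast
qed

definition h_sub :: "witt set" where
  "h_sub = witt.span {d 0}"

definition W_plus :: "witt set" where
  "W_plus = witt.span (d ` {0<..})"

definition b_sub :: "witt set" where
  "b_sub = {x + y | x y. x \<in> h_sub \<and> y \<in> W_plus}"


section \<open>The universal enveloping algebra\<close>

text \<open>Lists are made into a free (non-commutative) monoid, so that \<open>'a list \<Rightarrow>\<^sub>0 complex\<close> with the
  convolution product is the free associative algebra on \<open>'a\<close>. The enveloping algebra is the
  quotient of the free algebra on the set of all elements of the Lie algebra by the relations of
  linearity (these alone give the tensor algebra) and the commutator relations.\<close>

instantiation list :: (type) monoid_add
begin
definition zero_list :: "'a list" where "zero_list = []"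
definition plus_list :: "'a list \<Rightarrow> 'a list \<Rightarrow> 'a list" where "plus_list xs ys = xs @ ys"
instance by standard (simp_all add: zero_list_def plus_list_def)
end

type_synonym free_alg = "witt list \<Rightarrow>\<^sub>0 complex"

abbreviation gen :: "witt \<Rightarrow> free_alg" where
  "gen x \<equiv> Poly_Mapping.single [x] 1"

definition U_relations :: "free_alg set" where
  "U_relations =
     {gen (x + y) - gen x - gen y | x y. True} \<union>
     {gen (witt_scale c x) - Poly_Mapping.single [] c * gen x | c x. True} \<union>
     {gen x * gen y - gen y * gen x - gen (bracket x y) | x y. True}"

definition two_sided_ideal :: "'r::ring_1 set \<Rightarrow> bool" where
  "two_sided_ideal I \<longleftrightarrow> 0 \<in> I \<and> (\<forall>a\<in>I. \<forall>b\<in>I. a + b \<in> I) \<and> (\<forall>a\<in>I. \<forall>r. r * a \<in> I \<and> a * r \<in> I)"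

definition U_ideal :: "free_alg set" where
  "U_ideal = two_sided_ideal hull U_relations"

lemma U_ideal: "two_sided_ideal U_ideal"
  unfolding U_ideal_def by (rule hull_in) (auto simp: two_sided_ideal_def)

lemma U_ideal_0: "0 \<in> U_ideal"
  and U_ideal_add: "a \<in> U_ideal \<Longrightarrow> b \<in> U_ideal \<Longrightarrow> a + b \<in> U_ideal"
  and U_ideal_left: "a \<in> U_ideal \<Longrightarrow> r * a \<in> U_ideal"
  and U_ideal_right: "a \<in> U_ideal \<Longrightarrow> a * r \<in> U_ideal"
  using U_ideal unfolding two_sided_ideal_def by auto

lemma U_ideal_uminus: "a \<in> U_ideal \<Longrightarrow> - a \<in> U_ideal"
  using U_ideal_left[of a "-1"] by simp

lemma U_ideal_diff: "a \<in> U_ideal \<Longrightarrow> b \<in> U_ideal \<Longrightarrow> a - b \<in> U_ideal"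
  using U_ideal_add[of a "- b"] U_ideal_uminus[of b] by simp

lemma U_ideal_eq: "a = b \<Longrightarrow> a - b \<in> U_ideal"
  by (simp add: U_ideal_0)

quotient_type UW = free_alg / "\<lambda>p q. p - q \<in> U_ideal"
proof (rule equivpI)
  show "reflp (\<lambda>p q. p - q \<in> U_ideal)" by (simp add: reflp_def U_ideal_0)
  show "symp (\<lambda>p q. p - q \<in> U_ideal)"
    unfolding symp_def using U_ideal_uminus by fastforce
  show "transp (\<lambda>p q. p - q \<in> U_ideal)"
    unfolding transp_def
  proof (intro allI impI)
    fix x y z assume "x - y \<in> U_ideal" "y - z \<in> U_ideal"
    from U_ideal_add[OF this] show "x - z \<in> U_ideal" by simp
  qed
qed

lemma free_alg_induct [case_names zero add]:
  fixes f :: free_alg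
  assumes "P 0" "\<And>k v f. P f \<Longrightarrow> P (Poly_Mapping.single k v + f)"
  shows "P f"
proof (induction f rule: update_induct)
  case const
  then show ?case by fact
next
  case (update f a b)
  have "Poly_Mapping.update a b f = Poly_Mapping.single a b + f"
    using update(1) by (intro poly_mapping_eqI)
      (auto simp: lookup_update lookup_add lookup_single when_def in_keys_iff)
  then show ?case using assms(2)[OF update(3)] by simp
qed

lemma lookup_times_Nil:
  fixes f g :: free_alg
  shows "Poly_Mapping.lookup (f * g) [] = Poly_Mapping.lookup f [] * Poly_Mapping.lookup g []"
proof -
  have w: "([] = l + q) \<longleftrightarrow> l = [] \<and> q = []" for l q :: "witt list"
    by (auto simp: plus_list_def)
  have "(Poly_Mapping.lookup g q when [] = l + q) = ((Poly_Mapping.lookup g q when l = []) when q = [])"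
    for l q by (simp add: w when_def)
  then show ?thesis
    by (simp add: lookup_mult mult_when)
qed

lemma one_notin_U_ideal: "1 \<notin> U_ideal"
proof -
  define A where "A = {f :: free_alg. Poly_Mapping.lookup f [] = 0}"
  have "two_sided_ideal A"
    by (simp add: two_sided_ideal_def A_def lookup_times_Nil lookup_add)
  moreover have "U_relations \<subseteq> A"
    by (auto simp: U_relations_def A_def lookup_minus lookup_times_Nil lookup_single)
  ultimately have "U_ideal \<subseteq> A" unfolding U_ideal_def by (rule hull_minimal[rotated])
  moreover have "1 \<notin> A"
    by (simp add: A_def lookup_one zero_list_def)
  ultimately show ?thesis by blast
qed

instantiation UW :: ring_1
begin
lift_definition zero_UW :: UW is 0 .
lift_definition one_UW :: UW is 1 .
lift_definition plus_UW :: "UW \<Rightarrow> UW \<Rightarrow> UW" is "(+)"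
proof -
  fix a b c e :: free_alg assume "a - b \<in> U_ideal" "c - e \<in> U_ideal"
  from U_ideal_add[OF this] show "a + c - (b + e) \<in> U_ideal" by (simp add: algebra_simps)
qed
lift_definition uminus_UW :: "UW \<Rightarrow> UW" is "uminus"
proof -
  fix a b :: free_alg assume "a - b \<in> U_ideal"
  from U_ideal_uminus[OF this] show "- a - - b \<in> U_ideal" by simp
qed
lift_definition minus_UW :: "UW \<Rightarrow> UW \<Rightarrow> UW" is "(-)"
proof -
  fix a b c e :: free_alg assume "a - b \<in> U_ideal" "c - e \<in> U_ideal"
  from U_ideal_diff[OF this] show "a - c - (b - e) \<in> U_ideal" by (simp add: algebra_simps)
qed
lift_definition times_UW :: "UW \<Rightarrow> UW \<Rightarrow> UW" is "(*)"
proof -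
  fix a b c e :: free_alg assume "a - b \<in> U_ideal" "c - e \<in> U_ideal"
  then have "(a - b) * c + b * (c - e) \<in> U_ideal"
    by (intro U_ideal_add U_ideal_left U_ideal_right)
  then show "a * c - b * e \<in> U_ideal" by (simp add: algebra_simps)
qed
instance
proof
  show "(0 :: UW) \<noteq> 1"
    using one_notin_U_ideal U_ideal_uminus[of "-1"] by transfer auto
qed (transfer, rule U_ideal_eq, simp add: algebra_simps)+
end

lift_definition inc :: "witt \<Rightarrow> UW" is gen .

lift_definition scal :: "complex \<Rightarrow> UW" is "Poly_Mapping.single []" .

lemma inc_add: "inc (x + y) = inc x + inc y"
  by transfer (rule subsetD[OF hull_subset[of U_relations two_sided_ideal, folded U_ideal_def]],
      auto simp: U_relations_def diff_diff_eq)

lemma inc_scale: "inc (witt_scale c x) = scal c * inc x"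
  by transfer (rule subsetD[OF hull_subset[of U_relations two_sided_ideal, folded U_ideal_def]],
      auto simp: U_relations_def)

lemma inc_bracket: "inc (bracket x y) = inc x * inc y - inc y * inc x"
proof -
  have "inc x * inc y - inc y * inc x = inc (bracket x y)"
    by transfer (rule subsetD[OF hull_subset[of U_relations two_sided_ideal, folded U_ideal_def]],
        auto simp: U_relations_def)
  then show ?thesis by simp
qed


lemma scal_1: "scal 1 = 1"
  by transfer (rule U_ideal_eq, simp flip: single_one add: zero_list_def)

lemma scal_add: "scal (a + b) = scal a + scal b"
  by transfer (rule U_ideal_eq, simp add: single_add)

lemma scal_mult: "scal (a * b) = scal a * scal b"
  by transfer (rule U_ideal_eq, simp add: mult_single plus_list_def)

lemma scal_commute: "scal a * u = u * scal a"
proof -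
  have *: "Poly_Mapping.single [] a * f = f * Poly_Mapping.single [] a" for f :: free_alg and a
  proof (induction f rule: free_alg_induct)
    case zero
    then show ?case by simp
  next
    case (add k v f)
    then show ?case by (simp add: distrib_left distrib_right mult_single plus_list_def mult.commute)
  qed
  show ?thesis by transfer (rule U_ideal_eq, rule *)
qed

text \<open>The subalgebra generated by (the image of) a Lie subalgebra \<open>\<aa>\<close> is the image of \<open>U(\<aa>)\<close> in
  \<open>U(\<WW>)\<close>, which is how \<open>U(\<aa>)\<close> is regarded as a subalgebra of \<open>U(\<WW>)\<close>.\<close>

definition subalgebra :: "UW set \<Rightarrow> bool" where
  "subalgebra A \<longleftrightarrow> range scal \<subseteq> A \<and> (\<forall>a\<in>A. \<forall>b\<in>A. a + b \<in> A \<and> a * b \<in> A)"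

definition U_sub :: "witt set \<Rightarrow> UW set" where
  "U_sub \<aa> = subalgebra hull (inc ` \<aa>)"

lemma subalgebra_UNIV_iff:
  assumes "subalgebra A" "\<And>i. i \<ge> -1 \<Longrightarrow> inc (d i) \<in> A"
  shows "A = UNIV"
proof -
  have A: "scal c \<in> A" "a \<in> A \<Longrightarrow> b \<in> A \<Longrightarrow> a + b \<in> A" "a \<in> A \<Longrightarrow> b \<in> A \<Longrightarrow> a * b \<in> A" for a b c
    using assms(1) unfolding subalgebra_def by auto
  have 0: "inc 0 = 0" "scal 0 = 0" using inc_add[of 0 0] scal_add[of 0 0] by auto
  have inc: "inc D \<in> A" for D
  proof -
    have "D \<in> witt.span (d ` {-1..})" by (simp add: span_d)
    then show ?thesis
    proof (induction rule: witt.span_induct_alt)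
      case base then show ?case using A(1)[of 0] 0 by simp
    next
      case (step c x y)
      then show ?case using assms(2) A by (auto simp: inc_add inc_scale)
    qed
  qed
  have word: "abs_UW (Poly_Mapping.single w c) \<in> A" for w c
  proof (induction w arbitrary: c)
    case Nil
    then show ?case using A(1)[of c] by (simp add: scal.abs_eq)
  next
    case (Cons x w)
    have "Poly_Mapping.single (x # w) c = gen x * Poly_Mapping.single w c"
      by (simp add: mult_single plus_list_def)
    then have "abs_UW (Poly_Mapping.single (x # w) c) = inc x * abs_UW (Poly_Mapping.single w c)"
      by (simp add: inc.abs_eq times_UW.abs_eq)
    then show ?case using Cons inc A(3) by metis
  qed
  have "abs_UW f \<in> A" for f
  proof (induction f rule: free_alg_induct)
    case zero
    then show ?case using word[of "[]" 0] by simp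
  next
    case (add k v f)
    then show ?case using A(2) word by (metis plus_UW.abs_eq)
  qed
  then have "u \<in> A" for u by (induction u rule: UW.abs_induct)
  then show ?thesis by blast
qed


section \<open>Modules\<close>

text \<open>A left module over (a subring \<open>R\<close> of) the ring \<open>'r\<close>. The underlying abelian group is a subgroup
  of the group of all elements of the ambient type \<open>'v\<close>; outside the carrier (and for scalars
  outside \<open>R\<close>) the action is irrelevant.\<close>

record ('r, 'v) lmod =
  carr :: "'v set"
  act :: "'r \<Rightarrow> 'v \<Rightarrow> 'v"

type_synonym 'v wmod = "(UW, 'v) lmod"

definition add_subgroup :: "'v::ab_group_add set \<Rightarrow> bool" where
  "add_subgroup S \<longleftrightarrow> 0 \<in> S \<and> (\<forall>x\<in>S. \<forall>y\<in>S. x + y \<in> S) \<and> (\<forall>x\<in>S. - x \<in> S)"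

definition left_module :: "'r::ring_1 set \<Rightarrow> ('r, 'v::ab_group_add) lmod \<Rightarrow> bool" where
  "left_module R M \<longleftrightarrow>
     add_subgroup (carr M) \<and>
     (\<forall>r\<in>R. \<forall>x\<in>carr M. act M r x \<in> carr M) \<and>
     (\<forall>r\<in>R. \<forall>x\<in>carr M. \<forall>y\<in>carr M. act M r (x + y) = act M r x + act M r y) \<and>
     (\<forall>r\<in>R. \<forall>s\<in>R. \<forall>x\<in>carr M. act M (r + s) x = act M r x + act M s x) \<and>
     (\<forall>r\<in>R. \<forall>s\<in>R. \<forall>x\<in>carr M. act M (r * s) x = act M r (act M s x)) \<and>
     (\<forall>x\<in>carr M. act M 1 x = x)"

abbreviation w_module :: "'v::ab_group_add wmod \<Rightarrow> bool" where
  "w_module \<equiv> left_module UNIV"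

abbreviation cscale :: "'v wmod \<Rightarrow> complex \<Rightarrow> 'v \<Rightarrow> 'v" where
  "cscale M c \<equiv> act M (scal c)"

definition w_hom :: "'v::ab_group_add wmod \<Rightarrow> 'w::ab_group_add wmod \<Rightarrow> ('v \<Rightarrow> 'w) \<Rightarrow> bool" where
  "w_hom M N f \<longleftrightarrow>
     f ` carr M \<subseteq> carr N \<and>
     (\<forall>x\<in>carr M. \<forall>y\<in>carr M. f (x + y) = f x + f y) \<and>
     (\<forall>u. \<forall>x\<in>carr M. f (act M u x) = act N u (f x))"

definition submodule :: "'v::ab_group_add wmod \<Rightarrow> 'v set \<Rightarrow> bool" where
  "submodule M S \<longleftrightarrow> S \<subseteq> carr M \<and> add_subgroup S \<and> (\<forall>u. \<forall>x\<in>S. act M u x \<in> S)"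

definition simple_module :: "'v::ab_group_add wmod \<Rightarrow> bool" where
  "simple_module M \<longleftrightarrow>
     w_module M \<and> carr M \<noteq> {0} \<and> (\<forall>S. submodule M S \<longrightarrow> S = {0} \<or> S = carr M)"

definition finitely_generated :: "'v::ab_group_add wmod \<Rightarrow> bool" where
  "finitely_generated M \<longleftrightarrow>
     (\<exists>F. finite F \<and> F \<subseteq> carr M \<and> (\<forall>S. submodule M S \<longrightarrow> F \<subseteq> S \<longrightarrow> S = carr M))"

definition weight_space :: "'v::ab_group_add wmod \<Rightarrow> complex \<Rightarrow> 'v set" where
  "weight_space M l = {v \<in> carr M. act M (inc (d 0)) v = cscale M l v}"

definition weight_module :: "'v::ab_group_add wmod \<Rightarrow> bool" where
  "weight_module M \<longleftrightarrow>
     (\<forall>v\<in>carr M. \<exists>!f :: complex \<Rightarrow>\<^sub>0 'v.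
        (\<forall>l. Poly_Mapping.lookup f l \<in> weight_space M l) \<and>
        v = (\<Sum>l\<in>Poly_Mapping.keys f. Poly_Mapping.lookup f l))"

definition finite_dimensional :: "'v::ab_group_add wmod \<Rightarrow> 'v set \<Rightarrow> bool" where
  "finite_dimensional M X \<longleftrightarrow>
     (\<exists>B. finite B \<and> B \<subseteq> X \<and> X = {\<Sum>b\<in>B. cscale M (c b) b | c. True})"

definition category_O :: "'v::ab_group_add wmod \<Rightarrow> bool" where
  "category_O M \<longleftrightarrow>
     w_module M \<and> finitely_generated M \<and> weight_module M \<and>
     (\<forall>v\<in>carr M. finite_dimensional M {act M u v | u. u \<in> U_sub W_plus})"


section \<open>Verma modules and their simple quotients\<close>

text \<open>\<open>\<complex>\<^sub>\<lambda>\<close> as a \<open>U(\<bb>)\<close>-module, with \<open>v\<^sub>\<lambda> = 1\<close>.\<close>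

definition one_dim_module :: "complex \<Rightarrow> complex wmod \<Rightarrow> bool" where
  "one_dim_module l C \<longleftrightarrow>
     left_module (U_sub b_sub) C \<and> carr C = UNIV \<and>
     (\<forall>c z. cscale C c z = c * z) \<and>
     (\<forall>x\<in>W_plus. \<forall>z. act C (inc x) z = 0) \<and>
     (\<forall>z. act C (inc (d 0)) z = l * z)"

text \<open>The tensor product of \<open>U(\<WW>)\<close> with a left module \<open>C\<close> over a subring \<open>B\<close> is the quotient of the
  free abelian group on the pairs \<open>(u, z)\<close> by the subgroup generated by the following relations.
  Here \<open>D\<close> is a tensor product if it is isomorphic to that quotient, that is, if there is a
  surjective additive map \<open>\<pi>\<close> with that kernel which carries the left multiplication to the action.\<close>

abbreviation pure :: "UW \<Rightarrow> 'c \<Rightarrow> (UW \<times> 'c) \<Rightarrow>\<^sub>0 int" where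
  "pure u z \<equiv> Poly_Mapping.single (u, z) 1"

definition tensor_relations :: "UW set \<Rightarrow> 'c::ab_group_add wmod \<Rightarrow> ((UW \<times> 'c) \<Rightarrow>\<^sub>0 int) set" where
  "tensor_relations B C =
     {pure (u + u') z - pure u z - pure u' z | u u' z. z \<in> carr C} \<union>
     {pure u (z + z') - pure u z - pure u z' | u z z'. z \<in> carr C \<and> z' \<in> carr C} \<union>
     {pure (u * b) z - pure u (act C b z) | u b z. b \<in> B \<and> z \<in> carr C}"

definition is_tensor_product ::
    "UW set \<Rightarrow> 'c::ab_group_add wmod \<Rightarrow> 'v::ab_group_add wmod \<Rightarrow> bool" where
  "is_tensor_product B C D \<longleftrightarrow>
     w_module D \<and>
     (\<exists>\<pi> :: ((UW \<times> 'c) \<Rightarrow>\<^sub>0 int) \<Rightarrow> 'v.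
        let F = {f. Poly_Mapping.keys f \<subseteq> UNIV \<times> carr C} in
        (\<forall>f\<in>F. \<forall>g\<in>F. \<pi> (f + g) = \<pi> f + \<pi> g) \<and>
        \<pi> ` F = carr D \<and>
        {f \<in> F. \<pi> f = 0} = add_subgroup hull tensor_relations B C \<and>
        (\<forall>u u'. \<forall>z\<in>carr C. act D u (\<pi> (pure u' z)) = \<pi> (pure (u * u') z)))"

definition is_verma :: "complex \<Rightarrow> 'v::ab_group_add wmod \<Rightarrow> bool" where
  "is_verma l D \<longleftrightarrow> (\<exists>C. one_dim_module l C \<and> is_tensor_product (U_sub b_sub) C D)"

definition is_simple_quotient :: "'v::ab_group_add wmod \<Rightarrow> 'w::ab_group_add wmod \<Rightarrow> bool" where
  "is_simple_quotient D L \<longleftrightarrow> simple_module L \<and> (\<exists>q. w_hom D L q \<and> q ` carr D = carr L)"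


section \<open>Extensions\<close>

text \<open>A triple \<open>(K, i, p)\<close> stands for a sequence \<open>0 \<rightarrow> N \<rightarrow> K \<rightarrow> M \<rightarrow> 0\<close>.\<close>

type_synonym ('n, 'k, 'm) extension = "'k wmod \<times> ('n \<Rightarrow> 'k) \<times> ('k \<Rightarrow> 'm)"

definition short_exact ::
    "'n::ab_group_add wmod \<Rightarrow> 'm::ab_group_add wmod \<Rightarrow> ('n, 'k::ab_group_add, 'm) extension \<Rightarrow> bool"
  where
  "short_exact N M = (\<lambda>(K, i, p).
     w_module K \<and> w_hom N K i \<and> w_hom K M p \<and>
     inj_on i (carr N) \<and> i ` carr N = {k \<in> carr K. p k = 0} \<and> p ` carr K = carr M)"

text \<open>\<open>push \<alpha> N E E'\<close> states that there is a map of sequences \<open>(\<alpha>, \<psi>, id)\<close> from \<open>E\<close> to \<open>E'\<close>. For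
  \<open>\<alpha> = id\<close> this is equivalence of extensions (by the five lemma \<open>\<psi>\<close> is then an isomorphism); in
  general it says that \<open>E'\<close> is, up to equivalence, the pushout \<open>\<alpha>E\<close> of \<open>E\<close> along \<open>\<alpha>\<close>.\<close>

definition push ::
    "('n \<Rightarrow> 'n') \<Rightarrow> 'n set \<Rightarrow> ('n, 'k::ab_group_add, 'm) extension \<Rightarrow>
     ('n', 'l::ab_group_add, 'm) extension \<Rightarrow> bool" where
  "push \<alpha> N = (\<lambda>(K, i, p) (K', i', p').
     \<exists>\<psi>. w_hom K K' \<psi> \<and> (\<forall>n\<in>N. \<psi> (i n) = i' (\<alpha> n)) \<and> (\<forall>k\<in>carr K. p' (\<psi> k) = p k))"

text \<open>The middle terms have to range over a fixed type. By \<open>category_O_universe\<close> below, subspaces of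
  \<open>\<complex>[x]\<close> (with an arbitrary action) provide all objects of category O up to isomorphism, hence all
  extensions up to equivalence.\<close>

type_synonym universe = "complex poly"

lemma category_O_universe:
  fixes M :: "'v::ab_group_add wmod"
  assumes "category_O M"
  shows "\<exists>K f. w_module (K :: universe wmod) \<and> w_hom K M f \<and> bij_betw f (carr K) (carr M)"
proof -
  have wm: "w_module M" and fg: "finitely_generated M"
    using assms by (auto simp: category_O_def)
  have M0: "0 \<in> carr M" and Madd: "x \<in> carr M \<Longrightarrow> y \<in> carr M \<Longrightarrow> x + y \<in> carr M"
    and Mneg: "x \<in> carr M \<Longrightarrow> - x \<in> carr M"
    and Mact: "x \<in> carr M \<Longrightarrow> act M u x \<in> carr M"
    and aR: "x \<in> carr M \<Longrightarrow> y \<in> carr M \<Longrightarrow> act M u (x + y) = act M u x + act M u y"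
    and aL: "x \<in> carr M \<Longrightarrow> act M (u + u') x = act M u x + act M u' x"
    and aM: "x \<in> carr M \<Longrightarrow> act M (u * u') x = act M u (act M u' x)"
    and a1: "x \<in> carr M \<Longrightarrow> act M 1 x = x" for x y u u'
    using wm by (auto simp: left_module_def add_subgroup_def)
  have a0: "act M u 0 = 0" for u using aR[OF M0 M0, of u] by simp
  have aZ: "act M 0 x = 0" if "x \<in> carr M" for x using aL[OF that, of 0 0] by simp
  have s0: "scal 0 = 0" using scal_add[of 0 0] by simp
  have Msum: "(\<Sum>n\<in>A. g n) \<in> carr M" if "\<And>n. n \<in> A \<Longrightarrow> g n \<in> carr M" for g and A :: "nat set"
    using that by (induction A rule: infinite_finite_induct) (auto simp: M0 Madd)
  have asum: "act M u (\<Sum>n\<in>A. g n) = (\<Sum>n\<in>A. act M u (g n))"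
    if "\<And>n. n \<in> A \<Longrightarrow> g n \<in> carr M" for g u and A :: "nat set"
    using that by (induction A rule: infinite_finite_induct) (auto simp: a0 aR Msum)
  obtain F where F: "finite F" "F \<subseteq> carr M" "\<And>S. submodule M S \<Longrightarrow> F \<subseteq> S \<Longrightarrow> S = carr M"
    using fg by (auto simp: finitely_generated_def)
  obtain xs where xs: "set xs = F" using F(1) finite_list by blast
  define gx where "gx n = (if n < length xs then xs ! n else 0)" for n
  have gx: "gx n \<in> carr M" for n using F(2) xs by (auto simp: gx_def M0)
  define wd where "wd w = fold (\<lambda>n v. act M (inc (d (int n - 1))) v) w" for w
  have wd: "v \<in> carr M \<Longrightarrow> wd w v \<in> carr M" for w v
    by (induction w arbitrary: v) (auto simp: wd_def Mact)
  define e where "e n = (case prod_decode n of (k, m) \<Rightarrow> wd (list_decode k) (gx m))" for n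
  have e: "e n \<in> carr M" for n by (auto simp: e_def wd gx split: prod.split)
  have e_act: "\<exists>m. act M (inc (d i)) (e n) = e m" if "i \<ge> -1" for i n
  proof -
    obtain k m where km: "prod_decode n = (k, m)" by force
    have "act M (inc (d i)) (e n) = e (prod_encode (list_encode (list_decode k @ [nat (i + 1)]), m))"
      using that by (simp add: e_def km wd_def)
    then show ?thesis by blast
  qed
  define \<phi> where "\<phi> p = (\<Sum>n\<le>degree p. cscale M (coeff p n) (e n))" for p
  have \<phi>_N: "\<phi> p = (\<Sum>n\<le>N. cscale M (coeff p n) (e n))" if "degree p \<le> N" for p N
    unfolding \<phi>_def using that
    by (intro sum.mono_neutral_left) (auto simp: coeff_eq_0 s0 aZ e)
  have \<phi>_in: "\<phi> p \<in> carr M" for p unfolding \<phi>_def by (intro Msum Mact e)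
  have \<phi>_add: "\<phi> (p + q) = \<phi> p + \<phi> q" for p q
    using \<phi>_N[of p "max (degree p) (degree q)"] \<phi>_N[of q "max (degree p) (degree q)"]
      \<phi>_N[of "p + q" "max (degree p) (degree q)"]
    by (simp add: degree_add_le scal_add aL e sum.distrib)
  have \<phi>_smult: "\<phi> (smult c p) = cscale M c (\<phi> p)" for c p
    using \<phi>_N[of "smult c p" "degree p"]
    by (simp add: degree_smult_le scal_mult aM e asum Mact \<phi>_def)
  have \<phi>_0: "\<phi> 0 = 0" using \<phi>_smult[of 0 0] by (simp add: s0 aZ \<phi>_in)
  have \<phi>_neg: "\<phi> (- p) = - \<phi> p" for p
    using \<phi>_add[of p "- p"] \<phi>_0 by (simp add: eq_neg_iff_add_eq_0 add.commute)
  have \<phi>_diff: "\<phi> (p - q) = \<phi> p - \<phi> q" for p q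
    using \<phi>_add[of p "- q"] \<phi>_neg by simp
  have \<phi>_sum: "\<phi> (\<Sum>n\<in>A. g n) = (\<Sum>n\<in>A. \<phi> (g n))" for g and A :: "nat set"
    by (induction A rule: infinite_finite_induct) (auto simp: \<phi>_0 \<phi>_add)
  have \<phi>_monom: "\<phi> (monom 1 n) = e n" for n
  proof -
    have "\<phi> (monom 1 n) = (\<Sum>k\<le>n. cscale M (coeff (monom 1 n) k) (e k))"
      by (rule \<phi>_N) (simp add: degree_monom_eq)
    also have "\<dots> = (\<Sum>k\<le>n. if k = n then e k else 0)"
      by (intro sum.cong) (auto simp: scal_1 a1 e s0 aZ)
    finally show ?thesis by simp
  qed
  have "{u. \<forall>x\<in>range \<phi>. act M u x \<in> range \<phi>} = UNIV"
  proof (rule subalgebra_UNIV_iff)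
    show "subalgebra {u. \<forall>x\<in>range \<phi>. act M u x \<in> range \<phi>}"
      unfolding subalgebra_def
    proof (intro conjI ballI subsetI CollectI)
      fix u x assume "u \<in> range scal" "x \<in> range \<phi>"
      then show "act M u x \<in> range \<phi>" by (auto simp flip: \<phi>_smult)
    next
      fix a b x assume ab: "a \<in> {u. \<forall>x\<in>range \<phi>. act M u x \<in> range \<phi>}"
        "b \<in> {u. \<forall>x\<in>range \<phi>. act M u x \<in> range \<phi>}" and x: "x \<in> range \<phi>"
      have xM: "x \<in> carr M" using x \<phi>_in by auto
      obtain p where p: "act M a x = \<phi> p" using ab(1) x by blast
      obtain q where q: "act M b x = \<phi> q" using ab(2) x by blast
      show "act M (a + b) x \<in> range \<phi>" using aL[OF xM, of a b] p q \<phi>_add by (metis rangeI)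
      show "act M (a * b) x \<in> range \<phi>" using aM[OF xM, of a b] q ab(1) by auto
    qed
  next
    fix i :: int assume i: "i \<ge> -1"
    have "act M (inc (d i)) (\<phi> p) \<in> range \<phi>" for p
    proof -
      obtain h where h: "\<And>n. act M (inc (d i)) (e n) = e (h n)" using e_act[OF i] by metis
      have "act M (inc (d i)) (\<phi> p)
          = (\<Sum>n\<le>degree p. act M (inc (d i)) (cscale M (coeff p n) (e n)))"
        unfolding \<phi>_def by (rule asum) (simp add: Mact e)
      also have "\<dots> = (\<Sum>n\<le>degree p. cscale M (coeff p n) (act M (inc (d i)) (e n)))"
        by (intro sum.cong refl) (simp add: e scal_commute flip: aM)
      also have "\<dots> = \<phi> (\<Sum>n\<le>degree p. smult (coeff p n) (monom 1 (h n)))"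
        by (simp add: \<phi>_sum \<phi>_smult \<phi>_monom h)
      finally show ?thesis by simp
    qed
    then show "inc (d i) \<in> {u. \<forall>x\<in>range \<phi>. act M u x \<in> range \<phi>}" by auto
  qed
  then have act_\<phi>: "act M u (\<phi> p) \<in> range \<phi>" for u p by blast
  have "submodule M (range \<phi>)"
    unfolding submodule_def add_subgroup_def
    using \<phi>_in act_\<phi> \<phi>_0 \<phi>_add \<phi>_neg by (auto simp flip: \<phi>_add \<phi>_neg)
  moreover have "F \<subseteq> range \<phi>"
  proof
    fix x assume "x \<in> F"
    then obtain m where m: "m < length xs" "x = xs ! m" using xs by (metis in_set_conv_nth)
    then have "x = e (prod_encode (list_encode [], m))"
      by (simp add: e_def wd_def gx_def)
    then show "x \<in> range \<phi>" using \<phi>_monom by (metis rangeI)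
  qed
  ultimately have surj: "range \<phi> = carr M" by (rule F(3))
  interpret V: vector_space "smult :: complex \<Rightarrow> complex poly \<Rightarrow> complex poly"
    by standard (auto simp: smult_add_right smult_add_left)
  interpret VV: vector_space_pair "smult :: complex \<Rightarrow> complex poly \<Rightarrow> complex poly" smult ..
  define Ker where "Ker = {p. \<phi> p = 0}"
  have "V.subspace Ker"
    unfolding V.subspace_def Ker_def by (auto simp: \<phi>_0 \<phi>_add \<phi>_smult a0)
  then have "\<exists>g. g ` UNIV \<subseteq> Ker \<and> Vector_Spaces.linear smult smult g \<and> (\<forall>v\<in>Ker. g (id v) = v)"
    by (intro VV.linear_exists_left_inverse_on) (auto simp: V.linear_ident id_def)
  then obtain g where g: "\<And>p. g p \<in> Ker" "Vector_Spaces.linear smult smult g" "\<And>v. v \<in> Ker \<Longrightarrow> g v = v"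
    by auto
  interpret g: Vector_Spaces.linear smult smult g by fact
  define Z where "Z = {p. g p = 0}"
  have Z: "0 \<in> Z" "p \<in> Z \<Longrightarrow> q \<in> Z \<Longrightarrow> p + q \<in> Z" "p \<in> Z \<Longrightarrow> - p \<in> Z" for p q
    by (auto simp: Z_def g.zero g.add g.neg)
  have inj: "inj_on \<phi> Z"
  proof (rule inj_onI)
    fix p q assume pq: "p \<in> Z" "q \<in> Z" "\<phi> p = \<phi> q"
    then have "p - q \<in> Ker" by (simp add: Ker_def \<phi>_diff)
    then have "p - q = g (p - q)" using g(3) by simp
    also have "\<dots> = 0" using pq by (simp add: g.diff Z_def)
    finally show "p = q" by simp
  qed
  have im: "\<phi> ` Z = carr M"
  proof -
    have *: "\<phi> p \<in> \<phi> ` Z" for p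
    proof
      show "\<phi> p = \<phi> (p - g p)" using g(1)[of p] by (simp add: \<phi>_diff Ker_def)
      show "p - g p \<in> Z" using g(3)[OF g(1)[of p]] by (simp add: Z_def g.diff)
    qed
    show ?thesis
    proof (intro equalityI subsetI)
      fix x assume "x \<in> carr M"
      then obtain p where "x = \<phi> p" unfolding surj[symmetric] by (rule rangeE)
      then show "x \<in> \<phi> ` Z" using * by (simp only:)
    next
      fix x assume "x \<in> \<phi> ` Z"
      then obtain p where "x = \<phi> p" by (rule imageE)
      then show "x \<in> carr M" using \<phi>_in by (simp only:)
    qed
  qed
  define \<theta> where "\<theta> = inv_into Z \<phi>"
  have \<theta>: "x \<in> carr M \<Longrightarrow> \<theta> x \<in> Z" "x \<in> carr M \<Longrightarrow> \<phi> (\<theta> x) = x" for x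
    unfolding \<theta>_def using inv_into_into[of x \<phi> Z] f_inv_into_f[of x \<phi> Z] by (simp_all only: im)
  have eqZ: "p = q" if "p \<in> Z" "q \<in> Z" "\<phi> p = \<phi> q" for p q using inj_onD[OF inj that(3,1,2)] .
  define K :: "universe wmod" where "K = \<lparr>carr = Z, act = (\<lambda>u p. \<theta> (act M u (\<phi> p)))\<rparr>"
  have K: "carr K = Z" "act K u p = \<theta> (act M u (\<phi> p))" for u p by (simp_all add: K_def)
  have \<phi>K: "\<phi> (act K u p) = act M u (\<phi> p)" and KZ: "act K u p \<in> Z" for u p
    unfolding K by (simp_all add: \<theta> Mact \<phi>_in)
  have "w_module K"
    unfolding left_module_def add_subgroup_def K(1)
  proof (intro conjI ballI)
    fix u u' p q assume pq: "p \<in> Z" "q \<in> Z"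
    show "act K u (p + q) = act K u p + act K u q"
      by (rule eqZ) (simp_all only: Z KZ pq \<phi>K \<phi>_add aR[OF \<phi>_in \<phi>_in])
    show "act K (u + u') p = act K u p + act K u' p"
      by (rule eqZ) (simp_all only: Z KZ pq \<phi>K \<phi>_add aL[OF \<phi>_in])
    show "act K (u * u') p = act K u (act K u' p)"
      by (rule eqZ) (simp_all only: Z KZ pq \<phi>K aM[OF \<phi>_in])
    show "act K 1 p = p"
      by (rule eqZ) (simp_all only: Z KZ pq \<phi>K a1[OF \<phi>_in])
  qed (simp_all add: Z KZ)
  moreover have "w_hom K M \<phi>"
    unfolding w_hom_def by (auto simp: \<phi>_in \<phi>_add \<phi>K)
  moreover have "bij_betw \<phi> (carr K) (carr M)"
    using inj im by (simp add: bij_betw_def K)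
  ultimately show ?thesis by blast
qed

definition extensions_O ::
    "'m::ab_group_add wmod \<Rightarrow> 'n::ab_group_add wmod \<Rightarrow> ('n, universe, 'm) extension set" where
  "extensions_O M N = {(K, i, p). category_O K \<and> short_exact N M (K, i, p)}"

definition ext_equiv ::
    "'m::ab_group_add wmod \<Rightarrow> 'n::ab_group_add wmod \<Rightarrow>
     (('n, universe, 'm) extension \<times> ('n, universe, 'm) extension) set" where
  "ext_equiv M N = {(E, E'). E \<in> extensions_O M N \<and> E' \<in> extensions_O M N \<and> push id (carr N) E E'}"

definition Ext1_O ::
    "'m::ab_group_add wmod \<Rightarrow> 'n::ab_group_add wmod \<Rightarrow> ('n, universe, 'm) extension set set" where
  "Ext1_O M N = extensions_O M N // ext_equiv M N"

text \<open>The pullback of the direct sum of two extensions of \<open>M\<close> by \<open>N\<close> along the diagonal of \<open>M\<close>; the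
  Baer sum is its pushout along the addition map of \<open>N\<close>.\<close>

definition diagonal_pullback ::
    "('n, 'k, 'm) extension \<Rightarrow> ('n, 'l, 'm) extension \<Rightarrow> ('n \<times> 'n, 'k \<times> 'l, 'm) extension" where
  "diagonal_pullback = (\<lambda>(K, i, p) (K', i', p').
     (\<lparr>carr = {(k, k'). k \<in> carr K \<and> k' \<in> carr K' \<and> p k = p' k'},
       act = (\<lambda>u (k, k'). (act K u k, act K' u k'))\<rparr>,
      (\<lambda>(n, n'). (i n, i' n')),
      (\<lambda>(k, k'). p k)))"

definition baer_sum ::
    "'m::ab_group_add wmod \<Rightarrow> 'n::ab_group_add wmod \<Rightarrow> ('n, universe, 'm) extension set \<Rightarrow>
     ('n, universe, 'm) extension set \<Rightarrow> ('n, universe, 'm) extension set" where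
  "baer_sum M N X Y = {E \<in> extensions_O M N. \<exists>E1\<in>X. \<exists>E2\<in>Y.
     push (\<lambda>(n, n'). n + n') (carr N \<times> carr N) (diagonal_pullback E1 E2) E}"

definition ext_scale ::
    "'m::ab_group_add wmod \<Rightarrow> 'n::ab_group_add wmod \<Rightarrow> complex \<Rightarrow> ('n, universe, 'm) extension set \<Rightarrow>
     ('n, universe, 'm) extension set" where
  "ext_scale M N c X = {E \<in> extensions_O M N. \<exists>E1\<in>X. push (cscale N c) (carr N) E1 E}"

text \<open>Isomorphism of a complex vector space, given by a carrier and its operations, with a subspace
  \<open>Y\<close> of the one-dimensional space \<open>\<complex>\<close>.\<close>

definition complex_linear_iso ::
    "'x set \<Rightarrow> ('x \<Rightarrow> 'x \<Rightarrow> 'x) \<Rightarrow> (complex \<Rightarrow> 'x \<Rightarrow> 'x) \<Rightarrow> complex set \<Rightarrow> bool" where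
  "complex_linear_iso X add scale Y \<longleftrightarrow>
     (\<forall>a\<in>X. \<forall>b\<in>X. add a b \<in> X) \<and> (\<forall>c. \<forall>a\<in>X. scale c a \<in> X) \<and>
     (\<exists>\<phi>. bij_betw \<phi> X Y \<and>
        (\<forall>a\<in>X. \<forall>b\<in>X. \<phi> (add a b) = \<phi> a + \<phi> b) \<and>
        (\<forall>c. \<forall>a\<in>X. \<phi> (scale c a) = c * \<phi> a))"

end

theory Submission
  imports Defs
begin

text \<open>A simple quotient \<open>L(\<mu>)\<close> is generated by a highest weight vector \<open>m\<close>, and the annihilator of \<open>m\<close>
  is the left ideal generated by \<open>d\<^sub>0 - \<mu>\<close> and the \<open>d\<^sub>j\<close> with \<open>j \<ge> a\<close>. Here \<open>a = 1\<close> if \<open>\<mu> \<noteq> 0\<close>, because the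
  Verma module is then simple, and \<open>a = -1\<close> if \<open>\<mu> = 0\<close>, because \<open>L(0)\<close> is the trivial module. An extension
  of \<open>L(\<mu>)\<close> by \<open>N\<close> in category O contains a vector \<open>v\<close> of weight \<open>\<mu>\<close> above \<open>m\<close>, and its failure to satisfy
  these relations is the family \<open>c\<^sub>j = d\<^sub>j v\<close> of vectors of \<open>N\<close>, of weight \<open>\<mu> + j\<close>. The family obeys a cocycle identity,
  and replacing \<open>v\<close> by \<open>v + n\<close> with \<open>n\<close> of weight \<open>\<mu>\<close> in \<open>N\<close> adds the coboundary \<open>d\<^sub>j n\<close>. Since the relations
  generate the annihilator, nothing else can obstruct a map of extensions: such a map exists iff the
  cocycles agree up to a coboundary (\<open>push_iff\<close>). Baer sum and scalar multiplication become the
  operations on cocycles, and the extension space is found as soon as a linear functional on cocycles is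
  known that vanishes exactly on the coboundaries (\<open>Ext1_linear_iso\<close>).

  Let \<open>f\<^sub>n = (-1)\<^sup>n / n! d\<^sub>-\<^sub>1\<^sup>n v\<close>, where \<open>v\<close> is the highest weight vector of \<open>L(\<lambda>)\<close>. Then
  \<open>d\<^sub>i f\<^sub>n = (i - n + (i + 1) \<lambda>) f\<^sub>n\<^sub>-\<^sub>i\<close>, and for \<open>\<lambda> \<noteq> 0\<close> the \<open>f\<^sub>n\<close> form a basis. If both weights are nonzero and
  \<open>\<lambda> - \<mu> = k\<close> is a positive integer, a cocycle is \<open>c\<^sub>j = g\<^sub>j f\<^sub>k\<^sub>-\<^sub>j\<close>, and the cocycle identity is a system of linear equations
  (\<open>density_eq\<close>) that determines all \<open>g\<^sub>j\<close> from \<open>g\<^sub>1\<close> and \<open>g\<^sub>2\<close>. For \<open>k \<ge> 2\<close> the functional is the determinant of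
  \<open>(g\<^sub>1, g\<^sub>2)\<close> against the coboundary of \<open>f\<^sub>k\<close>. Up to \<open>k = 4\<close> there is no condition on \<open>g\<^sub>1, g\<^sub>2\<close>. From
  \<open>k = 5\<close> on there are two ways to compute \<open>g\<^sub>5\<close>, and they agree iff the determinant vanishes or
  \<open>(2\<lambda> - k + 1)\<^sup>2 = 3k + 1\<close>. For \<open>k = 5\<close> this means \<open>\<lambda> = 4\<close>, for \<open>k = 6\<close> it means \<open>\<lambda> = (5 \<plusminus> \<surd>19) / 2\<close>, and for \<open>k \<ge> 7\<close> the
  equations in degree seven then require \<open>k (k - 1)\<close> times the determinant to vanish. The cases in which a weight is
  zero follow from the weights of the \<open>c\<^sub>j\<close> and a few instances of the cocycle identity.

  Conversely a cocycle has to be realized in category O. For \<open>\<mu> \<noteq> 0\<close> the extension is built on \<open>N \<times> \<complex>[t]\<close>, where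
  \<open>t\<^sup>m\<close> stands for \<open>d\<^sub>-\<^sub>1\<^sup>m\<close> applied to the new generator: the action on the generator is prescribed by the
  cocycle, commutation with \<open>d\<^sub>-\<^sub>1\<close> forces it everywhere else, and the Jacobi identity shows that the bracket
  relations spread from the generator to the whole space. For \<open>\<mu> = 0\<close> the split extension and the Verma module
  \<open>\<Delta>(0)\<close>, an extension of \<open>L(0)\<close> by \<open>L(-1)\<close>, suffice.\<close>

section \<open>Modules over the enveloping algebra and their weight vectors\<close>

abbreviation D :: "int \<Rightarrow> UW" where
  "D i \<equiv> inc (d i)"

lemma scal_0 [simp]: "scal 0 = 0"
  using scal_add[of 0 0] by simp

lemma scal_uminus: "scal (- c) = - scal c"
  using scal_add[of c "- c"] by (simp add: eq_neg_iff_add_eq_0 add.commute)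

lemma D_commutator:
  assumes "i \<ge> -1" "j \<ge> -1"
  shows "D i * D j = D j * D i + scal (of_int (j - i)) * D (i + j)"
  using inc_bracket[of "d i" "d j", symmetric]
  unfolding bracket_d[OF assms] inc_scale diff_eq_eq by (simp only: add.commute)

locale wmod =
  fixes M :: "'v::ab_group_add wmod"
  assumes w_module: "w_module M"
begin

lemma zero_mem [simp]: "0 \<in> carr M"
  and add_mem [simp]: "x \<in> carr M \<Longrightarrow> y \<in> carr M \<Longrightarrow> x + y \<in> carr M"
  and uminus_mem [simp]: "x \<in> carr M \<Longrightarrow> - x \<in> carr M"
  and act_mem [simp]: "x \<in> carr M \<Longrightarrow> act M u x \<in> carr M"
  and act_add_right: "x \<in> carr M \<Longrightarrow> y \<in> carr M \<Longrightarrow> act M u (x + y) = act M u x + act M u y"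
  and act_add_left: "x \<in> carr M \<Longrightarrow> act M (u + u') x = act M u x + act M u' x"
  and act_mult: "x \<in> carr M \<Longrightarrow> act M (u * u') x = act M u (act M u' x)"
  and act_one [simp]: "x \<in> carr M \<Longrightarrow> act M 1 x = x"
  using w_module by (auto simp: left_module_def add_subgroup_def)

lemma diff_mem [simp]: "x \<in> carr M \<Longrightarrow> y \<in> carr M \<Longrightarrow> x - y \<in> carr M"
  using add_mem[of x "- y"] by simp

lemma sum_mem: "(\<And>n. n \<in> A \<Longrightarrow> g n \<in> carr M) \<Longrightarrow> (\<Sum>n\<in>A. g n) \<in> carr M"
  by (induction A rule: infinite_finite_induct) auto

lemma act_zero_right [simp]: "act M u 0 = 0"
  using act_add_right[of 0 0 u] by simp

lemma act_zero_left [simp]: "x \<in> carr M \<Longrightarrow> act M 0 x = 0"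
  using act_add_left[of x 0 0] by simp

lemma act_uminus_right: "x \<in> carr M \<Longrightarrow> act M u (- x) = - act M u x"
  using act_add_right[of x "- x" u] by (simp add: eq_neg_iff_add_eq_0 add.commute)

lemma act_uminus_left: "x \<in> carr M \<Longrightarrow> act M (- u) x = - act M u x"
  using act_add_left[of x u "- u"] by (simp add: eq_neg_iff_add_eq_0 add.commute)

lemma act_diff_right: "x \<in> carr M \<Longrightarrow> y \<in> carr M \<Longrightarrow> act M u (x - y) = act M u x - act M u y"
  using act_add_right[of x "- y" u] by (simp add: act_uminus_right)

lemma act_diff_left: "x \<in> carr M \<Longrightarrow> act M (u - u') x = act M u x - act M u' x"
  using act_add_left[of x u "- u'"] by (simp add: act_uminus_left)

lemma act_sum_right:
  "(\<And>n. n \<in> A \<Longrightarrow> g n \<in> carr M) \<Longrightarrow> act M u (\<Sum>n\<in>A. g n) = (\<Sum>n\<in>A. act M u (g n))"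
  by (induction A rule: infinite_finite_induct) (auto simp: act_add_right sum_mem)

lemma act_sum_left:
  "x \<in> carr M \<Longrightarrow> act M (\<Sum>n\<in>A. g n) x = (\<Sum>n\<in>A. act M (g n) x)"
  by (induction A rule: infinite_finite_induct) (auto simp: act_add_left)

lemma cscale_one [simp]: "x \<in> carr M \<Longrightarrow> cscale M 1 x = x"
  by (simp add: scal_1)

lemma cscale_add: "x \<in> carr M \<Longrightarrow> cscale M (a + b) x = cscale M a x + cscale M b x"
  by (simp add: scal_add act_add_left)

lemma cscale_uminus: "x \<in> carr M \<Longrightarrow> cscale M (- a) x = - cscale M a x"
  by (simp add: scal_uminus act_uminus_left)

lemma cscale_diff: "x \<in> carr M \<Longrightarrow> cscale M (a - b) x = cscale M a x - cscale M b x"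
  using cscale_add[of x a "- b"] by (simp add: cscale_uminus)

lemma cscale_cscale [simp]: "x \<in> carr M \<Longrightarrow> cscale M a (cscale M b x) = cscale M (a * b) x"
  by (simp add: scal_mult act_mult)

lemma act_cscale: "x \<in> carr M \<Longrightarrow> act M u (cscale M c x) = cscale M c (act M u x)"
  by (simp add: scal_commute flip: act_mult)

lemma D_cscale: "x \<in> carr M \<Longrightarrow> act M (D i) (cscale M c x) = cscale M c (act M (D i) x)"
  by (rule act_cscale)

lemma cscale_eq_0_iff: "x \<in> carr M \<Longrightarrow> cscale M c x = 0 \<longleftrightarrow> c = 0 \<or> x = 0"
proof -
  assume x: "x \<in> carr M"
  have "x = 0" if "cscale M c x = 0" "c \<noteq> 0"
    using x that cscale_cscale[OF x, of "inverse c" c] by simp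
  then show ?thesis using x by auto
qed

lemma D_D:
  assumes "i \<ge> -1" "j \<ge> -1" "x \<in> carr M"
  shows "act M (D i) (act M (D j) x)
    = act M (D j) (act M (D i) x) + cscale M (of_int (j - i)) (act M (D (i + j)) x)"
  unfolding act_mult[OF assms(3), symmetric] act_add_left[OF assms(3), symmetric]
    act_mult[OF act_mem[OF assms(3)], symmetric] D_commutator[OF assms(1,2)] ..

lemma weight_space_mem: "x \<in> weight_space M l \<Longrightarrow> x \<in> carr M"
  and weight_space_eq: "x \<in> weight_space M l \<Longrightarrow> act M (D 0) x = cscale M l x"
  by (auto simp: weight_space_def)

lemma weight_space_zero [simp]: "0 \<in> weight_space M l"
  by (simp add: weight_space_def)

lemma weight_space_add:
  "x \<in> weight_space M l \<Longrightarrow> y \<in> weight_space M l \<Longrightarrow> x + y \<in> weight_space M l"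
  by (simp add: weight_space_def act_add_right)

lemma weight_space_cscale: "x \<in> weight_space M l \<Longrightarrow> cscale M c x \<in> weight_space M l"
  by (auto simp: weight_space_def D_cscale mult.commute)

lemma weight_space_diff:
  "x \<in> weight_space M l \<Longrightarrow> y \<in> weight_space M l \<Longrightarrow> x - y \<in> weight_space M l"
  by (simp add: weight_space_def act_diff_right)

lemma weight_space_sum:
  "(\<And>n. n \<in> A \<Longrightarrow> g n \<in> weight_space M l) \<Longrightarrow> (\<Sum>n\<in>A. g n) \<in> weight_space M l"
  by (induction A rule: infinite_finite_induct) (auto intro: weight_space_add)

lemma weight_space_D:
  assumes "x \<in> weight_space M l" "i \<ge> -1"
  shows "act M (D i) x \<in> weight_space M (l + of_int i)"
proof -
  note x = weight_space_mem[OF assms(1)] weight_space_eq[OF assms(1)]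
  show ?thesis
    using D_D[of 0 i x] x assms(2)
    by (simp add: weight_space_def D_cscale cscale_add add.commute)
qed

lemma weight_space_D_power:
  "x \<in> weight_space M l \<Longrightarrow> act M (D (-1) ^ n) x \<in> weight_space M (l - of_nat n)"
proof (induction n)
  case 0
  then show ?case using weight_space_mem by simp
next
  case (Suc n)
  from weight_space_D[OF Suc.IH[OF Suc.prems], of "-1"] show ?case
    using weight_space_mem[OF Suc.prems] by (simp add: act_mult algebra_simps)
qed

text \<open>Eigenvectors of \<open>d\<^sub>0\<close> for distinct eigenvalues: applying \<open>d\<^sub>0 - k\<close> removes the component of weight \<open>k\<close> and
  scales the others by nonzero factors.\<close>

lemma weight_vectors_independent:
  assumes "finite S" "\<And>l. l \<in> S \<Longrightarrow> x l \<in> weight_space M l" "(\<Sum>l\<in>S. x l) = 0" "l \<in> S"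
  shows "x l = 0"
  using assms
proof (induction S arbitrary: x l rule: finite_induct)
  case empty
  then show ?case by simp
next
  case (insert k S)
  have xc: "x l \<in> carr M" if "l \<in> insert k S" for l
    using insert.prems(1)[OF that] by (rule weight_space_mem)
  have sum: "x k + (\<Sum>l\<in>S. x l) = 0" using insert by simp
  have shift: "act M (D 0 - scal k) (x l) = cscale M (l - k) (x l)" if "l \<in> insert k S" for l
    using xc[OF that] insert.prems(1)[OF that] by (simp add: act_diff_left weight_space_eq cscale_diff)
  have "0 = act M (D 0 - scal k) (x k + (\<Sum>l\<in>S. x l))" by (simp add: sum)
  also have "\<dots> = act M (D 0 - scal k) (x k) + (\<Sum>l\<in>S. act M (D 0 - scal k) (x l))"
    using xc by (simp add: act_add_right act_sum_right sum_mem)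
  also have "\<dots> = (\<Sum>l\<in>S. cscale M (l - k) (x l))"
    using xc by (simp add: shift)
  finally have "(\<Sum>l\<in>S. cscale M (l - k) (x l)) = 0" by simp
  from insert.IH[of "\<lambda>l. cscale M (l - k) (x l)", OF _ this]
  have S0: "x l = 0" if "l \<in> S" for l
    using that insert.prems(1) insert.hyps xc by (metis weight_space_cscale cscale_eq_0_iff insertCI right_minus_eq)
  then have "x k = 0" using sum by simp
  then show ?case using S0 insert.prems(3) by auto
qed

text \<open>This replaces a projection onto a weight space: a weight vector written as a sum of vectors of pairwise
  distinct weights only meets the summand of its own weight.\<close>

lemma weight_component:
  assumes A: "finite A" "inj_on w A" "\<And>n. n \<in> A \<Longrightarrow> x n \<in> weight_space M (w n)"
    and y: "y \<in> weight_space M l" "y = (\<Sum>n\<in>A. x n)"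
  shows "y = (\<Sum>n\<in>{n\<in>A. w n = l}. x n)" and "n \<in> A \<Longrightarrow> w n \<noteq> l \<Longrightarrow> x n = 0"
proof -
  define z where "z k = (\<Sum>n\<in>{n\<in>A. w n = k}. x n) - (if k = l then y else 0)" for k
  define S where "S = insert l (w ` A)"
  have S: "finite S" using A by (simp add: S_def)
  have z: "z k \<in> weight_space M k" for k
    unfolding z_def using y A by (auto intro!: weight_space_diff weight_space_sum)
  have "(\<Sum>k\<in>S. z k) = (\<Sum>k\<in>S. \<Sum>n\<in>{n\<in>A. w n = k}. x n) - (\<Sum>k\<in>S. if k = l then y else 0)"
    by (simp add: z_def sum_subtractf)
  also have "(\<Sum>k\<in>S. \<Sum>n\<in>{n\<in>A. w n = k}. x n) = (\<Sum>n\<in>A. x n)"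
    using A S by (intro sum.group) (auto simp: S_def)
  also have "(\<Sum>k\<in>S. if k = l then y else 0) = y" using S by (simp add: S_def)
  finally have "(\<Sum>k\<in>S. z k) = 0" using y by simp
  then have z0: "z k = 0" if "k \<in> S" for k
    using weight_vectors_independent[of S z k] z S that by blast
  show "y = (\<Sum>n\<in>{n\<in>A. w n = l}. x n)" using z0[of l] by (simp add: z_def S_def)
  show "x n = 0" if n: "n \<in> A" "w n \<noteq> l" for n
  proof -
    have "{m\<in>A. w m = w n} = {n}" using n A(2) by (auto dest: inj_onD)
    then show ?thesis using z0[of "w n"] n by (simp add: z_def S_def)
  qed
qed

end

lemma weight_module_weight_decomposition:
  fixes M :: "'a::ab_group_add wmod"
  assumes "weight_module M" "x \<in> carr M"
  obtains S y where "finite S" "\<And>l. y l \<in> weight_space M l" "x = (\<Sum>l\<in>S. y l)"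
proof -
  obtain f :: "complex \<Rightarrow>\<^sub>0 'a" where
    "\<forall>l. Poly_Mapping.lookup f l \<in> weight_space M l" "x = (\<Sum>l\<in>Poly_Mapping.keys f. Poly_Mapping.lookup f l)"
    using assms unfolding weight_module_def by blast
  then show thesis using that[of "Poly_Mapping.keys f" "Poly_Mapping.lookup f"] by simp
qed

lemma (in wmod) weight_moduleI:
  assumes "\<And>x. x \<in> carr M \<Longrightarrow> \<exists>f :: complex \<Rightarrow>\<^sub>0 'v.
    (\<forall>l. Poly_Mapping.lookup f l \<in> weight_space M l) \<and> x = (\<Sum>l\<in>Poly_Mapping.keys f. Poly_Mapping.lookup f l)"
  shows "weight_module M"
  unfolding weight_module_def
proof
  fix x assume "x \<in> carr M"
  then obtain f :: "complex \<Rightarrow>\<^sub>0 'v"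
    where f: "\<forall>l. Poly_Mapping.lookup f l \<in> weight_space M l" "x = (\<Sum>l\<in>Poly_Mapping.keys f. Poly_Mapping.lookup f l)"
    using assms by blast
  show "\<exists>!f :: complex \<Rightarrow>\<^sub>0 'v.
    (\<forall>l. Poly_Mapping.lookup f l \<in> weight_space M l) \<and> x = (\<Sum>l\<in>Poly_Mapping.keys f. Poly_Mapping.lookup f l)"
  proof (rule ex1I[of _ f], use f in blast)
    fix g :: "complex \<Rightarrow>\<^sub>0 'v"
    assume g: "(\<forall>l. Poly_Mapping.lookup g l \<in> weight_space M l) \<and> x = (\<Sum>l\<in>Poly_Mapping.keys g. Poly_Mapping.lookup g l)"
    define S where "S = Poly_Mapping.keys f \<union> Poly_Mapping.keys g"
    have "(\<Sum>l\<in>S. Poly_Mapping.lookup h l) = (\<Sum>l\<in>Poly_Mapping.keys h. Poly_Mapping.lookup h l)"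
      if "Poly_Mapping.keys h \<subseteq> S" for h :: "complex \<Rightarrow>\<^sub>0 'v"
      using that by (intro sum.mono_neutral_right) (auto simp: S_def in_keys_iff)
    then have "(\<Sum>l\<in>S. Poly_Mapping.lookup g l - Poly_Mapping.lookup f l) = 0"
      using f g by (simp add: sum_subtractf S_def)
    then have eq: "Poly_Mapping.lookup g l - Poly_Mapping.lookup f l = 0" if "l \<in> S" for l
      using weight_vectors_independent[of S "\<lambda>l. Poly_Mapping.lookup g l - Poly_Mapping.lookup f l" l] f g that
      by (auto simp: S_def intro: weight_space_diff)
    show "g = f"
    proof (rule poly_mapping_eqI)
      fix l
      show "Poly_Mapping.lookup g l = Poly_Mapping.lookup f l"
        using eq[of l] by (cases "l \<in> S") (auto simp: S_def in_keys_iff)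
    qed
  qed
qed

section \<open>Highest weight vectors\<close>

text \<open>Substitution of \<open>d\<^sub>-\<^sub>1\<close> for the variable, written with a fold because the enveloping algebra is not commutative.\<close>

definition ev :: "complex poly \<Rightarrow> UW" where
  "ev p = fold_coeffs (\<lambda>a u. scal a + D (-1) * u) p 0"

lemma ev_0 [simp]: "ev 0 = 0"
  by (simp add: ev_def)

lemma ev_pCons: "ev (pCons a p) = scal a + D (-1) * ev p"
  by (cases "a = 0 \<and> p = 0") (auto simp: ev_def)

lemma ev_1 [simp]: "ev 1 = 1"
  by (simp add: one_pCons ev_pCons scal_1)

lemma ev_add: "ev (p + q) = ev p + ev q"
  by (induction p q rule: poly_induct2) (simp_all add: ev_pCons scal_add algebra_simps)

lemma ev_smult: "ev (smult c p) = scal c * ev p"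
proof (induction p)
  case (pCons a p)
  have "scal c * (D (-1) * ev p) = D (-1) * (scal c * ev p)"
    by (metis mult.assoc scal_commute)
  then show ?case using pCons by (simp add: ev_pCons scal_mult distrib_left)
qed simp

lemma ev_eq_sum: "ev p = (\<Sum>n\<le>degree p. scal (coeff p n) * D (-1) ^ n)"
proof (induction p)
  case (pCons a p)
  have "D (-1) * ev p = (\<Sum>n\<le>degree p. scal (coeff p n) * D (-1) ^ Suc n)"
    unfolding pCons.IH sum_distrib_left
    by (intro sum.cong refl) (metis mult.assoc power_Suc scal_commute)
  then show ?case
    by (cases "p = 0") (simp_all add: ev_pCons sum.atMost_Suc_shift del: sum.atMost_Suc)
qed simp

text \<open>The generators appear with an arbitrary left factor, so that the induction rule reduces a statement about
  the ideal to the elements \<open>u * r\<close>.\<close>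

inductive_set left_ideal :: "UW set \<Rightarrow> UW set" for R where
  zero: "0 \<in> left_ideal R"
| add: "x \<in> left_ideal R \<Longrightarrow> y \<in> left_ideal R \<Longrightarrow> x + y \<in> left_ideal R"
| generator: "r \<in> R \<Longrightarrow> u * r \<in> left_ideal R"

lemma left_ideal_mult: "x \<in> left_ideal R \<Longrightarrow> u * x \<in> left_ideal R"
  by (induction rule: left_ideal.induct)
    (auto simp: distrib_left simp flip: mult.assoc intro: left_ideal.intros)

lemma left_ideal_generator: "r \<in> R \<Longrightarrow> r \<in> left_ideal R"
  using left_ideal.generator[of r R 1] by simp

text \<open>The relations of a highest weight vector of weight \<open>l\<close> for \<open>a = 1\<close>, and of the trivial module for
  \<open>a = -1\<close>, \<open>l = 0\<close>.\<close>

definition hw_relations :: "int \<Rightarrow> complex \<Rightarrow> UW set" where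
  "hw_relations a l = insert (D 0 - scal l) (D ` {a..})"

definition plus_left_ideal :: "UW set \<Rightarrow> UW set \<Rightarrow> UW set" where
  "plus_left_ideal S R = {s + j | s j. s \<in> S \<and> j \<in> left_ideal R}"

lemma plus_left_idealI: "s \<in> S \<Longrightarrow> j \<in> left_ideal R \<Longrightarrow> s + j \<in> plus_left_ideal S R"
  by (auto simp: plus_left_ideal_def)

lemma plus_left_ideal_add:
  assumes "\<And>s t. s \<in> S \<Longrightarrow> t \<in> S \<Longrightarrow> s + t \<in> S" "x \<in> plus_left_ideal S R" "y \<in> plus_left_ideal S R"
  shows "x + y \<in> plus_left_ideal S R"
proof -
  obtain s j t k where x: "s \<in> S" "j \<in> left_ideal R" "x = s + j" and y: "t \<in> S" "k \<in> left_ideal R" "y = t + k"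
    using assms by (auto simp: plus_left_ideal_def)
  have "(s + t) + (j + k) \<in> plus_left_ideal S R"
    by (intro plus_left_idealI assms(1) left_ideal.add) (use x y in auto)
  then show ?thesis using x y by (simp add: algebra_simps)
qed

lemma plus_left_ideal_mult:
  assumes "\<And>s t. s \<in> S \<Longrightarrow> t \<in> S \<Longrightarrow> s + t \<in> S" "0 \<in> S"
    and "\<And>s. s \<in> S \<Longrightarrow> u * s \<in> plus_left_ideal S R" "x \<in> plus_left_ideal S R"
  shows "u * x \<in> plus_left_ideal S R"
proof -
  obtain s j where x: "s \<in> S" "j \<in> left_ideal R" "x = s + j"
    using assms(4) by (auto simp: plus_left_ideal_def)
  have "0 + u * j \<in> plus_left_ideal S R"
    using assms(2) x(2) by (intro plus_left_idealI left_ideal_mult)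
  then show ?thesis
    using plus_left_ideal_add[OF assms(1) assms(3)[OF x(1)]] x(3) by (simp add: distrib_left)
qed

text \<open>The spanning half of the PBW theorem: with \<open>J\<close> the left ideal, \<open>S + J\<close> is stable under left
  multiplication by the generators \<open>d\<^sub>i\<close> and contains \<open>1\<close>, hence it is everything.\<close>

lemma plus_left_ideal_UNIV:
  assumes S: "\<And>s t. s \<in> S \<Longrightarrow> t \<in> S \<Longrightarrow> s + t \<in> S" "\<And>s c. s \<in> S \<Longrightarrow> scal c * s \<in> S" "1 \<in> S"
    and D: "\<And>s i. s \<in> S \<Longrightarrow> i \<ge> -1 \<Longrightarrow> D i * s \<in> plus_left_ideal S R"
  shows "u \<in> plus_left_ideal S R"
proof -
  let ?A = "plus_left_ideal S R"
  have 0: "0 \<in> S" using S(2)[OF S(3), of 0] by simp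
  have S_A: "s \<in> ?A" if "s \<in> S" for s using plus_left_idealI[OF that left_ideal.zero] by simp
  have "{w. \<forall>x\<in>?A. w * x \<in> ?A} = UNIV"
  proof (rule subalgebra_UNIV_iff)
    have "scal c * x \<in> ?A" if "x \<in> ?A" for c x
      by (rule plus_left_ideal_mult[OF S(1) 0 S_A[OF S(2)] that])
    then show "subalgebra {w. \<forall>x\<in>?A. w * x \<in> ?A}"
      using plus_left_ideal_add[OF S(1)] by (auto simp: subalgebra_def distrib_right mult.assoc)
    show "D i \<in> {w. \<forall>x\<in>?A. w * x \<in> ?A}" if "i \<ge> -1" for i
      using plus_left_ideal_mult[OF S(1) 0 D[OF _ that]] by blast
  qed
  then have "u * 1 \<in> ?A" using S_A[OF S(3)] by blast
  then show ?thesis by simp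
qed

text \<open>The Verma module is spanned by the \<open>d\<^sub>-\<^sub>1\<^sup>n v\<close>. Moving \<open>d\<^sub>i\<close> past \<open>d\<^sub>-\<^sub>1\<close> costs a multiple of
  \<open>d\<^sub>i\<^sub>-\<^sub>1\<close>, so \<open>d\<^sub>i ev p\<close> is treated by induction on \<open>p\<close> for all \<open>i\<close> at once.\<close>

lemma hw_ideal_complement: "\<exists>p. \<exists>j\<in>left_ideal (hw_relations 1 l). u = ev p + j"
proof -
  let ?R = "hw_relations 1 l"
  let ?A = "plus_left_ideal (range ev) ?R"
  have add: "s + t \<in> range ev" if "s \<in> range ev" "t \<in> range ev" for s t
    using that by (auto simp flip: ev_add)
  have scl: "scal c * s \<in> range ev" if "s \<in> range ev" for s c
    using that by (auto simp flip: ev_smult)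
  have low: "D (-1) * s \<in> range ev" if "s \<in> range ev" for s
  proof -
    obtain p where "s = ev p" using \<open>s \<in> range ev\<close> by blast
    then have "D (-1) * s = ev (pCons 0 p)" by (simp add: ev_pCons)
    then show ?thesis by simp
  qed
  have one: "1 \<in> range ev" using ev_1 by (metis rangeI)
  have zero: "0 \<in> range ev" using ev_0 by (metis rangeI)
  have S_A: "s \<in> ?A" if "s \<in> range ev" for s using plus_left_idealI[OF that left_ideal.zero] by simp
  note A_add = plus_left_ideal_add[OF add]
  have A_scal: "scal c * x \<in> ?A" and A_lower: "D (-1) * x \<in> ?A" if "x \<in> ?A" for c x
    by (rule plus_left_ideal_mult[OF add zero S_A[OF scl] that], assumption+)
      (rule plus_left_ideal_mult[OF add zero S_A[OF low] that], assumption+)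
  have D_A: "D i \<in> ?A" if i: "i \<ge> 0" for i
  proof (cases "i = 0")
    case True
    have "scal l + (D 0 - scal l) \<in> ?A"
      using scl[OF one, of l]
      by (intro plus_left_idealI left_ideal_generator) (simp_all add: hw_relations_def)
    then show ?thesis using True by simp
  next
    case False
    then have "0 + D i \<in> ?A"
      using i zero by (intro plus_left_idealI left_ideal_generator) (simp_all add: hw_relations_def)
    then show ?thesis by simp
  qed
  have D_ev: "D i * ev p \<in> ?A" if "i \<ge> -1" for i p
    using that
  proof (induction p arbitrary: i)
    case 0
    then show ?case using S_A[OF zero] by simp
  next
    case (pCons a p)
    show ?case
    proof (cases "i = -1")
      case True
      then show ?thesis using S_A low by simp
    next
      case False
      then have i: "i \<ge> 0" using pCons.prems by simp
      have "D i * ev (pCons a p) = scal a * D i + (D i * D (-1)) * ev p"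
        by (simp add: ev_pCons distrib_left scal_commute mult.assoc)
      also have "D i * D (-1) = D (-1) * D i + scal (of_int (- 1 - i)) * D (i - 1)"
        using D_commutator[of i "-1"] i by simp
      finally have "D i * ev (pCons a p) =
          scal a * D i + (D (-1) * (D i * ev p) + scal (of_int (- 1 - i)) * (D (i - 1) * ev p))"
        by (simp add: distrib_right mult.assoc)
      moreover have "D (i - 1) * ev p \<in> ?A" "D i * ev p \<in> ?A"
        using pCons.IH i by auto
      ultimately show ?thesis using A_add A_scal A_lower D_A[OF i] by metis
    qed
  qed
  have "u \<in> ?A" by (rule plus_left_ideal_UNIV[OF add scl one]) (use D_ev in auto)
  then show ?thesis by (auto simp: plus_left_ideal_def)
qed

lemma trivial_ideal_complement: "\<exists>c. \<exists>j\<in>left_ideal (hw_relations (-1) 0). u = scal c + j"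
proof -
  have "u \<in> plus_left_ideal (range scal) (hw_relations (-1) 0)"
  proof (rule plus_left_ideal_UNIV)
    show "1 \<in> range scal" using scal_1 by (metis rangeI)
    show "D i * s \<in> plus_left_ideal (range scal) (hw_relations (-1) 0)" if s: "s \<in> range scal" and i: "i \<ge> -1" for s i
    proof -
      have "0 \<in> range scal" using scal_0 by (metis rangeI)
      then have "0 + s * D i \<in> plus_left_ideal (range scal) (hw_relations (-1) 0)"
        using i by (intro plus_left_idealI left_ideal.generator) (simp_all add: hw_relations_def)
      moreover have "D i * s = s * D i" using s scal_commute by auto
      ultimately show ?thesis by simp
    qed
  qed (auto simp flip: scal_add scal_mult)
  then show ?thesis by (auto simp: plus_left_ideal_def)
qed

context wmod
begin

lemma act_ev:
  "x \<in> carr M \<Longrightarrow>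
    act M (ev p) x = (\<Sum>n\<le>degree p. cscale M (coeff p n) (act M (D (-1) ^ n) x))"
  unfolding ev_eq_sum by (simp add: act_sum_left act_mult)

lemma left_ideal_kills:
  assumes "\<And>r. r \<in> R \<Longrightarrow> act M r x = 0" "x \<in> carr M" "u \<in> left_ideal R"
  shows "act M u x = 0"
  using assms(3,1,2) by (induction rule: left_ideal.induct) (auto simp: act_add_left act_mult)

end

lemma submodule_cyclic:
  assumes "wmod M" "x \<in> carr M"
  shows "submodule M {act M u x | u. True}"
proof -
  interpret wmod M by fact
  show ?thesis
    unfolding submodule_def add_subgroup_def
  proof (intro conjI ballI allI subsetI)
    show "0 \<in> {act M u x | u. True}" by (intro CollectI exI[of _ 0]) (simp add: assms)
  qed (use assms(2) in \<open>auto simp flip: act_add_left act_mult act_uminus_left\<close>)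
qed

locale hw_vector = wmod M for M :: "'v::ab_group_add wmod" +
  fixes v :: 'v and l :: complex
  assumes v_weight: "v \<in> weight_space M l" and raise_v: "i \<ge> 1 \<Longrightarrow> act M (D i) v = 0"
begin

lemma v_mem [simp]: "v \<in> carr M"
  using v_weight by (rule weight_space_mem)

text \<open>The normalization makes all structure constants linear in the indices (\<open>D_f\<close>), as in the dual of a tensor density
  module. With the value \<open>0\<close> at negative indices the formula holds for all integers.\<close>

definition f :: "int \<Rightarrow> 'v" where
  "f m = (if m < 0 then 0
    else cscale M ((-1) ^ nat m / fact (nat m)) (act M (D (-1) ^ nat m) v))"

lemma f_mem [simp]: "f m \<in> carr M"
  by (simp add: f_def)

lemma f_neg: "m < 0 \<Longrightarrow> f m = 0"
  by (simp add: f_def)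

lemma f_0: "f 0 = v"
  by (simp add: f_def)

lemma D_power_v: "act M (D (-1) ^ n) v = cscale M ((-1) ^ n * fact n) (f (int n))"
  by (simp add: f_def flip: power_mult_distrib)

lemma f_weight: "f m \<in> weight_space M (l - of_int m)"
proof (cases "m < 0")
  case False
  then have "of_int m = (of_nat (nat m) :: complex)" by simp
  then show ?thesis
    using False weight_space_D_power[OF v_weight, of "nat m"] by (simp add: f_def weight_space_cscale)
qed (simp add: f_neg)

lemma lower_f: "act M (D (-1)) (f m) = cscale M (- of_int (m + 1)) (f (m + 1))"
proof (cases "m < 0")
  case True
  then show ?thesis by (cases "m = -1") (simp_all add: f_neg)
next
  case False
  then obtain n where m: "m = int n" by (metis not_less nat_0_le)
  have "(- 1) ^ n / fact n = - of_nat (Suc n) * ((- 1) ^ Suc n / fact (Suc n) :: complex)"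
    by (simp add: divide_simps del: of_nat_Suc)
  moreover have "nat (int n + 1) = Suc n" "- of_int (int n + 1) = - (of_nat (Suc n) :: complex)" by simp_all
  ultimately show ?thesis
    unfolding m f_def by (simp add: D_cscale act_mult del: of_nat_Suc fact_Suc power_Suc) (simp add: act_mult)
qed

text \<open>Induction on \<open>m\<close> by \<open>[d\<^sub>i, d\<^sub>-\<^sub>1] = - (i + 1) d\<^sub>i\<^sub>-\<^sub>1\<close>, using that \<open>f (m + 1)\<close> is a nonzero multiple of \<open>d\<^sub>-\<^sub>1 f m\<close>.\<close>

lemma D_f: "i \<ge> -1 \<Longrightarrow>
    act M (D i) (f m) = cscale M (of_int (i - m) + of_int (i + 1) * l) (f (m - i))"
proof -
  have nat: "act M (D i) (f (int n)) = cscale M (of_int (i - int n) + of_int (i + 1) * l) (f (int n - i))"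
    if "i \<ge> -1" for n i
    using that
  proof (induction n arbitrary: i)
    case 0
    consider "i = -1" | "i = 0" | "i \<ge> 1" using 0 by linarith
    then show ?case
    proof cases
      case 1
      then show ?thesis using lower_f[of 0] by simp
    next
      case 2
      then show ?thesis using weight_space_eq[OF v_weight] by (simp add: f_0)
    next
      case 3
      then show ?thesis using raise_v[OF 3] by (simp add: f_0 f_neg)
    qed
  next
    case (Suc n)
    show ?case
    proof (cases "i = -1")
      case True
      then show ?thesis using lower_f[of "int (Suc n)"] by simp
    next
      case False
      then have i: "i \<ge> 0" using Suc.prems by simp
      let ?g = "f (int n - i + 1)"
      have "cscale M (- of_nat (Suc n)) (act M (D i) (f (int (Suc n)))) = act M (D i) (act M (D (-1)) (f (int n)))"
        by (simp add: lower_f D_cscale add.commute)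
      also have "\<dots> = act M (D (-1)) (act M (D i) (f (int n)))
          + cscale M (of_int (- 1 - i)) (act M (D (i + - 1)) (f (int n)))"
        using i by (intro D_D) auto
      also have "act M (D (-1)) (act M (D i) (f (int n)))
          = cscale M ((of_int (i - int n) + of_int (i + 1) * l) * - of_int (int n - i + 1)) ?g"
        using Suc.IH[of i] i by (simp add: D_cscale lower_f)
      also have "act M (D (i + - 1)) (f (int n))
          = cscale M (of_int (i - 1 - int n) + of_int i * l) ?g"
        using Suc.IH[of "i + -1"] i by (simp add: algebra_simps)
      also have "cscale M ((of_int (i - int n) + of_int (i + 1) * l) * - of_int (int n - i + 1)) ?g
          + cscale M (of_int (- 1 - i)) (cscale M (of_int (i - 1 - int n) + of_int i * l) ?g)
          = cscale M ((of_int (i - int n) + of_int (i + 1) * l) * - of_int (int n - i + 1)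
              + of_int (- 1 - i) * (of_int (i - 1 - int n) + of_int i * l)) ?g"
        by (simp only: cscale_cscale[OF f_mem] cscale_add[OF f_mem, symmetric])
      also have "(of_int (i - int n) + of_int (i + 1) * l) * - of_int (int n - i + 1)
              + of_int (- 1 - i) * (of_int (i - 1 - int n) + of_int i * l)
          = - of_nat (Suc n) * (of_int (i - int (Suc n)) + of_int (i + 1) * l)"
        by (simp add: algebra_simps)
      finally have "cscale M (- of_nat (Suc n)) (act M (D i) (f (int (Suc n))))
          = cscale M (- of_nat (Suc n)) (cscale M (of_int (i - int (Suc n)) + of_int (i + 1) * l) ?g)"
        by (simp only: cscale_cscale[OF f_mem])
      then have "cscale M (- of_nat (Suc n)) (act M (D i) (f (int (Suc n)))
          - cscale M (of_int (i - int (Suc n)) + of_int (i + 1) * l) ?g) = 0"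
        by (subst act_diff_right) auto
      then have "act M (D i) (f (int (Suc n)))
          - cscale M (of_int (i - int (Suc n)) + of_int (i + 1) * l) ?g = 0"
        by (subst (asm) cscale_eq_0_iff) (auto simp del: of_nat_Suc)
      then show ?thesis by (simp add: algebra_simps)
    qed
  qed
  assume i: "i \<ge> -1"
  show ?thesis
  proof (cases "m < 0")
    case True
    \<comment> \<open>the coefficient vanishes in the only case \<open>m = i = -1\<close> where the target index is not negative\<close>
    show ?thesis
    proof (cases "m - i < 0")
      case False
      then have "m = -1" "i = -1" using True i by linarith+
      then show ?thesis by (simp add: f_neg)
    qed (use True in \<open>simp add: f_neg\<close>)
  next
    case False
    then show ?thesis using nat[OF i, of "nat m"] by simp
  qed
qed

lemma hw_relations_kill: "r \<in> hw_relations 1 l \<Longrightarrow> act M r v = 0"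
  using weight_space_eq[OF v_weight] raise_v by (auto simp: hw_relations_def act_diff_left)

lemma orbit_eq_ev: "\<exists>p. act M u v = act M (ev p) v"
  using hw_ideal_complement[of l u] left_ideal_kills[of "hw_relations 1 l" v] hw_relations_kill
  by (auto simp: act_add_left)

text \<open>If \<open>f n\<close> is the first to vanish, applying \<open>d\<^sub>1\<close> and \<open>d\<^sub>2\<close> gives \<open>2 l = n - 1\<close> and \<open>3 l = n - 2\<close>, which has no
  solution with \<open>n \<ge> 2\<close>, while \<open>n = 1\<close> would force \<open>l = 0\<close>.\<close>

lemma f_nonzero:
  assumes "l \<noteq> 0" "v \<noteq> 0" "m \<ge> 0"
  shows "f m \<noteq> 0"
proof -
  have "f (int n) \<noteq> 0" for n
  proof (induction n rule: less_induct)
    case (less n)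
    show ?case
    proof
      assume fn: "f (int n) = 0"
      have 1: "of_int (1 - int n) + 2 * l = 0" if "n \<ge> 1"
        using D_f[of 1 "int n"] fn less.IH[of "n - 1"] that by (auto simp: cscale_eq_0_iff of_nat_diff)
      have 2: "of_int (2 - int n) + 3 * l = 0" if "n \<ge> 2"
        using D_f[of 2 "int n"] fn less.IH[of "n - 2"] that by (auto simp: cscale_eq_0_iff of_nat_diff)
      consider "n = 0" | "n = 1" | "n \<ge> 2" by linarith
      then show False
      proof cases
        case 1
        then show ?thesis using fn assms f_0 by simp
      next
        case 2
        then show ?thesis using 1 assms by simp
      next
        case 3
        have e: "2 * (of_int (2 - int n) + 3 * l) - 3 * (of_int (1 - int n) + 2 * l) = of_nat (n + 1)"
          by (simp add: algebra_simps)
        have z: "of_int (2 - int n) + 3 * l = 0" "of_int (1 - int n) + 2 * l = 0"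
          by (rule 2[OF 3], rule 1, use 3 in linarith)
        have "of_nat (n + 1) = (0::complex)" using e[unfolded z] by simp
        then show ?thesis by (simp only: of_nat_eq_0_iff)
      qed
    qed
  qed
  from this[of "nat m"] assms show ?thesis by simp
qed

lemma ev_eq_0_iff:
  assumes "l \<noteq> 0" "v \<noteq> 0"
  shows "act M (ev p) v = 0 \<longleftrightarrow> p = 0"
proof
  assume 0: "act M (ev p) v = 0"
  have "coeff p n = 0" if n: "n \<le> degree p" for n
  proof -
    have "cscale M (coeff p n) (act M (D (-1) ^ n) v) = 0"
    proof (rule weight_component(2)[where A = "{..degree p}" and w = "\<lambda>n. l - of_nat n" and y = 0 and l = "l + 1"])
      show "l - of_nat n \<noteq> l + 1"
      proof
        assume "l - of_nat n = l + 1"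
        then have "of_nat (n + 1) = (0::complex)" by (simp add: algebra_simps add_eq_0_iff)
        then show False by (simp only: of_nat_eq_0_iff)
      qed
    qed (use n 0 in \<open>auto simp: inj_on_def act_ev intro: weight_space_cscale weight_space_D_power v_weight\<close>)
    moreover have "act M (D (-1) ^ n) v \<noteq> 0"
      using f_nonzero[OF assms, of "int n"] by (simp add: D_power_v cscale_eq_0_iff)
    ultimately show ?thesis by (simp add: cscale_eq_0_iff)
  qed
  then show "p = 0" by (metis le_degree leading_coeff_0_iff order_refl)
qed auto

end

section \<open>Simple quotients of Verma modules\<close>

lemma subalgebra_U_sub: "subalgebra (U_sub \<aa>)"
  unfolding U_sub_def by (rule hull_in) (auto simp: subalgebra_def)

lemma scal_in_U_sub: "scal c \<in> U_sub \<aa>"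
  using subalgebra_U_sub[of \<aa>] by (auto simp: subalgebra_def)

lemma inc_in_U_sub: "x \<in> \<aa> \<Longrightarrow> inc x \<in> U_sub \<aa>"
  unfolding U_sub_def using hull_subset[of "inc ` \<aa>" subalgebra] by blast

lemma d_in_W_plus: "i > 0 \<Longrightarrow> d i \<in> W_plus"
  unfolding W_plus_def by (intro witt.span_base) auto

lemma d_in_b_sub: "i \<ge> 0 \<Longrightarrow> d i \<in> b_sub"
proof (cases "i = 0")
  case True
  have "d 0 = d 0 + 0" "d 0 \<in> h_sub" "0 \<in> W_plus"
    by (auto simp: h_sub_def W_plus_def intro: witt.span_base witt.span_zero)
  then show ?thesis using True unfolding b_sub_def by blast
next
  case False
  assume "i \<ge> 0"
  have "d i = 0 + d i" "0 \<in> h_sub" "d i \<in> W_plus"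
    using False \<open>i \<ge> 0\<close> d_in_W_plus[of i] by (auto simp: h_sub_def intro: witt.span_zero)
  then show ?thesis unfolding b_sub_def by blast
qed

text \<open>The generator is the class of \<open>1 \<otimes> 1\<close>. Scalars lie in \<open>U(\<bb>)\<close>, so every pure tensor can be written with
  second factor \<open>1\<close>.\<close>

lemma verma_hw_vector:
  fixes V :: "'v::ab_group_add wmod"
  assumes "is_verma l V"
  obtains v where "hw_vector V v l" "carr V = {act V u v | u. True}"
proof -
  obtain C where C: "one_dim_module l C" and T: "is_tensor_product (U_sub b_sub) C V"
    using assms by (auto simp: is_verma_def)
  have carrC: "carr C = UNIV" and scC: "cscale C c z = c * z"
    and WC: "x \<in> W_plus \<Longrightarrow> act C (inc x) z = 0" and hC: "act C (D 0) z = l * z" for c z x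
    using C by (auto simp: one_dim_module_def)
  interpret wmod V using T by unfold_locales (simp add: is_tensor_product_def)
  obtain \<pi> where add: "\<And>f g. \<pi> (f + g) = \<pi> f + \<pi> g" and surj: "range \<pi> = carr V"
    and ker: "{f. \<pi> f = 0} = add_subgroup hull tensor_relations (U_sub b_sub) C"
    and act: "\<And>u u' z. act V u (\<pi> (pure u' z)) = \<pi> (pure (u * u') z)"
    using T by (auto simp: is_tensor_product_def carrC Let_def)
  have rel: "\<pi> r = 0" if "r \<in> tensor_relations (U_sub b_sub) C" for r
    using hull_subset[of "tensor_relations (U_sub b_sub) C" add_subgroup] ker that by auto
  have pi0: "\<pi> 0 = 0" using add[of 0 0] by simp
  have neg: "\<pi> (- f) = - \<pi> f" for f
    using add[of f "- f"] pi0 by (simp add: eq_neg_iff_add_eq_0 add.commute)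
  have diff: "\<pi> (f - g) = \<pi> f - \<pi> g" for f g using add[of f "- g"] neg by simp
  have move: "\<pi> (pure (u * b) z) = \<pi> (pure u (act C b z))" if "b \<in> U_sub b_sub" for u b z
  proof -
    have "\<pi> (pure (u * b) z - pure u (act C b z)) = 0"
      using that by (intro rel) (unfold tensor_relations_def carrC, blast)
    then show ?thesis by (simp add: diff)
  qed
  have pure0: "\<pi> (pure u 0) = 0" for u
  proof -
    have "\<pi> (pure u (0 + 0) - pure u 0 - pure u 0) = 0"
      by (intro rel) (unfold tensor_relations_def carrC, blast)
    then show ?thesis by (simp add: diff neg)
  qed
  define v where "v = \<pi> (pure 1 1)"
  have v: "v \<in> carr V" using surj by (auto simp: v_def)
  have pure: "\<pi> (pure u z) = act V (u * scal z) v" for u z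
    using move[OF scal_in_U_sub, of u z 1] by (simp add: v_def act scC)
  have "hw_vector V v l"
  proof (unfold_locales)
    have "act V (D 0) v = \<pi> (pure (1 * D 0) 1)" by (simp add: v_def act)
    also have "\<dots> = \<pi> (pure 1 l)"
      by (subst move) (simp_all add: hC inc_in_U_sub d_in_b_sub)
    finally have "act V (D 0) v = cscale V l v" by (simp add: pure)
    then show "v \<in> weight_space V l" using v by (simp add: weight_space_def)
    fix i :: int assume i: "i \<ge> 1"
    have "act V (D i) v = \<pi> (pure (1 * D i) 1)" by (simp add: v_def act)
    also have "\<dots> = \<pi> (pure 1 0)"
      using i by (subst move) (simp_all add: WC d_in_W_plus inc_in_U_sub d_in_b_sub)
    finally show "act V (D i) v = 0" by (simp add: pure0)
  qed
  moreover have "carr V = {act V u v | u. True}"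
  proof -
    define S where "S = {act V u v | u. True}"
    have S_add: "x + y \<in> S" if "x \<in> S" "y \<in> S" for x y
      using that v by (auto simp: S_def simp flip: act_add_left)
    have S_neg: "- x \<in> S" if "x \<in> S" for x
      using that v by (auto simp: S_def simp flip: act_uminus_left)
    have S_0: "0 \<in> S" unfolding S_def using v by (intro CollectI exI[of _ 0]) simp
    have S_pure: "\<pi> (pure u z) \<in> S" for u z by (auto simp: pure S_def)
    have S_single: "\<pi> (Poly_Mapping.single k n) \<in> S" for k n
    proof (induction n rule: int_induct[where k = 0])
      case base
      then show ?case by (simp add: pi0 S_0)
    next
      case (step1 i)
      then show ?case using S_add[OF step1(2) S_pure[of "fst k" "snd k"]] by (simp add: single_add add)
    next
      case (step2 i)
      then show ?case using S_add[OF step2(2) S_neg[OF S_pure[of "fst k" "snd k"]]]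
        by (simp add: single_diff diff)
    qed
    have "\<pi> f \<in> S" for f
    proof (induction f rule: update_induct)
      case const
      then show ?case by (simp add: pi0 S_0)
    next
      case (update f a b)
      have "Poly_Mapping.update a b f = Poly_Mapping.single a b + f"
        using update(1) by (intro poly_mapping_eqI)
          (auto simp: lookup_update lookup_add lookup_single when_def in_keys_iff)
      then show ?case using S_add[OF S_single update(3)] by (simp add: add)
    qed
    then have "carr V \<subseteq> S" unfolding surj[symmetric] by (rule image_subsetI)
    moreover have "S \<subseteq> carr V" using v by (auto simp: S_def)
    ultimately show ?thesis by (auto simp: S_def)
  qed
  ultimately show thesis by (rule that)
qed

lemma simple_module_orbit:
  assumes "simple_module L" "x \<in> carr L" "x \<noteq> 0"
  shows "carr L = {act L u x | u. True}"
proof -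
  interpret wmod L using assms by unfold_locales (simp add: simple_module_def)
  have "submodule L {act L u x | u. True}"
    by (rule submodule_cyclic) (use assms wmod_axioms in auto)
  moreover have "x \<in> {act L u x | u. True}" using assms by (intro CollectI exI[of _ 1]) simp
  ultimately show ?thesis using assms by (auto simp: simple_module_def)
qed

text \<open>By \<open>D_f\<close> the vector \<open>d\<^sub>-\<^sub>1 v\<close> of weight \<open>-1\<close> is again killed by all \<open>d\<^sub>i\<close> with \<open>i \<ge> 1\<close>. If it were nonzero it would generate the simple
  module, but the weights in its orbit are \<open>-1, -2, \<dots>\<close>, so \<open>v\<close> is not reached.\<close>

lemma (in hw_vector) simple_weight_zero:
  assumes "simple_module M" "l = 0" "v \<noteq> 0"
  shows "act M (D (-1)) v = 0"
proof (rule ccontr)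
  define w where "w = f 1"
  assume "act M (D (-1)) v \<noteq> 0"
  then have w0: "w \<noteq> 0"
    using D_power_v[of 1] by (auto simp: w_def)
  have w: "w \<in> carr M" by (simp add: w_def)
  interpret W: hw_vector M w "-1"
  proof
    show "w \<in> weight_space M (-1)" using f_weight[of 1] assms(2) by (simp add: w_def)
    show "act M (D i) w = 0" if "i \<ge> 1" for i
      using that assms(2) D_f[of i 1] by (cases "i = 1") (auto simp: w_def f_neg)
  qed
  have "v \<in> {act M u w | u. True}"
    using simple_module_orbit[OF assms(1) w w0] v_mem by simp
  then obtain u where "v = act M u w" by blast
  with W.orbit_eq_ev[of u] obtain p where "v = act M (ev p) w" by auto
  then have p: "v = (\<Sum>n\<le>degree p. cscale M (coeff p n) (act M (D (-1) ^ n) w))"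
    by (simp add: act_ev w)
  have "v = (\<Sum>n\<in>{n\<in>{..degree p}. - 1 - of_nat n = l}. cscale M (coeff p n) (act M (D (-1) ^ n) w))"
    by (rule weight_component(1)[where w = "\<lambda>n. - 1 - of_nat n" and l = l])
      (use v_weight p in \<open>auto simp: inj_on_def intro!: weight_space_cscale weight_space_D_power W.v_weight\<close>)
  also have "{n\<in>{..degree p}. - 1 - of_nat n = l} = {}"
  proof -
    have "- 1 - of_nat n \<noteq> (0::complex)" for n
    proof
      assume "- 1 - of_nat n = (0::complex)"
      then have "of_nat (n + 1) = (0::complex)" by (simp add: algebra_simps add_eq_0_iff)
      then show False by (simp only: of_nat_eq_0_iff)
    qed
    then show ?thesis using assms(2) by auto
  qed
  finally show False using assms(3) by simp
qed

locale simple_hw_module = hw_vector +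
  assumes v_nonzero: "v \<noteq> 0" and simple: "simple_module M"
begin

lemma carr_orbit: "carr M = {act M u v | u. True}"
  using simple v_nonzero by (intro simple_module_orbit) auto

lemma carr_ev: "x \<in> carr M \<Longrightarrow> \<exists>p. x = act M (ev p) v"
  using orbit_eq_ev unfolding carr_orbit by blast

lemma D_v_trivial:
  assumes "l = 0" "j \<ge> -1"
  shows "act M (D j) v = 0"
proof -
  consider "j = -1" | "j = 0" | "j \<ge> 1" using assms(2) by linarith
  then show ?thesis
    using simple_weight_zero[OF simple assms(1) v_nonzero] raise_v weight_space_eq[OF v_weight] assms(1)
    by cases auto
qed

lemma carr_trivial:
  assumes "l = 0" "x \<in> carr M"
  shows "\<exists>c. x = cscale M c v"
proof -
  obtain u where u: "x = act M u v" using assms(2) carr_orbit by auto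
  obtain c j where "j \<in> left_ideal (hw_relations (-1) 0)" "u = scal c + j"
    using trivial_ideal_complement by blast
  moreover have "act M r v = 0" if "r \<in> hw_relations (-1) 0" for r
    using that D_v_trivial[OF assms(1)] by (auto simp: hw_relations_def act_diff_left)
  ultimately show ?thesis
    using u left_ideal_kills[of "hw_relations (-1) 0" v j] by (auto simp: act_add_left)
qed

lemma weight_space_cases:
  assumes "l \<noteq> 0" "x \<in> weight_space M k"
  shows "(\<exists>n. k = l - of_nat n \<and> (\<exists>c. x = cscale M c (f (int n)))) \<or> (\<forall>n. k \<noteq> l - of_nat n) \<and> x = 0"
proof -
  obtain p where p: "x = act M (ev p) v" using carr_ev weight_space_mem[OF assms(2)] by blast
  have x: "x = (\<Sum>n\<le>degree p. cscale M (coeff p n) (act M (D (-1) ^ n) v))"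
    using p by (simp add: act_ev)
  define A where "A = {n\<in>{..degree p}. l - of_nat n = k}"
  have xA: "x = (\<Sum>n\<in>A. cscale M (coeff p n) (act M (D (-1) ^ n) v))"
    unfolding A_def
    by (rule weight_component(1)[where w = "\<lambda>n. l - of_nat n" and l = k])
      (use assms(2) x in \<open>auto simp: inj_on_def intro!: weight_space_cscale weight_space_D_power v_weight\<close>)
  show ?thesis
  proof (cases "\<exists>n. k = l - of_nat n")
    case True
    then obtain n where n: "k = l - of_nat n" by blast
    have "A \<subseteq> {n}" using n by (auto simp: A_def)
    then consider "A = {}" | "A = {n}" by blast
    then have "\<exists>c. x = cscale M c (f (int n))"
    proof cases
      case 1
      then show ?thesis using xA by (intro exI[of _ 0]) simp
    next
      case 2
      then show ?thesis using xA by (auto simp: D_power_v)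
    qed
    then show ?thesis using n by auto
  next
    case False
    then have "A = {}" by (auto simp: A_def)
    then show ?thesis using xA False by simp
  qed
qed

lemma weight_space_f:
  assumes "l \<noteq> 0" "x \<in> weight_space M (l - of_int m)"
  shows "\<exists>c. x = cscale M c (f m)"
proof (cases "m < 0")
  case True
  have "l - of_int m \<noteq> l - of_nat n" for n
  proof
    assume "l - of_int m = l - of_nat n"
    then have "of_int m = (of_int (int n) :: complex)" by simp
    then show False using True by (simp only: of_int_eq_iff)
  qed
  then show ?thesis using weight_space_cases[OF assms] True by (auto simp: f_neg)
next
  case False
  then have "l - of_int m = l - of_nat (nat m)" by simp
  with weight_space_cases[OF assms] obtain c n where
    c: "l - of_int m = l - of_nat n" "x = cscale M c (f (int n))" by blast
  then have "of_int m = (of_int (int n) :: complex)" by simp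
  then show ?thesis using c(2) by (auto simp only: of_int_eq_iff)
qed

lemma weight_space_outside:
  assumes "l \<noteq> 0" "x \<in> weight_space M k" "\<And>n. k \<noteq> l - of_nat n"
  shows "x = 0"
  using weight_space_cases[OF assms(1,2)] assms(3) by auto

lemma weight_space_trivial:
  assumes "l = 0" "x \<in> weight_space M k" "k \<noteq> 0"
  shows "x = 0"
proof -
  obtain c where "x = cscale M c v" using carr_trivial[OF assms(1) weight_space_mem[OF assms(2)]] by blast
  then have "x \<in> weight_space M 0" using weight_space_cscale[OF v_weight] assms(1) by simp
  then show ?thesis
    using assms weight_space_mem[OF assms(2)] by (auto simp: weight_space_def cscale_eq_0_iff)
qed

end

lemma simple_quotient_of_verma:
  fixes L :: "'w::ab_group_add wmod"
  assumes "is_verma l V" "is_simple_quotient V L"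
  obtains v where "simple_hw_module L v l"
proof -
  obtain w where "hw_vector V w l" and gen: "carr V = {act V u w | u. True}"
    using verma_hw_vector[OF assms(1)] by blast
  interpret V: hw_vector V w l by fact
  obtain q where L: "simple_module L" and q: "w_hom V L q" "q ` carr V = carr L"
    using assms(2) by (auto simp: is_simple_quotient_def)
  interpret L: wmod L using L by unfold_locales (simp add: simple_module_def)
  have q_act: "q (act V u x) = act L u (q x)" if "x \<in> carr V" for u x
    using q(1) that by (auto simp: w_hom_def)
  have q0: "q 0 = 0" using q(1) V.zero_mem unfolding w_hom_def by (metis add_cancel_left_left)
  define v where "v = q w"
  have v: "v \<in> carr L" using q V.v_mem by (auto simp: v_def)
  have "simple_hw_module L v l"
  proof
    have "act L (D 0) v = cscale L l v"
      using q_act[of w "D 0"] q_act[of w "scal l"] V.weight_space_eq[OF V.v_weight] by (simp add: v_def)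
    then show "v \<in> weight_space L l" using v by (simp add: weight_space_def)
    show "act L (D i) v = 0" if "i \<ge> 1" for i
      using q_act[of w "D i"] V.raise_v[OF that] q0 by (simp add: v_def)
    show "v \<noteq> 0"
    proof
      assume "v = 0"
      then have "q x = 0" if "x \<in> carr V" for x
        using that gen q_act[OF V.v_mem] by (auto simp: v_def)
      then have "carr L \<subseteq> {0}" using q(2) by auto
      then show False using L L.zero_mem by (auto simp: simple_module_def)
    qed
  qed (rule L)
  then show thesis by (rule that)
qed

text \<open>Verma modules up to isomorphism: the module is free of rank one over \<open>\<complex>[d\<^sub>-\<^sub>1]\<close> on a highest weight vector. Together with \<open>hw_ideal_complement\<close> this gives the universal property \<open>extend_hom\<close>.\<close>

locale free_hw_module = hw_vector +
  assumes ev_inj: "act M (ev q) v = 0 \<Longrightarrow> q = 0"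
    and carr_ev: "x \<in> carr M \<Longrightarrow> \<exists>p. x = act M (ev p) v"
begin

lemma ev_eq_iff: "act M (ev p) v = act M (ev q) v \<longleftrightarrow> p = q"
proof -
  have "ev p = ev (p - q) + ev q" by (simp flip: ev_add)
  then show ?thesis using ev_inj[of "p - q"] by (auto simp: act_add_left)
qed

lemma extend_hom:
  fixes K :: "'k::ab_group_add wmod"
  assumes "hw_vector K w l"
  obtains \<phi> where "w_hom M K \<phi>" "\<And>q. \<phi> (act M (ev q) v) = act K (ev q) w"
proof -
  interpret W: hw_vector K w l by fact
  define \<phi> where "\<phi> x = act K (ev (SOME p. x = act M (ev p) v)) w" for x
  have \<phi>: "\<phi> (act M (ev q) v) = act K (ev q) w" for q
    unfolding \<phi>_def ev_eq_iff by simp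
  have orbit: "\<phi> (act M u v) = act K u w" for u
  proof -
    obtain p j where "j \<in> left_ideal (hw_relations 1 l)" "u = ev p + j"
      using hw_ideal_complement by blast
    moreover from this have "act M j v = 0" "act K j w = 0"
      using left_ideal_kills[OF hw_relations_kill v_mem] W.left_ideal_kills[OF W.hw_relations_kill W.v_mem]
      by auto
    ultimately show ?thesis using \<phi>[of p] by (simp add: act_add_left W.act_add_left)
  qed
  have "w_hom M K \<phi>"
    unfolding w_hom_def
  proof (intro conjI ballI allI)
    show "\<phi> ` carr M \<subseteq> carr K" using carr_ev \<phi> W.v_mem W.act_mem by (metis image_subsetI)
    fix x assume "x \<in> carr M"
    then obtain p where p: "x = act M (ev p) v" using carr_ev by blast
    show "\<phi> (act M u x) = act K u (\<phi> x)" for u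
      using orbit[of "u * ev p"] by (simp add: p \<phi> act_mult W.act_mult)
    fix y assume "y \<in> carr M"
    then obtain q where q: "y = act M (ev q) v" using carr_ev by blast
    show "\<phi> (x + y) = \<phi> x + \<phi> y"
      using \<phi>[of "p + q"] by (simp add: p q \<phi> ev_add act_add_left W.act_add_left)
  qed
  then show thesis using \<phi> that by blast
qed

end

section \<open>Extensions of cyclic modules and their cocycles\<close>

locale w_morphism = K: wmod K + M: wmod M
  for K :: "'k::ab_group_add wmod" and M :: "'m::ab_group_add wmod" +
  fixes p :: "'k \<Rightarrow> 'm"
  assumes hom: "w_hom K M p"
begin

lemma mem [simp]: "x \<in> carr K \<Longrightarrow> p x \<in> carr M"
  and add: "x \<in> carr K \<Longrightarrow> y \<in> carr K \<Longrightarrow> p (x + y) = p x + p y"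
  and act: "x \<in> carr K \<Longrightarrow> p (act K u x) = act M u (p x)"
  using hom by (auto simp: w_hom_def)

lemma zero [simp]: "p 0 = 0"
  using add[of 0 0] by simp

lemma uminus: "x \<in> carr K \<Longrightarrow> p (- x) = - p x"
  using add[of x "- x"] by (simp add: eq_neg_iff_add_eq_0 add.commute)

lemma diff: "x \<in> carr K \<Longrightarrow> y \<in> carr K \<Longrightarrow> p (x - y) = p x - p y"
  using add[of x "- y"] by (simp add: uminus)

lemma sum: "(\<And>n. n \<in> A \<Longrightarrow> g n \<in> carr K) \<Longrightarrow> p (\<Sum>n\<in>A. g n) = (\<Sum>n\<in>A. p (g n))"
  by (induction A rule: infinite_finite_induct) (auto simp: add K.sum_mem)

lemma weight: "x \<in> weight_space K l \<Longrightarrow> p x \<in> weight_space M l"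
  by (auto simp: weight_space_def simp flip: act)

end

locale w_extension = N: wmod N + K: wmod K + M: wmod M
  for N :: "'n::ab_group_add wmod" and K :: "'k::ab_group_add wmod" and M :: "'m::ab_group_add wmod" +
  fixes i :: "'n \<Rightarrow> 'k" and p :: "'k \<Rightarrow> 'm"
  assumes exact: "short_exact N M (K, i, p)"
begin

sublocale i: w_morphism N K i
  using exact by unfold_locales (auto simp: short_exact_def)

sublocale p: w_morphism K M p
  using exact by unfold_locales (auto simp: short_exact_def)

lemma i_eq_iff: "x \<in> carr N \<Longrightarrow> y \<in> carr N \<Longrightarrow> i x = i y \<longleftrightarrow> x = y"
  using exact by (auto simp: short_exact_def dest: inj_onD)

lemma kernel: "k \<in> carr K \<Longrightarrow> p k = 0 \<Longrightarrow> \<exists>n\<in>carr N. k = i n"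
  using exact unfolding short_exact_def split_conv by blast

lemma p_i [simp]: "n \<in> carr N \<Longrightarrow> p (i n) = 0"
  using exact by (auto simp: short_exact_def)

lemma surj: "x \<in> carr M \<Longrightarrow> \<exists>k\<in>carr K. p k = x"
proof -
  assume "x \<in> carr M"
  moreover have "carr M = p ` carr K" using exact by (simp add: short_exact_def)
  ultimately show ?thesis by auto
qed

lemma i_weight_iff: "n \<in> carr N \<Longrightarrow> i n \<in> weight_space K l \<longleftrightarrow> n \<in> weight_space N l"
  by (auto simp: weight_space_def i_eq_iff simp flip: i.act)

text \<open>The component of weight \<open>l\<close> of any preimage of \<open>x\<close> is again a preimage.\<close>

lemma lift_weight_vector:
  assumes "weight_module K" "x \<in> weight_space M l"
  obtains v where "v \<in> weight_space K l" "p v = x"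
proof -
  obtain k where k: "k \<in> carr K" "p k = x"
    using surj M.weight_space_mem[OF assms(2)] by blast
  obtain S y where S: "finite S" "\<And>l. y l \<in> weight_space K l" "k = (\<Sum>l\<in>S. y l)"
    using weight_module_weight_decomposition[OF assms(1) k(1)] by blast
  have y: "y l \<in> carr K" for l using S(2) by (rule K.weight_space_mem)
  have "x = (\<Sum>l\<in>S. p (y l))" using k S(3) y by (simp add: p.sum)
  then have "x = (\<Sum>k\<in>{k\<in>S. k = l}. p (y k))"
    by (intro M.weight_component(1)[where w = "\<lambda>k. k"]) (use S assms in \<open>auto intro: p.weight\<close>)
  also have "\<dots> = p (\<Sum>k\<in>{k\<in>S. k = l}. y k)" using y by (simp add: p.sum)
  finally show thesis
    using that[of "\<Sum>k\<in>{k\<in>S. k = l}. y k"] S(2) by (auto intro!: K.weight_space_sum)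
qed

end

lemma w_extensionI:
  "wmod N \<Longrightarrow> wmod M \<Longrightarrow> short_exact N M (K, i, p) \<Longrightarrow> w_extension N K M i p"
  by (simp add: w_extension_def w_extension_axioms_def wmod_def short_exact_def)

text \<open>The condition \<open>c 0 = 0\<close> for \<open>a \<le> 0\<close> expresses that the lift has the same weight as the generator. The bound on \<open>i + j\<close> only excludes \<open>i = j = -1\<close>.\<close>

definition is_cocycle :: "int \<Rightarrow> complex \<Rightarrow> 'n::ab_group_add wmod \<Rightarrow> (int \<Rightarrow> 'n) \<Rightarrow> bool" where
  "is_cocycle a l N c \<longleftrightarrow>
     (\<forall>j\<ge>a. c j \<in> weight_space N (l + of_int j)) \<and> (a \<le> 0 \<longrightarrow> c 0 = 0) \<and>
     (\<forall>i\<ge>a. \<forall>j\<ge>a. i + j \<ge> a \<longrightarrow>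
        act N (D i) (c j) - act N (D j) (c i) = cscale N (of_int (j - i)) (c (i + j)))"

definition is_coboundary :: "int \<Rightarrow> complex \<Rightarrow> 'n::ab_group_add wmod \<Rightarrow> (int \<Rightarrow> 'n) \<Rightarrow> bool" where
  "is_coboundary a l N c \<longleftrightarrow> (\<exists>n\<in>weight_space N l. \<forall>j\<ge>a. c j = act N (D j) n)"

definition ext_cocycle :: "'m \<Rightarrow> complex \<Rightarrow> int \<Rightarrow> 'n wmod \<Rightarrow>
    ('n, 'k::ab_group_add, 'm) extension \<Rightarrow> (int \<Rightarrow> 'n) \<Rightarrow> bool" where
  "ext_cocycle m l a N = (\<lambda>(K, i, p) c. \<exists>v\<in>weight_space K l. p v = m \<and>
    (\<forall>j\<ge>a. c j \<in> carr N \<and> i (c j) = act K (D j) v))"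

locale presented = wmod M for M :: "'m::ab_group_add wmod" +
  fixes m :: 'm and l :: complex and a :: int
  assumes m_weight: "m \<in> weight_space M l"
    and generated: "carr M = {act M u m | u. True}"
    and relations: "r \<in> hw_relations a l \<Longrightarrow> act M r m = 0"
    and annihilator: "act M u m = 0 \<Longrightarrow> u \<in> left_ideal (hw_relations a l)"
    and a_cases: "a = 1 \<or> a = -1 \<and> l = 0"
begin

lemma m_mem [simp]: "m \<in> carr M"
  using m_weight by (rule weight_space_mem)

lemma D_m: "j \<ge> a \<Longrightarrow> act M (D j) m = 0"
  by (rule relations) (simp add: hw_relations_def)

lemma ext_cocycle_exists:
  assumes "wmod N" "short_exact N M (K, i, p)" "weight_module K"
  shows "\<exists>c. ext_cocycle m l a N (K, i, p) c"
proof -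
  interpret N: wmod N by fact
  interpret E: w_extension N K M i p by (rule w_extensionI) (fact | rule wmod_axioms)+
  obtain v where v: "v \<in> weight_space K l" "p v = m"
    using E.lift_weight_vector[OF assms(3) m_weight] by blast
  have vK: "v \<in> carr K" using v(1) by (rule E.K.weight_space_mem)
  have "\<exists>n\<in>carr N. act K (D j) v = i n" if "j \<ge> a" for j
    using that vK v(2) by (intro E.kernel) (auto simp: E.p.act D_m)
  then obtain c where "\<And>j. j \<ge> a \<Longrightarrow> c j \<in> carr N \<and> act K (D j) v = i (c j)" by metis
  then show ?thesis using v unfolding ext_cocycle_def by force
qed

lemma is_cocycle_of_extension:
  assumes "wmod N" "short_exact N M (K, i, p)" "ext_cocycle m l a N (K, i, p) c"
  shows "is_cocycle a l N c"
proof -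
  interpret N: wmod N by fact
  interpret E: w_extension N K M i p by (rule w_extensionI) (fact | rule wmod_axioms)+
  obtain v where v: "v \<in> weight_space K l" "p v = m"
    and c: "\<And>j. j \<ge> a \<Longrightarrow> c j \<in> carr N" "\<And>j. j \<ge> a \<Longrightarrow> i (c j) = act K (D j) v"
    using assms(3) by (auto simp: ext_cocycle_def)
  have vK [simp]: "v \<in> carr K" using v(1) by (rule E.K.weight_space_mem)
  have a: "a \<ge> -1" using a_cases by auto
  have wt: "c j \<in> weight_space N (l + of_int j)" if j: "j \<ge> a" for j
    using E.K.weight_space_D[OF v(1), of j] j a c E.i_weight_iff[of "c j"] by simp
  have zero: "c 0 = 0" if "a \<le> 0"
  proof -
    have "i (c 0) = i 0" using c(2)[of 0] that a_cases E.K.weight_space_eq[OF v(1)] by auto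
    then show ?thesis using c(1)[of 0] that E.i_eq_iff[of "c 0" 0] by simp
  qed
  have "act N (D j) (c k) - act N (D k) (c j) = cscale N (of_int (k - j)) (c (j + k))"
    if jk: "j \<ge> a" "k \<ge> a" "j + k \<ge> a" for j k
  proof -
    have "i (act N (D j) (c k) - act N (D k) (c j)) =
        act K (D j) (act K (D k) v) - act K (D k) (act K (D j) v)"
      using jk c by (simp add: E.i.diff E.i.act)
    also have "\<dots> = cscale K (of_int (k - j)) (act K (D (j + k)) v)"
      using E.K.D_D[of j k v] jk a by simp
    also have "\<dots> = i (cscale N (of_int (k - j)) (c (j + k)))"
      using jk c by (simp only: E.i.act)
    finally show ?thesis using jk c by (subst (asm) E.i_eq_iff) auto
  qed
  then show ?thesis using wt zero by (auto simp: is_cocycle_def)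
qed

text \<open>The cocycles are taken with respect to fixed lifts of the generator, and a map of extensions moves one lift to the
  other up to an element \<open>n\<close> of \<open>N\<close>; that yields the coboundary. Conversely the map has to send
  \<open>u v\<^sub>0 + i\<^sub>0 y\<close> to \<open>u (v + i n) + i (\<alpha> y)\<close>. This is well defined because \<open>u v\<^sub>0\<close> lies in the image of \<open>N\<^sub>0\<close> only if \<open>u\<close>
  annihilates \<open>m\<close>, and on the left ideal of such \<open>u\<close> the prescription holds since it holds on its generators.\<close>

lemma push_iff:
  fixes N0 :: "'n0::ab_group_add wmod" and N :: "'n::ab_group_add wmod"
    and K0 :: "'k0::ab_group_add wmod" and K :: "'k::ab_group_add wmod"
  assumes \<alpha>: "wmod N0" "wmod N" "w_hom N0 N \<alpha>"
    and E0: "short_exact N0 M (K0, i0, p0)" "ext_cocycle m l a N0 (K0, i0, p0) c0"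
    and E: "short_exact N M (K, i, p)" "ext_cocycle m l a N (K, i, p) c"
  shows "push \<alpha> (carr N0) (K0, i0, p0) (K, i, p) \<longleftrightarrow> is_coboundary a l N (\<lambda>j. \<alpha> (c0 j) - c j)"
proof -
  interpret \<alpha>: w_morphism N0 N \<alpha> using \<alpha> by (simp add: w_morphism_def w_morphism_axioms_def)
  interpret E0: w_extension N0 K0 M i0 p0 by (rule w_extensionI) (fact | rule wmod_axioms)+
  interpret E: w_extension N K M i p by (rule w_extensionI) (fact | rule wmod_axioms)+
  obtain v0 where v0: "v0 \<in> weight_space K0 l" "p0 v0 = m"
    and c0: "\<And>j. j \<ge> a \<Longrightarrow> c0 j \<in> carr N0" "\<And>j. j \<ge> a \<Longrightarrow> i0 (c0 j) = act K0 (D j) v0"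
    using E0(2) by (auto simp: ext_cocycle_def)
  have [simp]: "v0 \<in> carr K0" using v0(1) by (rule E0.K.weight_space_mem)
  obtain v where v: "v \<in> weight_space K l" "p v = m"
    and c: "\<And>j. j \<ge> a \<Longrightarrow> c j \<in> carr N" "\<And>j. j \<ge> a \<Longrightarrow> i (c j) = act K (D j) v"
    using E(2) by (auto simp: ext_cocycle_def)
  have [simp]: "v \<in> carr K" using v(1) by (rule E.K.weight_space_mem)
  show ?thesis
  proof
    assume "push \<alpha> (carr N0) (K0, i0, p0) (K, i, p)"
    then obtain \<psi> where \<psi>: "w_hom K0 K \<psi>" "\<And>n. n \<in> carr N0 \<Longrightarrow> \<psi> (i0 n) = i (\<alpha> n)"
      "\<And>k. k \<in> carr K0 \<Longrightarrow> p (\<psi> k) = p0 k"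
      by (auto simp: push_def)
    interpret \<psi>: w_morphism K0 K \<psi> by unfold_locales fact
    obtain n where n: "n \<in> carr N" "\<psi> v0 - v = i n"
      using E.kernel[of "\<psi> v0 - v"] v0 v \<psi>(3) by (auto simp: E.p.diff)
    have "i n \<in> weight_space K l"
      unfolding n(2)[symmetric] by (intro E.K.weight_space_diff \<psi>.weight v0 v)
    then have nw: "n \<in> weight_space N l" using n by (simp add: E.i_weight_iff)
    have "\<alpha> (c0 j) - c j = act N (D j) n" if j: "j \<ge> a" for j
    proof -
      have "i (\<alpha> (c0 j) - c j) = act K (D j) (\<psi> v0) - act K (D j) v"
        using j c0 c by (simp add: E.i.diff \<psi>.act flip: \<psi>(2))
      also have "\<dots> = i (act N (D j) n)"
        using n by (simp add: E.i.act flip: E.K.act_diff_right)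
      finally show ?thesis using j c0 c n by (simp add: E.i_eq_iff)
    qed
    then show "is_coboundary a l N (\<lambda>j. \<alpha> (c0 j) - c j)" using nw by (auto simp: is_coboundary_def)
  next
    assume "is_coboundary a l N (\<lambda>j. \<alpha> (c0 j) - c j)"
    then obtain n where nw: "n \<in> weight_space N l"
      and n: "\<And>j. j \<ge> a \<Longrightarrow> \<alpha> (c0 j) - c j = act N (D j) n"
      by (auto simp: is_coboundary_def)
    have nN [simp]: "n \<in> carr N" using nw by (rule \<alpha>.M.weight_space_mem)
    define w where "w = v + i n"
    have ww: "w \<in> weight_space K l"
      unfolding w_def using v nw by (intro E.K.weight_space_add) (simp_all add: E.i_weight_iff)
    have w [simp]: "w \<in> carr K" by (simp add: w_def)
    have pw: "p w = m" using v by (simp add: w_def E.p.add)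
    have Dw: "act K (D j) w = i (\<alpha> (c0 j))" if "j \<ge> a" for j
    proof -
      have "act K (D j) w = i (c j + (\<alpha> (c0 j) - c j))"
        unfolding n[OF that] using that c by (simp add: w_def E.K.act_add_right E.i.add E.i.act)
      then show ?thesis by simp
    qed
    have ideal: "\<exists>y\<in>carr N0. act K0 u v0 = i0 y \<and> act K u w = i (\<alpha> y)"
      if "u \<in> left_ideal (hw_relations a l)" for u
      using that
    proof (induction rule: left_ideal.induct)
      case zero
      then show ?case by (intro bexI[of _ 0]) auto
    next
      case (add x y)
      then obtain s t where "s \<in> carr N0" "t \<in> carr N0" "act K0 x v0 = i0 s" "act K x w = i (\<alpha> s)"
        "act K0 y v0 = i0 t" "act K y w = i (\<alpha> t)" by blast
      then show ?case
        by (intro bexI[of _ "s + t"])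
          (auto simp: E0.K.act_add_left E.K.act_add_left E0.i.add E.i.add \<alpha>.add)
    next
      case (generator r u)
      show ?case
      proof (cases "r = D 0 - scal l")
        case True
        have "act K0 r v0 = 0" "act K r w = 0"
          using E0.K.weight_space_eq[OF v0(1)] E.K.weight_space_eq[OF ww]
          by (auto simp: True E0.K.act_diff_left E.K.act_diff_left)
        then show ?thesis
          by (intro bexI[of _ 0]) (auto simp: E0.K.act_mult E.K.act_mult)
      next
        case False
        then obtain j where j: "j \<ge> a" "r = D j" using generator by (auto simp: hw_relations_def)
        then have "act K0 r v0 = i0 (c0 j)" "act K r w = i (\<alpha> (c0 j))" using c0 Dw by auto
        then show ?thesis
          using c0[OF j(1)]
          by (intro bexI[of _ "act N0 u (c0 j)"])
            (auto simp: E0.K.act_mult E.K.act_mult E0.i.act E.i.act \<alpha>.act)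
      qed
    qed
    \<comment> \<open>the graph of the map to be constructed\<close>
    define G where "G k x \<longleftrightarrow> (\<exists>u. \<exists>y\<in>carr N0. k = act K0 u v0 + i0 y \<and> x = act K u w + i (\<alpha> y))" for k x
    have G_ex: "\<exists>x. G k x" if k: "k \<in> carr K0" for k
    proof -
      obtain u where u: "p0 k = act M u m" using generated E0.p.mem[OF k] by auto
      then have "p0 (k - act K0 u v0) = 0" using k v0 by (simp add: E0.p.diff E0.p.act)
      then obtain y where "y \<in> carr N0" "k - act K0 u v0 = i0 y"
        using k E0.kernel[of "k - act K0 u v0"] by auto
      then show ?thesis
        unfolding G_def by (intro exI[of _ "act K u w + i (\<alpha> y)"] exI[of _ u] bexI[of _ y])
          (auto simp: algebra_simps)
    qed
    have G_unique: "x = x'" if "G k x" "G k x'" for k x x'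
    proof -
      from that obtain u y u' y' where y: "y \<in> carr N0" "y' \<in> carr N0"
        and k: "k = act K0 u v0 + i0 y" "k = act K0 u' v0 + i0 y'"
        and x: "x = act K u w + i (\<alpha> y)" "x' = act K u' w + i (\<alpha> y')"
        unfolding G_def by blast
      have e: "act K0 (u - u') v0 = i0 (y' - y)"
        using k y by (simp add: E0.K.act_diff_left E0.i.diff algebra_simps)
      have "act M (u - u') m = p0 (act K0 (u - u') v0)" using v0 by (simp add: E0.p.act)
      also have "\<dots> = 0" unfolding e using y by simp
      finally obtain z where z: "z \<in> carr N0" "act K0 (u - u') v0 = i0 z" "act K (u - u') w = i (\<alpha> z)"
        using ideal annihilator by blast
      then have "y' - y = z" using e y by (simp add: E0.i_eq_iff)
      then have "y' = y + z" by (simp add: diff_eq_eq add.commute)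
      then have "i (\<alpha> y') = i (\<alpha> y) + i (\<alpha> z)" using y z by (simp add: E.i.add \<alpha>.add)
      then show ?thesis
        using z(3) x y by (simp add: E.K.act_diff_left algebra_simps)
    qed
    define \<psi> where "\<psi> k = (SOME x. G k x)" for k
    have \<psi>G: "G k (\<psi> k)" if "k \<in> carr K0" for k
      unfolding \<psi>_def using G_ex[OF that] by (rule someI_ex)
    have \<psi>_eq: "\<psi> k = x" if "G k x" for k x
      unfolding \<psi>_def using that G_unique by blast
    have G_K: "x \<in> carr K" "p x = p0 k" if "G k x" for k x
      using that v0 pw by (auto simp: G_def E.p.add E0.p.add E.p.act E0.p.act)
    have "w_hom K0 K \<psi>"
      unfolding w_hom_def
    proof (intro conjI ballI allI)
      show "\<psi> ` carr K0 \<subseteq> carr K" using \<psi>G G_K by blast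
    next
      fix x y assume "x \<in> carr K0" "y \<in> carr K0"
      from \<psi>G[OF this(1)] \<psi>G[OF this(2)] obtain u s u' t where "s \<in> carr N0" "t \<in> carr N0"
        "x = act K0 u v0 + i0 s" "\<psi> x = act K u w + i (\<alpha> s)"
        "y = act K0 u' v0 + i0 t" "\<psi> y = act K u' w + i (\<alpha> t)"
        unfolding G_def by blast
      then have "G (x + y) (\<psi> x + \<psi> y)"
        unfolding G_def by (intro exI[of _ "u + u'"] bexI[of _ "s + t"])
          (auto simp: E0.K.act_add_left E.K.act_add_left E0.i.add E.i.add \<alpha>.add)
      then show "\<psi> (x + y) = \<psi> x + \<psi> y" by (rule \<psi>_eq)
    next
      fix u x assume "x \<in> carr K0"
      from \<psi>G[OF this] obtain u' s where "s \<in> carr N0"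
        "x = act K0 u' v0 + i0 s" "\<psi> x = act K u' w + i (\<alpha> s)"
        unfolding G_def by blast
      then have "G (act K0 u x) (act K u (\<psi> x))"
        unfolding G_def by (intro exI[of _ "u * u'"] bexI[of _ "act N0 u s"])
          (auto simp: E0.K.act_add_right E.K.act_add_right E0.K.act_mult E.K.act_mult
            E0.i.act E.i.act \<alpha>.act)
      then show "\<psi> (act K0 u x) = act K u (\<psi> x)" by (rule \<psi>_eq)
    qed
    moreover have "\<psi> (i0 y) = i (\<alpha> y)" if "y \<in> carr N0" for y
      by (rule \<psi>_eq) (use that in \<open>auto simp: G_def intro!: exI[of _ 0] bexI[of _ y]\<close>)
    moreover have "p (\<psi> k) = p0 k" if "k \<in> carr K0" for k
      using G_K(2)[OF \<psi>G[OF that]] .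
    ultimately show "push \<alpha> (carr N0) (K0, i0, p0) (K, i, p)" by (auto simp: push_def)
  qed
qed

end

definition prod_module :: "'v wmod \<Rightarrow> 'w wmod \<Rightarrow> ('v \<times> 'w) wmod" where
  "prod_module M N = \<lparr>carr = carr M \<times> carr N, act = (\<lambda>u (x, y). (act M u x, act N u y))\<rparr>"

lemma wmod_prod_module:
  assumes "wmod M" "wmod N"
  shows "wmod (prod_module M N)"
proof -
  interpret M: wmod M by fact
  interpret N: wmod N by fact
  show ?thesis
    by unfold_locales
      (auto simp: left_module_def add_subgroup_def prod_module_def zero_prod_def uminus_prod_def plus_prod_def
        M.act_add_left N.act_add_left M.act_add_right N.act_add_right M.act_mult N.act_mult)
qed

text \<open>It makes the Baer sum accessible to \<open>push_iff\<close>, applied to extensions by \<open>N \<times> N\<close> and to the addition map of \<open>N\<close>.\<close>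

lemma short_exact_diagonal_pullback:
  assumes "wmod N" "wmod M" "short_exact N M (K, i, p)" "short_exact N M (K', i', p')"
  shows "short_exact (prod_module N N) M (diagonal_pullback (K, i, p) (K', i', p'))"
proof -
  interpret E: w_extension N K M i p by (rule w_extensionI) fact+
  interpret E': w_extension N K' M i' p' by (rule w_extensionI) fact+
  define P where "P = \<lparr>carr = {(k, k'). k \<in> carr K \<and> k' \<in> carr K' \<and> p k = p' k'},
       act = (\<lambda>u (k, k'). (act K u k, act K' u k'))\<rparr>"
  have carrP: "carr P = {(k, k'). k \<in> carr K \<and> k' \<in> carr K' \<and> p k = p' k'}"
    and actP: "act P u (k, k') = (act K u k, act K' u k')" for u k k'
    by (simp_all add: P_def)
  have "w_module P"
    by (auto simp: left_module_def add_subgroup_def carrP actP zero_prod_def uminus_prod_def plus_prod_def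
        E.K.act_add_left E.K.act_add_right E.K.act_mult E'.K.act_add_left E'.K.act_add_right
        E'.K.act_mult E.p.add E'.p.add E.p.uminus E'.p.uminus E.p.act E'.p.act)
  moreover have "w_hom (prod_module N N) P (\<lambda>(n, n'). (i n, i' n'))"
    by (auto simp: w_hom_def prod_module_def carrP actP E.i.add E'.i.add E.i.act E'.i.act)
  moreover have "w_hom P M (\<lambda>(k, k'). p k)"
    by (auto simp: w_hom_def carrP actP E.p.add E.p.act)
  moreover have "inj_on (\<lambda>(n, n'). (i n, i' n')) (carr (prod_module N N))"
    by (auto simp: inj_on_def prod_module_def E.i_eq_iff E'.i_eq_iff)
  moreover have "(\<lambda>(n, n'). (i n, i' n')) ` carr (prod_module N N) = {k \<in> carr P. (\<lambda>(k, k'). p k) k = 0}"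
  proof (intro equalityI subsetI)
    fix x assume "x \<in> {k \<in> carr P. (\<lambda>(k, k'). p k) k = 0}"
    then obtain k k' where x: "x = (k, k')" "k \<in> carr K" "k' \<in> carr K'" "p k = 0" "p' k' = 0"
      by (auto simp: carrP)
    obtain n n' where "n \<in> carr N" "n' \<in> carr N" "k = i n" "k' = i' n'"
      using E.kernel E'.kernel x by metis
    then show "x \<in> (\<lambda>(n, n'). (i n, i' n')) ` carr (prod_module N N)"
      using x by (auto simp: prod_module_def)
  qed (auto simp: carrP prod_module_def)
  moreover have "(\<lambda>(k, k'). p k) ` carr P = carr M"
  proof (intro equalityI subsetI)
    fix x assume "x \<in> carr M"
    then obtain k k' where "k \<in> carr K" "k' \<in> carr K'" "p k = x" "p' k' = x"
      using E.surj E'.surj by metis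
    then show "x \<in> (\<lambda>(k, k'). p k) ` carr P" by (auto simp: carrP intro!: image_eqI[of _ _ "(k, k')"])
  qed (auto simp: carrP)
  ultimately show ?thesis by (simp add: short_exact_def diagonal_pullback_def flip: P_def)
qed

text \<open>A complete invariant \<open>\<chi>\<close> that turns pushouts into linear relations identifies the classes with its values. The
  classes are the fibres of \<open>\<chi>\<close>.\<close>

lemma complex_linear_isoI:
  assumes equiv: "\<And>E E'. E \<in> extensions_O M N \<Longrightarrow> E' \<in> extensions_O M N \<Longrightarrow>
      push id (carr N) E E' \<longleftrightarrow> \<chi> E = \<chi> E'"
    and scale: "\<And>c E E'. E \<in> extensions_O M N \<Longrightarrow> E' \<in> extensions_O M N \<Longrightarrow>
      push (cscale N c) (carr N) E E' \<longleftrightarrow> c * \<chi> E = \<chi> E'"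
    and sum: "\<And>E1 E2 E. E1 \<in> extensions_O M N \<Longrightarrow> E2 \<in> extensions_O M N \<Longrightarrow> E \<in> extensions_O M N \<Longrightarrow>
      push (\<lambda>(n, n'). n + n') (carr N \<times> carr N) (diagonal_pullback E1 E2) E \<longleftrightarrow> \<chi> E1 + \<chi> E2 = \<chi> E"
    and im: "\<chi> ` extensions_O M N = Y" and Y: "Y = UNIV \<or> Y = {0}"
  shows "complex_linear_iso (Ext1_O M N) (baer_sum M N) (ext_scale M N) Y"
proof -
  define cls where "cls y = {E \<in> extensions_O M N. \<chi> E = y}" for y
  have Y_add: "x + y \<in> Y" "c * x \<in> Y" if "x \<in> Y" "y \<in> Y" for x y c using that Y by auto
  have nonempty: "\<exists>E. E \<in> cls y" if "y \<in> Y" for y using that im by (auto simp: cls_def)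
  have inj: "inj_on cls Y"
  proof (rule inj_onI)
    fix x y assume "x \<in> Y" "y \<in> Y" "cls x = cls y"
    then show "x = y" using nonempty[of x] by (auto simp: cls_def)
  qed
  have "ext_equiv M N `` {E} = cls (\<chi> E)" if "E \<in> extensions_O M N" for E
  proof (rule set_eqI)
    fix E'
    have "(E, E') \<in> ext_equiv M N \<longleftrightarrow> E' \<in> extensions_O M N \<and> push id (carr N) E E'"
      unfolding ext_equiv_def using that by simp
    also have "\<dots> \<longleftrightarrow> E' \<in> cls (\<chi> E)" unfolding cls_def using equiv[OF that, of E'] by auto
    finally show "E' \<in> ext_equiv M N `` {E} \<longleftrightarrow> E' \<in> cls (\<chi> E)" by (simp only: Image_singleton_iff)
  qed
  then have Ext: "Ext1_O M N = cls ` Y"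
    unfolding Ext1_O_def quotient_def im[symmetric] by auto
  have baer: "baer_sum M N (cls x) (cls y) = cls (x + y)" if xy: "x \<in> Y" "y \<in> Y" for x y
  proof -
    obtain E1 E2 where E12: "E1 \<in> cls x" "E2 \<in> cls y" using nonempty xy by metis
    show ?thesis
    proof (rule set_eqI)
      fix E
      have iff: "push (\<lambda>(n, n'). n + n') (carr N \<times> carr N) (diagonal_pullback F1 F2) E \<longleftrightarrow> x + y = \<chi> E"
        if "F1 \<in> cls x" "F2 \<in> cls y" "E \<in> extensions_O M N" for F1 F2
        using sum[of F1 F2 E] that unfolding cls_def by blast
      show "E \<in> baer_sum M N (cls x) (cls y) \<longleftrightarrow> E \<in> cls (x + y)"
      proof
        assume "E \<in> baer_sum M N (cls x) (cls y)"
        then show "E \<in> cls (x + y)" unfolding baer_sum_def using iff by (auto simp only: cls_def mem_Collect_eq)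
      next
        assume "E \<in> cls (x + y)"
        then have "E \<in> extensions_O M N" "x + y = \<chi> E" by (simp_all add: cls_def)
        then show "E \<in> baer_sum M N (cls x) (cls y)" unfolding baer_sum_def mem_Collect_eq using iff E12 by blast
      qed
    qed
  qed
  have scl: "ext_scale M N c (cls x) = cls (c * x)" if x: "x \<in> Y" for c x
  proof -
    obtain E1 where E1: "E1 \<in> cls x" using nonempty x by metis
    show ?thesis
    proof (rule set_eqI)
      fix E
      have iff: "push (cscale N c) (carr N) F E \<longleftrightarrow> c * x = \<chi> E"
        if "F \<in> cls x" "E \<in> extensions_O M N" for F
        using scale[of F E c] that unfolding cls_def by blast
      show "E \<in> ext_scale M N c (cls x) \<longleftrightarrow> E \<in> cls (c * x)"
      proof
        assume "E \<in> ext_scale M N c (cls x)"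
        then show "E \<in> cls (c * x)" unfolding ext_scale_def using iff by (auto simp only: cls_def mem_Collect_eq)
      next
        assume "E \<in> cls (c * x)"
        then have "E \<in> extensions_O M N" "c * x = \<chi> E" by (simp_all add: cls_def)
        then show "E \<in> ext_scale M N c (cls x)" unfolding ext_scale_def mem_Collect_eq using iff E1 by blast
      qed
    qed
  qed
  have inv: "inv_into Y cls (cls y) = y" if "y \<in> Y" for y using inv_into_f_f[OF inj that] .
  have "bij_betw (inv_into Y cls) (cls ` Y) Y" using inj by (intro bij_betw_inv_into inj_on_imp_bij_betw)
  then show ?thesis
    unfolding complex_linear_iso_def Ext
    by (intro conjI exI[of _ "inv_into Y cls"]) (auto simp: baer scl inv Y_add)
qed

text \<open>By \<open>push_iff\<close> every relation between extensions is the vanishing of a combination of their cocycles modulo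
  coboundaries, which \<open>X\<close> detects; so \<open>X\<close> of any cocycle of an extension is a complete invariant.\<close>

lemma (in presented) Ext1_linear_iso:
  fixes N :: "'n::ab_group_add wmod"
  assumes N: "wmod N"
    and X_add: "\<And>c c'. is_cocycle a l N c \<Longrightarrow> is_cocycle a l N c' \<Longrightarrow> X (\<lambda>j. c j + c' j) = X c + X c'"
    and X_scale: "\<And>c s. is_cocycle a l N c \<Longrightarrow> X (\<lambda>j. cscale N s (c j)) = s * X c"
    and X_ker: "\<And>c. is_cocycle a l N c \<Longrightarrow> X c = 0 \<longleftrightarrow> is_coboundary a l N c"
    and X_im: "\<And>c. is_cocycle a l N c \<Longrightarrow> X c \<in> Y"
    and X_onto: "\<And>y. y \<in> Y \<Longrightarrow> \<exists>E\<in>extensions_O M N. \<exists>c. ext_cocycle m l a N E c \<and> X c = y"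
    and Y: "Y = UNIV \<or> Y = {0}"
  shows "complex_linear_iso (Ext1_O M N) (baer_sum M N) (ext_scale M N) Y"
proof -
  interpret N: wmod N by fact
  let ?S = "extensions_O M N"
  define Z where "Z = {c. is_cocycle a l N c}"
  have S: "\<exists>K i p. E = (K, i, p) \<and> short_exact N M (K, i, p) \<and> weight_module K" if "E \<in> ?S" for E
    using that by (cases E) (auto simp: extensions_O_def category_O_def)
  have coc: "c \<in> Z" if "E \<in> ?S" "ext_cocycle m l a N E c" for E c
    using S[OF that(1)] is_cocycle_of_extension[OF N] that(2) by (auto simp: Z_def)
  have Z_mem: "c j \<in> carr N" if "c \<in> Z" "j \<ge> a" for c j
    using that N.weight_space_mem by (auto simp: Z_def is_cocycle_def)
  have a1: "a \<ge> -1" using a_cases by auto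
  have Z_scale: "(\<lambda>j. cscale N s (c j)) \<in> Z" if c: "c \<in> Z" for c s
  proof -
    have "act N (D i) (cscale N s (c j)) - act N (D j) (cscale N s (c i)) =
        cscale N (of_int (j - i)) (cscale N s (c (i + j)))" if ij: "i \<ge> a" "j \<ge> a" "i + j \<ge> a" for i j
    proof -
      have "act N (D i) (cscale N s (c j)) - act N (D j) (cscale N s (c i)) =
          cscale N s (act N (D i) (c j) - act N (D j) (c i))"
        using ij Z_mem[OF c] by (simp add: N.D_cscale N.act_diff_right)
      also have "act N (D i) (c j) - act N (D j) (c i) = cscale N (of_int (j - i)) (c (i + j))"
        using c ij by (auto simp: Z_def is_cocycle_def)
      finally show ?thesis using Z_mem[OF c] ij by (simp add: mult.commute)
    qed
    then show ?thesis
      using c by (auto simp: Z_def is_cocycle_def intro: N.weight_space_cscale)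
  qed
  have Z_add: "(\<lambda>j. c j + c' j) \<in> Z" if c: "c \<in> Z" "c' \<in> Z" for c c'
  proof -
    have "act N (D i) (c j + c' j) - act N (D j) (c i + c' i) =
        cscale N (of_int (j - i)) (c (i + j) + c' (i + j))" if ij: "i \<ge> a" "j \<ge> a" "i + j \<ge> a" for i j
    proof -
      have "act N (D i) (c j + c' j) - act N (D j) (c i + c' i) =
          (act N (D i) (c j) - act N (D j) (c i)) + (act N (D i) (c' j) - act N (D j) (c' i))"
        using ij Z_mem[OF c(1)] Z_mem[OF c(2)] by (simp add: N.act_add_right)
      also have "\<dots> = cscale N (of_int (j - i)) (c (i + j)) + cscale N (of_int (j - i)) (c' (i + j))"
        using c ij unfolding Z_def is_cocycle_def by simp
      finally show ?thesis using Z_mem[OF c(1)] Z_mem[OF c(2)] ij by (simp add: N.act_add_right)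
    qed
    then show ?thesis
      using c by (auto simp: Z_def is_cocycle_def intro: N.weight_space_add)
  qed
  have cob_cong: "is_coboundary a l N c \<longleftrightarrow> is_coboundary a l N c'" if "\<And>j. j \<ge> a \<Longrightarrow> c j = c' j" for c c'
    using that by (auto simp: is_coboundary_def)
  have diff: "is_coboundary a l N (\<lambda>j. c j - c' j) \<longleftrightarrow> X c = X c'" if c: "c \<in> Z" "c' \<in> Z" for c c'
  proof -
    have "is_coboundary a l N (\<lambda>j. c j - c' j) \<longleftrightarrow> is_coboundary a l N (\<lambda>j. c j + cscale N (-1) (c' j))"
      by (rule cob_cong) (simp add: N.cscale_uminus Z_mem[OF c(2)])
    also have "\<dots> \<longleftrightarrow> X (\<lambda>j. c j + cscale N (-1) (c' j)) = 0"
      using X_ker Z_add[OF c(1) Z_scale[OF c(2), of "-1"]] by (simp add: Z_def)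
    also have "X (\<lambda>j. c j + cscale N (-1) (c' j)) = X c - X c'"
      using X_add X_scale Z_scale[OF c(2)] c by (simp add: Z_def)
    finally show ?thesis by simp
  qed
  define \<gamma> where "\<gamma> E = (SOME c. ext_cocycle m l a N E c)" for E :: "('n, universe, 'm) extension"
  define \<chi> where "\<chi> E = X (\<gamma> E)" for E
  have \<gamma>: "ext_cocycle m l a N E (\<gamma> E)" if E: "E \<in> ?S" for E
  proof -
    obtain K i p where "E = (K, i, p)" "short_exact N M (K, i, p)" "weight_module K"
      using S[OF E] by blast
    then have "\<exists>c. ext_cocycle m l a N E c" using ext_cocycle_exists[OF N, of K i p] by simp
    then show ?thesis unfolding \<gamma>_def by (rule someI_ex)
  qed
  have \<gamma>Z: "\<gamma> E \<in> Z" if "E \<in> ?S" for E using coc[OF that \<gamma>[OF that]] .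
  have push_S: "push \<alpha> (carr N) E E' \<longleftrightarrow> is_coboundary a l N (\<lambda>j. \<alpha> (c j) - c' j)"
    if E: "E \<in> ?S" "E' \<in> ?S" "w_hom N N \<alpha>" "ext_cocycle m l a N E c" "ext_cocycle m l a N E' c'" for E E' \<alpha> c c'
  proof -
    obtain K i p where 1: "E = (K, i, p)" "short_exact N M (K, i, p)" using S[OF E(1)] by blast
    obtain K' i' p' where 2: "E' = (K', i', p')" "short_exact N M (K', i', p')" using S[OF E(2)] by blast
    show ?thesis unfolding 1(1) 2(1)
      by (rule push_iff[OF N N E(3) 1(2) _ 2(2)]) (use E(4,5) 1(1) 2(1) in simp_all)
  qed
  have push_id: "push id (carr N) E E' \<longleftrightarrow> is_coboundary a l N (\<lambda>j. c j - c' j)"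
    if "E \<in> ?S" "E' \<in> ?S" "ext_cocycle m l a N E c" "ext_cocycle m l a N E' c'" for E E' c c'
    using push_S[of E E' id c c'] that by (simp add: w_hom_def)
  have \<chi>_eq: "\<chi> E = X c" if "E \<in> ?S" "ext_cocycle m l a N E c" for E c
  proof -
    have "push id (carr N) E E"
      by (cases E) (auto simp: push_def w_hom_def intro!: exI[of _ id])
    then show ?thesis
      using push_id[OF that(1) that(1) \<gamma>[OF that(1)] that(2)] diff[OF \<gamma>Z[OF that(1)] coc[OF that]]
      by (simp add: \<chi>_def)
  qed
  show ?thesis
  proof (rule complex_linear_isoI[where \<chi> = \<chi>])
    fix E E' assume E: "E \<in> ?S" "E' \<in> ?S"
    show "push id (carr N) E E' \<longleftrightarrow> \<chi> E = \<chi> E'"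
      using push_id[OF E \<gamma>[OF E(1)] \<gamma>[OF E(2)]] diff[OF \<gamma>Z[OF E(1)] \<gamma>Z[OF E(2)]] by (simp add: \<chi>_def)
    fix s
    have "w_hom N N (cscale N s)"
      by (auto simp: w_hom_def N.act_add_right N.act_cscale)
    then have "push (cscale N s) (carr N) E E' \<longleftrightarrow> is_coboundary a l N (\<lambda>j. cscale N s (\<gamma> E j) - \<gamma> E' j)"
      by (rule push_S[OF E _ \<gamma>[OF E(1)] \<gamma>[OF E(2)]])
    also have "\<dots> \<longleftrightarrow> X (\<lambda>j. cscale N s (\<gamma> E j)) = X (\<gamma> E')"
      by (rule diff[OF Z_scale[OF \<gamma>Z[OF E(1)]] \<gamma>Z[OF E(2)]])
    also have "X (\<lambda>j. cscale N s (\<gamma> E j)) = s * \<chi> E"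
      using X_scale \<gamma>Z[OF E(1)] by (simp add: \<chi>_def Z_def)
    finally show "push (cscale N s) (carr N) E E' \<longleftrightarrow> s * \<chi> E = \<chi> E'" by (simp add: \<chi>_def)
  next
    fix E1 E2 E assume E: "E1 \<in> ?S" "E2 \<in> ?S" "E \<in> ?S"
    obtain K1 i1 p1 where E1: "E1 = (K1, i1, p1)" "short_exact N M (K1, i1, p1)" using S[OF E(1)] by blast
    obtain K2 i2 p2 where E2: "E2 = (K2, i2, p2)" "short_exact N M (K2, i2, p2)" using S[OF E(2)] by blast
    obtain K i p where E3: "E = (K, i, p)" "short_exact N M (K, i, p)" using S[OF E(3)] by blast
    let ?N2 = "prod_module N N"
    have carr2: "carr ?N2 = carr N \<times> carr N" by (simp add: prod_module_def)
    obtain P j q where P: "diagonal_pullback E1 E2 = (P, j, q)" by (cases "diagonal_pullback E1 E2")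
    have ex: "short_exact ?N2 M (P, j, q)"
      using short_exact_diagonal_pullback[OF N wmod_axioms E1(2) E2(2)] P E1 E2 by simp
    have "ext_cocycle m l a ?N2 (P, j, q) (\<lambda>j. (\<gamma> E1 j, \<gamma> E2 j))"
    proof -
      obtain v1 v2 where v: "v1 \<in> weight_space K1 l" "v2 \<in> weight_space K2 l" "p1 v1 = m" "p2 v2 = m"
        and c: "\<And>j. j \<ge> a \<Longrightarrow> \<gamma> E1 j \<in> carr N \<and> i1 (\<gamma> E1 j) = act K1 (D j) v1"
          "\<And>j. j \<ge> a \<Longrightarrow> \<gamma> E2 j \<in> carr N \<and> i2 (\<gamma> E2 j) = act K2 (D j) v2"
        using \<gamma>[OF E(1)] \<gamma>[OF E(2)] by (auto simp: ext_cocycle_def E1(1) E2(1))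
      have P': "P = \<lparr>carr = {(k, k'). k \<in> carr K1 \<and> k' \<in> carr K2 \<and> p1 k = p2 k'},
          act = (\<lambda>u (k, k'). (act K1 u k, act K2 u k'))\<rparr>" "j = (\<lambda>(n, n'). (i1 n, i2 n'))" "q = (\<lambda>(k, k'). p1 k)"
        using P by (auto simp: E1(1) E2(1) diagonal_pullback_def)
      have "(v1, v2) \<in> weight_space P l" using v by (auto simp: weight_space_def P')
      then show ?thesis
        unfolding ext_cocycle_def using v c by (auto simp: P' carr2 intro!: bexI[of _ "(v1, v2)"])
    qed
    moreover have "w_hom ?N2 N (\<lambda>(n, n'). n + n')"
      by (auto simp: w_hom_def prod_module_def N.act_add_right)
    ultimately have "push (\<lambda>(n, n'). n + n') (carr N \<times> carr N) (diagonal_pullback E1 E2) E \<longleftrightarrow>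
        is_coboundary a l N (\<lambda>j. (\<gamma> E1 j + \<gamma> E2 j) - \<gamma> E j)"
      using push_iff[OF wmod_prod_module[OF N N] N _ ex _ E3(2)] \<gamma>[OF E(3)] P E3(1) by (simp add: carr2)
    also have "\<dots> \<longleftrightarrow> X (\<lambda>j. \<gamma> E1 j + \<gamma> E2 j) = X (\<gamma> E)"
      by (rule diff[OF Z_add[OF \<gamma>Z[OF E(1)] \<gamma>Z[OF E(2)]] \<gamma>Z[OF E(3)]])
    also have "X (\<lambda>j. \<gamma> E1 j + \<gamma> E2 j) = \<chi> E1 + \<chi> E2"
      using X_add \<gamma>Z[OF E(1)] \<gamma>Z[OF E(2)] by (simp add: \<chi>_def Z_def)
    finally show "push (\<lambda>(n, n'). n + n') (carr N \<times> carr N) (diagonal_pullback E1 E2) E \<longleftrightarrow> \<chi> E1 + \<chi> E2 = \<chi> E"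
      by (simp add: \<chi>_def)
  next
    show "\<chi> ` ?S = Y"
    proof (intro equalityI subsetI)
      fix y assume "y \<in> \<chi> ` ?S"
      then show "y \<in> Y" using X_im \<gamma>Z by (auto simp: \<chi>_def Z_def)
    next
      fix y assume "y \<in> Y"
      then obtain E c where "E \<in> ?S" "ext_cocycle m l a N E c" "X c = y" using X_onto by blast
      then show "y \<in> \<chi> ` ?S" using \<chi>_eq by (intro image_eqI[of _ _ E]) auto
    qed
  qed (rule Y)
qed

section \<open>From representations of the Lie algebra to modules over the enveloping algebra\<close>

text \<open>Complex vector spaces on a subset of an abelian group, with scalars that are only meaningful on that subset; \<open>V\<close> will be
  the underlying space of a module that is not yet constructed.\<close>

locale cspace =
  fixes V :: "'v::ab_group_add set" and sc :: "complex \<Rightarrow> 'v \<Rightarrow> 'v"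
  assumes subgroup: "add_subgroup V"
    and sc_mem [simp]: "x \<in> V \<Longrightarrow> sc c x \<in> V"
    and sc_add_right: "x \<in> V \<Longrightarrow> y \<in> V \<Longrightarrow> sc c (x + y) = sc c x + sc c y"
    and sc_add_left: "x \<in> V \<Longrightarrow> sc (a + b) x = sc a x + sc b x"
    and sc_mult [simp]: "x \<in> V \<Longrightarrow> sc a (sc b x) = sc (a * b) x"
    and sc_one [simp]: "x \<in> V \<Longrightarrow> sc 1 x = x"
begin

lemma zero_mem [simp]: "0 \<in> V"
  and add_mem [simp]: "x \<in> V \<Longrightarrow> y \<in> V \<Longrightarrow> x + y \<in> V"
  and uminus_mem [simp]: "x \<in> V \<Longrightarrow> - x \<in> V"
  using subgroup by (auto simp: add_subgroup_def)

lemma diff_mem [simp]: "x \<in> V \<Longrightarrow> y \<in> V \<Longrightarrow> x - y \<in> V"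
  using add_mem[of x "- y"] by simp

lemma sum_mem: "(\<And>n. n \<in> A \<Longrightarrow> g n \<in> V) \<Longrightarrow> (\<Sum>n\<in>A. g n) \<in> V"
  by (induction A rule: infinite_finite_induct) auto

lemma sc_zero_right [simp]: "sc c 0 = 0"
  using sc_add_right[of 0 0 c] by simp

lemma sc_zero_left [simp]: "x \<in> V \<Longrightarrow> sc 0 x = 0"
  using sc_add_left[of x 0 0] by simp

lemma sc_uminus_right: "x \<in> V \<Longrightarrow> sc c (- x) = - sc c x"
  using sc_add_right[of x "- x" c] by (simp add: eq_neg_iff_add_eq_0 add.commute)

lemma sc_diff_right: "x \<in> V \<Longrightarrow> y \<in> V \<Longrightarrow> sc c (x - y) = sc c x - sc c y"
  using sc_add_right[of x "- y" c] by (simp add: sc_uminus_right)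

lemma sc_sum_right: "(\<And>n. n \<in> A \<Longrightarrow> g n \<in> V) \<Longrightarrow> sc c (\<Sum>n\<in>A. g n) = (\<Sum>n\<in>A. sc c (g n))"
  by (induction A rule: infinite_finite_induct) (auto simp: sc_add_right sum_mem)

definition comb :: "(nat \<Rightarrow> 'v) \<Rightarrow> complex poly \<Rightarrow> 'v" where
  "comb g p = (\<Sum>n\<le>degree p. sc (coeff p n) (g n))"

lemma comb_extend:
  assumes "\<And>n. g n \<in> V" "degree p \<le> N"
  shows "comb g p = (\<Sum>n\<le>N. sc (coeff p n) (g n))"
  unfolding comb_def using assms
  by (intro sum.mono_neutral_left) (auto simp: coeff_eq_0)

lemma comb_mem [simp]: "(\<And>n. g n \<in> V) \<Longrightarrow> comb g p \<in> V"
  unfolding comb_def by (intro sum_mem) auto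

lemma comb_add: "(\<And>n. g n \<in> V) \<Longrightarrow> comb g (p + q) = comb g p + comb g q"
  using comb_extend[of g p "max (degree p) (degree q)"] comb_extend[of g q "max (degree p) (degree q)"]
    comb_extend[of g "p + q" "max (degree p) (degree q)"]
  by (simp add: degree_add_le sc_add_left sum.distrib)

lemma comb_0 [simp]: "(\<And>n. g n \<in> V) \<Longrightarrow> comb g 0 = 0"
  by (simp add: comb_def)

lemma comb_smult: "(\<And>n. g n \<in> V) \<Longrightarrow> comb g (smult c p) = sc c (comb g p)"
  using comb_extend[of g "smult c p" "degree p"]
  by (simp add: comb_def sc_sum_right degree_smult_le)

lemma comb_monom: "(\<And>n. g n \<in> V) \<Longrightarrow> comb g (monom c n) = sc c (g n)"
proof -
  assume g: "\<And>n. g n \<in> V"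
  have "comb g (monom c n) = (\<Sum>k\<le>n. sc (coeff (monom c n) k) (g k))"
    by (rule comb_extend[OF g]) (simp add: degree_monom_le)
  also have "\<dots> = (\<Sum>k\<le>n. if k = n then sc c (g k) else 0)"
    using g by (intro sum.cong) (auto simp:)
  finally show ?thesis by simp
qed

lemma comb_pCons: "(\<And>n. g n \<in> V) \<Longrightarrow> comb g (pCons a p) = sc a (g 0) + comb (\<lambda>n. g (Suc n)) p"
proof -
  assume g: "\<And>n. g n \<in> V"
  have "comb g (pCons a p) = (\<Sum>n\<le>Suc (degree p). sc (coeff (pCons a p) n) (g n))"
    by (rule comb_extend[OF g]) (simp add: degree_pCons_le)
  then show ?thesis by (simp add: sum.atMost_Suc_shift comb_def del: sum.atMost_Suc)
qed

lemma comb_diff_fun: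
  "(\<And>n. g n \<in> V) \<Longrightarrow> (\<And>n. h n \<in> V) \<Longrightarrow> comb (\<lambda>n. g n - h n) p = comb g p - comb h p"
  by (simp add: comb_def sc_diff_right sum_subtractf)

lemma comb_map:
  assumes "\<And>x y. x \<in> V \<Longrightarrow> y \<in> V \<Longrightarrow> F (x + y) = F x + F y" "\<And>c x. x \<in> V \<Longrightarrow> F (sc c x) = sc c (F x)"
    "\<And>n. g n \<in> V"
  shows "F (comb g p) = comb (\<lambda>n. F (g n)) p"
proof -
  have "F 0 = 0" using assms(1)[of 0 0] by simp
  then have "F (\<Sum>n\<in>A. h n) = (\<Sum>n\<in>A. F (h n))" if "\<And>n. h n \<in> V" for h and A :: "nat set"
    using that by (induction A rule: infinite_finite_induct) (auto simp: assms(1) sum_mem)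
  from this[of "\<lambda>n. sc (coeff p n) (g n)"] show ?thesis
    using assms(2,3) by (auto simp: comb_def)
qed

end

lemma abs_rep_UW: "abs_UW (rep_UW u) = u"
  by (rule Quotient3_abs_rep[OF Quotient3_UW])

text \<open>The universal property of the enveloping algebra: a Lie algebra representation extends to words, hence to
  the free algebra, and the ideal of relations acts by zero.\<close>

locale lie_rep = cspace +
  fixes \<rho> :: "witt \<Rightarrow> 'a \<Rightarrow> 'a"
  assumes rho_mem [simp]: "v \<in> V \<Longrightarrow> \<rho> x v \<in> V"
    and rho_add_right: "v \<in> V \<Longrightarrow> w \<in> V \<Longrightarrow> \<rho> x (v + w) = \<rho> x v + \<rho> x w"
    and rho_sc: "v \<in> V \<Longrightarrow> \<rho> x (sc c v) = sc c (\<rho> x v)"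
    and rho_add_left: "v \<in> V \<Longrightarrow> \<rho> (x + y) v = \<rho> x v + \<rho> y v"
    and rho_scale: "v \<in> V \<Longrightarrow> \<rho> (witt_scale c x) v = sc c (\<rho> x v)"
    and rho_bracket: "v \<in> V \<Longrightarrow> \<rho> (bracket x y) v = \<rho> x (\<rho> y v) - \<rho> y (\<rho> x v)"
begin

definition word_act :: "witt list \<Rightarrow> 'a \<Rightarrow> 'a" where
  "word_act w v = foldr \<rho> w v"

lemma word_act_mem [simp]: "v \<in> V \<Longrightarrow> word_act w v \<in> V"
  by (induction w) (auto simp: word_act_def)

lemma word_act_add: "v \<in> V \<Longrightarrow> v' \<in> V \<Longrightarrow> word_act w (v + v') = word_act w v + word_act w v'"
proof (induction w)
  case (Cons x w)
  then show ?case
    using word_act_mem[of v w] word_act_mem[of v' w] by (simp add: word_act_def rho_add_right)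
qed (simp add: word_act_def)

lemma word_act_sc: "v \<in> V \<Longrightarrow> word_act w (sc c v) = sc c (word_act w v)"
proof (induction w)
  case (Cons x w)
  then show ?case using word_act_mem[of v w] by (simp add: word_act_def rho_sc)
qed (simp add: word_act_def)

lemma word_act_append: "word_act (w + w') v = word_act w (word_act w' v)"
  by (simp add: word_act_def plus_list_def)

definition free_act :: "free_alg \<Rightarrow> 'a \<Rightarrow> 'a" where
  "free_act f v = (\<Sum>w\<in>Poly_Mapping.keys f. sc (Poly_Mapping.lookup f w) (word_act w v))"

lemma free_act_extend:
  "v \<in> V \<Longrightarrow> finite A \<Longrightarrow> Poly_Mapping.keys f \<subseteq> A \<Longrightarrow>
    free_act f v = (\<Sum>w\<in>A. sc (Poly_Mapping.lookup f w) (word_act w v))"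
  unfolding free_act_def by (intro sum.mono_neutral_left) (auto simp: in_keys_iff)

lemma free_act_mem [simp]: "v \<in> V \<Longrightarrow> free_act f v \<in> V"
  unfolding free_act_def by (intro sum_mem) auto

lemma free_act_add: "v \<in> V \<Longrightarrow> free_act (f + g) v = free_act f v + free_act g v"
proof -
  assume v: "v \<in> V"
  let ?A = "Poly_Mapping.keys f \<union> Poly_Mapping.keys g"
  have "free_act h v = (\<Sum>w\<in>?A. sc (Poly_Mapping.lookup h w) (word_act w v))"
    if "Poly_Mapping.keys h \<subseteq> ?A" for h
    using v that by (intro free_act_extend) auto
  from this[of f] this[of g] this[of "f + g"] show ?thesis
    using v keys_add[of f g] by (simp add: lookup_add sc_add_left sum.distrib)
qed

lemma free_act_single [simp]: "v \<in> V \<Longrightarrow> free_act (Poly_Mapping.single w c) v = sc c (word_act w v)"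
  using free_act_extend[of v "{w}" "Poly_Mapping.single w c"] by simp

lemma free_act_zero [simp]: "free_act 0 v = 0"
  by (simp add: free_act_def)

lemma free_act_diff: "v \<in> V \<Longrightarrow> free_act (f - g) v = free_act f v - free_act g v"
  using free_act_add[of v "f - g" g] by simp

lemma free_act_add_right: "v \<in> V \<Longrightarrow> w \<in> V \<Longrightarrow> free_act f (v + w) = free_act f v + free_act f w"
  by (simp add: free_act_def word_act_add sc_add_right sum.distrib)

lemma free_act_mult: "v \<in> V \<Longrightarrow> free_act (f * g) v = free_act f (free_act g v)"
proof (induction f rule: free_alg_induct)
  case (add k c f)
  have "free_act (Poly_Mapping.single k c * g) v = sc c (word_act k (free_act g v))"
  proof (induction g rule: free_alg_induct)
    case zero
    have "word_act k 0 = 0" using word_act_add[of 0 0 k] by simp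
    then show ?case by simp
  next
    case (add k' c' g)
    then show ?case
      using \<open>v \<in> V\<close>
      by (simp add: distrib_left free_act_add mult_single word_act_append word_act_sc word_act_add sc_add_right)
  qed
  then show ?case using add by (simp add: distrib_right free_act_add)
qed simp

lemma U_ideal_acts_zero: "f \<in> U_ideal \<Longrightarrow> v \<in> V \<Longrightarrow> free_act f v = 0"
proof -
  define I where "I = {f. \<forall>v\<in>V. free_act f v = 0}"
  have "free_act f 0 = 0" for f
    using free_act_add_right[of 0 0 f] by simp
  then have "two_sided_ideal I"
    by (auto simp: two_sided_ideal_def I_def free_act_add free_act_mult)
  moreover have "U_relations \<subseteq> I"
    by (auto simp: U_relations_def I_def free_act_diff free_act_mult free_act_add word_act_def
        rho_add_left rho_scale rho_bracket)
  ultimately have "U_ideal \<subseteq> I" unfolding U_ideal_def by (rule hull_minimal[rotated])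
  then show "f \<in> U_ideal \<Longrightarrow> v \<in> V \<Longrightarrow> free_act f v = 0" by (auto simp: I_def)
qed

definition rep_module :: "'a wmod" where
  "rep_module = \<lparr>carr = V, act = (\<lambda>u. free_act (rep_UW u))\<rparr>"

lemma carr_rep_module [simp]: "carr rep_module = V"
  by (simp add: rep_module_def)

lemma act_rep_module: "v \<in> V \<Longrightarrow> act rep_module (abs_UW f) v = free_act f v"
proof -
  assume v: "v \<in> V"
  have "rep_UW (abs_UW f) - f \<in> U_ideal"
    using abs_rep_UW[of "abs_UW f"] by (simp add: UW.abs_eq_iff)
  from U_ideal_acts_zero[OF this v] show ?thesis using v by (simp add: rep_module_def free_act_diff)
qed

lemma act_rep_module_inc [simp]: "v \<in> V \<Longrightarrow> act rep_module (inc x) v = \<rho> x v"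
  by (simp add: inc.abs_eq act_rep_module word_act_def)

lemma act_rep_module_scal [simp]: "v \<in> V \<Longrightarrow> cscale rep_module c v = sc c v"
  by (simp add: scal.abs_eq act_rep_module word_act_def)

lemma wmod_rep_module: "wmod rep_module"
proof
  have mem: "act rep_module u x \<in> V" if "x \<in> V" for u x
    using that by (simp add: rep_module_def)
  show "w_module rep_module"
    unfolding left_module_def carr_rep_module
  proof (intro conjI ballI)
    fix r s x y assume x: "x \<in> V" "y \<in> V"
    obtain f g where "r = abs_UW f" "s = abs_UW g" using abs_rep_UW by metis
    then show "act rep_module (r + s) x = act rep_module r x + act rep_module s x"
      "act rep_module (r * s) x = act rep_module r (act rep_module s x)"
      using x by (simp_all add: plus_UW.abs_eq times_UW.abs_eq act_rep_module free_act_add free_act_mult)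
    show "act rep_module r (x + y) = act rep_module r x + act rep_module r y"
      using x by (simp add: rep_module_def free_act_add_right)
  next
    fix x assume "x \<in> V"
    then show "act rep_module 1 x = x" using act_rep_module_scal[of x 1] by (simp add: scal_1)
  qed (use mem subgroup in auto)
qed

end

section \<open>The module induced from a cocycle\<close>

lemma bracket_add_right: "bracket x (y + z) = bracket x y + bracket x z"
  and bracket_add_left: "bracket (x + y) z = bracket x z + bracket y z"
  and bracket_scale_right: "bracket x (witt_scale c y) = witt_scale c (bracket x y)"
  and bracket_scale_left: "bracket (witt_scale c x) y = witt_scale c (bracket x y)"
  and bracket_anticommute: "bracket y x = - bracket x y"
  and jacobi: "bracket z (bracket x y) = bracket (bracket z x) y + bracket x (bracket z y)"
  and bracket_self [simp]: "bracket x x = 0"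
proof -
  have diff: "der D (p - q) = der D p - der D q" for D p q
  proof -
    have "der D (p - q) + der D q = der D ((p - q) + q)" using der[of D] by (simp only: mem_Collect_eq)
    then show ?thesis by (simp add: diff_eq_eq[symmetric] eq_diff_eq)
  qed
  have add: "der D (p + q) = der D p + der D q" and scl: "der D (smult c p) = smult c (der D p)" for D c p q
    using der[of D] by auto
  show "bracket x (y + z) = bracket x y + bracket x z"
    and "bracket (x + y) z = bracket x z + bracket y z"
    and "bracket x (witt_scale c y) = witt_scale c (bracket x y)"
    and "bracket (witt_scale c x) y = witt_scale c (bracket x y)"
    and "bracket y x = - bracket x y"
    and "bracket z (bracket x y) = bracket (bracket z x) y + bracket x (bracket z y)"
    and "bracket x x = 0"
    by (simp_all add: der_inject[symmetric] fun_eq_iff bracket.rep_eq plus_witt.rep_eq uminus_witt.rep_eq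
        witt_scale.rep_eq zero_witt.rep_eq add scl diff smult_diff_right)
qed

text \<open>The space \<open>N \<times> \<complex>[t]\<close> carries the module induced from the extension \<open>N \<oplus> \<complex> v\<close> over \<open>\<bb>\<close> in which
  \<open>d\<^sub>j v = c\<^sub>j\<close>. The pair \<open>(0, t\<^sup>m)\<close> stands for \<open>d\<^sub>-\<^sub>1\<^sup>m v\<close>.\<close>

locale induced = N: wmod N for N :: "'n::ab_group_add wmod" +
  fixes l :: complex and c :: "int \<Rightarrow> 'n"
  assumes cocycle: "is_cocycle 1 l N c"
begin

definition V :: "('n \<times> complex poly) set" where
  "V = carr N \<times> UNIV"

definition sc :: "complex \<Rightarrow> 'n \<times> complex poly \<Rightarrow> 'n \<times> complex poly" where
  "sc a v = (cscale N a (fst v), smult a (snd v))"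

sublocale V: cspace V sc
  by unfold_locales
    (auto simp: V_def sc_def add_subgroup_def zero_prod_def N.act_add_right N.cscale_add smult_add_right smult_add_left)

lemma Pair_mem [simp]: "(n, q) \<in> V \<longleftrightarrow> n \<in> carr N"
  by (simp add: V_def)

lemma fst_mem [simp]: "v \<in> V \<Longrightarrow> fst v \<in> carr N"
  by (auto simp: V_def)

lemma c_mem [simp]: "j \<ge> 1 \<Longrightarrow> c j \<in> carr N"
  using cocycle N.weight_space_mem by (auto simp: is_cocycle_def)

definition lower :: "'n \<times> complex poly \<Rightarrow> 'n \<times> complex poly" where
  "lower v = (act N (D (-1)) (fst v), pCons 0 (snd v))"

lemma lower_mem [simp]: "v \<in> V \<Longrightarrow> lower v \<in> V"
  by (simp add: lower_def)

lemma lower_add: "v \<in> V \<Longrightarrow> w \<in> V \<Longrightarrow> lower (v + w) = lower v + lower w"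
  by (simp add: lower_def N.act_add_right)

lemma lower_sc: "v \<in> V \<Longrightarrow> lower (sc a v) = sc a (lower v)"
  by (simp add: lower_def sc_def N.D_cscale)

lemma lower_diff: "v \<in> V \<Longrightarrow> w \<in> V \<Longrightarrow> lower (v - w) = lower v - lower w"
  by (simp add: lower_def N.act_diff_right)

text \<open>The image of the generator under the basis element \<open>d\<^sub>k\<^sub>-\<^sub>1\<close>; the index shift is that of the exponent of \<open>x\<close>.\<close>

definition top_image :: "nat \<Rightarrow> 'n \<times> complex poly" where
  "top_image k = (if k = 0 then (0, [:0, 1:]) else if k = 1 then (0, [:l:]) else (c (int k - 1), 0))"

lemma top_image_mem [simp]: "top_image k \<in> V"
  by (simp add: top_image_def)

text \<open>The action on \<open>(0, t\<^sup>m)\<close>. The second equation is \<open>x d\<^sub>-\<^sub>1 = d\<^sub>-\<^sub>1 x - [d\<^sub>-\<^sub>1, x]\<close>.\<close>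

primrec gen_image :: "nat \<Rightarrow> witt \<Rightarrow> 'n \<times> complex poly" where
  "gen_image 0 x = V.comb top_image (der x [:0, 1:])"
| "gen_image (Suc m) x = lower (gen_image m x) - gen_image m (bracket (d (-1)) x)"

lemma gen_image_mem [simp]: "gen_image m x \<in> V"
  by (induction m arbitrary: x) simp_all

lemma gen_image_add: "gen_image m (x + y) = gen_image m x + gen_image m y"
  by (induction m arbitrary: x y) (simp_all add: V.comb_add plus_witt.rep_eq lower_add bracket_add_right)

lemma gen_image_scale: "gen_image m (witt_scale a x) = sc a (gen_image m x)"
  by (induction m arbitrary: x)
    (simp_all add: V.comb_smult witt_scale.rep_eq lower_sc bracket_scale_right V.sc_diff_right)

lemma gen_image_zero [simp]: "gen_image m 0 = 0"
  using gen_image_add[of m 0 0] by simp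

lemma der_d_X: "der (d i) [:0, 1:] = monom 1 (nat (i + 1))"
  by (simp add: d.rep_eq pderiv_pCons)

lemma gen_image_lower: "gen_image m (d (-1)) = (0, monom 1 (Suc m))"
proof (induction m)
  case 0
  have "gen_image 0 (d (-1)) = V.comb top_image (monom 1 0)" by (simp add: der_d_X)
  also have "\<dots> = top_image 0" by (subst V.comb_monom) simp_all
  finally show ?case by (simp add: top_image_def monom_Suc)
qed (simp add: lower_def monom_Suc)

definition rho :: "witt \<Rightarrow> 'n \<times> complex poly \<Rightarrow> 'n \<times> complex poly" where
  "rho x v = (act N (inc x) (fst v), 0) + V.comb (\<lambda>m. gen_image m x) (snd v)"

lemma rho_mem [simp]: "v \<in> V \<Longrightarrow> rho x v \<in> V"
  by (simp add: rho_def)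

lemma rho_add_right: "v \<in> V \<Longrightarrow> w \<in> V \<Longrightarrow> rho x (v + w) = rho x v + rho x w"
  by (simp add: rho_def V.comb_add N.act_add_right algebra_simps)

lemma sc_Pair [simp]: "sc a (n, q) = (cscale N a n, smult a q)"
  by (simp add: sc_def)

lemma rho_sc: "v \<in> V \<Longrightarrow> rho x (sc a v) = sc a (rho x v)"
  by (cases v) (simp add: rho_def V.comb_smult N.act_cscale[of _ "inc x"] V.sc_add_right)

lemma rho_add_left: "v \<in> V \<Longrightarrow> rho (x + y) v = rho x v + rho y v"
proof -
  assume v: "v \<in> V"
  have "V.comb (\<lambda>m. gen_image m (x + y)) q = V.comb (\<lambda>m. gen_image m x) q + V.comb (\<lambda>m. gen_image m y) q" for q
    by (simp add: gen_image_add V.comb_def V.sc_add_right sum.distrib)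
  then show ?thesis using v by (simp add: rho_def inc_add N.act_add_left algebra_simps)
qed

lemma rho_scale: "v \<in> V \<Longrightarrow> rho (witt_scale a x) v = sc a (rho x v)"
proof -
  assume v: "v \<in> V"
  have "V.comb (\<lambda>m. gen_image m (witt_scale a x)) q = sc a (V.comb (\<lambda>m. gen_image m x) q)" for q
    by (simp add: gen_image_scale V.comb_def V.sc_sum_right mult.commute)
  then show ?thesis using v by (simp add: rho_def inc_scale N.act_mult V.sc_add_right)
qed

lemma rho_lower: "v \<in> V \<Longrightarrow> rho (d (-1)) v = lower v"
proof -
  have "V.comb (\<lambda>m. (0, monom 1 (Suc m))) q = (0, pCons 0 q)" for q
  proof (induction q)
    case (pCons a q)
    have "V.comb (\<lambda>m. (0, monom 1 (Suc m))) (pCons a q)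
        = sc a (0, monom 1 1) + V.comb (\<lambda>m. lower (0, monom 1 (Suc m))) q"
      by (subst V.comb_pCons) (simp_all add: lower_def monom_Suc)
    also have "V.comb (\<lambda>m. lower (0, monom 1 (Suc m))) q = lower (V.comb (\<lambda>m. (0, monom 1 (Suc m))) q)"
      by (rule V.comb_map[symmetric]) (simp_all add: lower_add lower_sc)
    finally show ?case unfolding pCons.IH by (simp add: lower_def monom_Suc)
  qed (simp add: zero_prod_def)
  then show "v \<in> V \<Longrightarrow> rho (d (-1)) v = lower v"
    by (simp add: rho_def gen_image_lower lower_def)
qed

text \<open>The failure of \<open>rho\<close> to respect the bracket. It vanishes when \<open>x = d\<^sub>-\<^sub>1\<close> by construction, on \<open>N\<close> because \<open>N\<close> is a
  module, and on the generator by the cocycle identity; \<open>defect_step\<close> then carries it along powers of \<open>d\<^sub>-\<^sub>1\<close>.\<close>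

definition defect :: "witt \<Rightarrow> witt \<Rightarrow> 'n \<times> complex poly \<Rightarrow> 'n \<times> complex poly" where
  "defect x y v = rho x (rho y v) - rho y (rho x v) - rho (bracket x y) v"

lemma rho_diff_right: "v \<in> V \<Longrightarrow> w \<in> V \<Longrightarrow> rho x (v - w) = rho x v - rho x w"
  using rho_add_right[of "v - w" w x] by (simp add: algebra_simps)

lemma rho_zero_right [simp]: "rho x 0 = 0"
  using rho_add_right[of 0 0 x] by simp

lemma rho_zero_left [simp]: "v \<in> V \<Longrightarrow> rho 0 v = 0"
  using rho_add_left[of v 0 0] by simp

lemma rho_uminus_left: "v \<in> V \<Longrightarrow> rho (- x) v = - rho x v"
  using rho_add_left[of v x "- x"] by (simp add: eq_neg_iff_add_eq_0 add.commute)

lemma rho_N: "n \<in> carr N \<Longrightarrow> rho x (n, 0) = (act N (inc x) n, 0)"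
  by (simp add: rho_def)

lemma defect_add_right: "v \<in> V \<Longrightarrow> w \<in> V \<Longrightarrow> defect x y (v + w) = defect x y v + defect x y w"
  by (simp add: defect_def rho_add_right algebra_simps)

lemma defect_lower: "v \<in> V \<Longrightarrow> defect (d (-1)) x v = 0"
proof -
  assume v: "v \<in> V"
  obtain n q where nq: "v = (n, q)" "n \<in> carr N" using v by (auto simp: V_def)
  have N: "defect (d (-1)) x (n, 0) = 0"
    using nq(2) by (simp add: defect_def rho_N inc_bracket N.act_diff_left N.act_mult)
  have rho0: "rho y (0, p) = V.comb (\<lambda>m. gen_image m y) p" for y p
    by (simp add: rho_def zero_prod_def[symmetric])
  have "defect (d (-1)) x (0, q) = lower (V.comb (\<lambda>m. gen_image m x) q)
      - V.comb (\<lambda>m. gen_image m x) (pCons 0 q) - V.comb (\<lambda>m. gen_image m (bracket (d (-1)) x)) q"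
  proof -
    have "rho (d (-1)) (rho x (0, q)) = lower (V.comb (\<lambda>m. gen_image m x) q)"
      by (subst rho_lower) (simp_all add: rho0)
    moreover have "rho x (rho (d (-1)) (0, q)) = V.comb (\<lambda>m. gen_image m x) (pCons 0 q)"
      by (subst rho_lower) (simp_all add: lower_def rho0)
    ultimately show ?thesis by (simp add: defect_def rho0)
  qed
  also have "lower (V.comb (\<lambda>m. gen_image m x) q) = V.comb (\<lambda>m. lower (gen_image m x)) q"
    by (rule V.comb_map) (simp_all add: lower_add lower_sc)
  also have "V.comb (\<lambda>m. gen_image m x) (pCons 0 q) = V.comb (\<lambda>m. gen_image (Suc m) x) q"
    by (subst V.comb_pCons) simp_all
  also have "V.comb (\<lambda>m. gen_image (Suc m) x) q =
      V.comb (\<lambda>m. lower (gen_image m x)) q - V.comb (\<lambda>m. gen_image m (bracket (d (-1)) x)) q"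
    unfolding gen_image.simps by (rule V.comb_diff_fun) simp_all
  finally have "defect (d (-1)) x (0, q) = 0" by simp
  with N show ?thesis using defect_add_right[of "(n, 0)" "(0, q)" "d (-1)" x] nq by simp
qed

lemma defect_anticommute: "v \<in> V \<Longrightarrow> defect y x v = - defect x y v"
  using bracket_anticommute[of y x] by (simp add: defect_def rho_uminus_left algebra_simps)

lemma defect_add_left: "v \<in> V \<Longrightarrow> defect (x + x') y v = defect x y v + defect x' y v"
  by (simp add: defect_def rho_add_left rho_add_right bracket_add_left algebra_simps)

lemma defect_scale_left: "v \<in> V \<Longrightarrow> defect (witt_scale a x) y v = sc a (defect x y v)"
  by (simp add: defect_def rho_scale rho_sc bracket_scale_left V.sc_diff_right)

lemma defect_sc: "v \<in> V \<Longrightarrow> defect x y (sc a v) = sc a (defect x y v)"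
  by (simp add: defect_def rho_sc V.sc_diff_right)

text \<open>Commuting \<open>d\<^sub>-\<^sub>1\<close> past \<open>x\<close>, \<open>y\<close> and \<open>[x, y]\<close> produces the correction terms, which combine to defects by the Jacobi
  identity.\<close>

lemma defect_step: "v \<in> V \<Longrightarrow> defect x y (lower v) =
    lower (defect x y v) - defect (bracket (d (-1)) x) y v - defect x (bracket (d (-1)) y) v"
proof -
  assume v: "v \<in> V"
  let ?L = "rho (d (-1))" and ?B = "bracket (d (-1))"
  have swap: "rho x (?L w) = ?L (rho x w) - rho (?B x) w" if "w \<in> V" for x w
    using defect_lower[OF that, of x] by (simp add: defect_def algebra_simps)
  have e: "rho x (rho y (?L v)) = ?L (rho x (rho y v)) - rho (?B x) (rho y v) - rho x (rho (?B y) v)" for x y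
    by (simp add: v swap[of v y] swap[of "rho y v" x] rho_diff_right)
  have "rho (bracket x y) (?L v) = ?L (rho (bracket x y) v) - rho (bracket (?B x) y) v - rho (bracket x (?B y)) v"
    by (simp add: v swap[of v "bracket x y"] jacobi[of "d (-1)" x y] rho_add_left)
  moreover have "lower (defect x y v) = ?L (rho x (rho y v)) - ?L (rho y (rho x v)) - ?L (rho (bracket x y) v)"
    using v by (simp add: defect_def rho_lower lower_diff)
  moreover have "lower v = ?L v" using v by (simp add: rho_lower)
  ultimately show ?thesis using e[of x y] e[of y x] by (simp add: defect_def)
qed

lemma rho_top: "rho (d j) (0, 1) = top_image (nat (j + 1))"
proof -
  have "rho (d j) (0, 1) = V.comb top_image (der (d j) [:0, 1:])"
    by (simp add: rho_def one_pCons V.comb_pCons zero_prod_def[symmetric])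
  then show ?thesis by (simp add: der_d_X V.comb_monom)
qed

text \<open>The defect is bilinear, so basis elements suffice. For indices \<open>\<ge> 1\<close> the equation is the cocycle identity, and
  for index \<open>0\<close> it states that \<open>c\<^sub>j\<close> has weight \<open>l + j\<close>.\<close>

lemma defect_top: "defect x y (0, 1) = 0"
proof -
  have basis: "defect (d i) (d j) (0, 1) = 0" if ij: "i \<ge> -1" "j \<ge> -1" for i j
  proof -
    consider "i = -1" | "j = -1" | "i \<ge> 0" "j \<ge> 0" using ij by linarith
    then show ?thesis
    proof cases
      case 1
      then show ?thesis by (simp add: defect_lower)
    next
      case 2
      then show ?thesis using defect_anticommute[of "(0, 1)" "d i" "d j"] by (simp add: defect_lower)
    next
      case 3
      have top: "rho (d k) (0, 1) = (if k = 0 then (0, [:l:]) else (c k, 0))" if "k \<ge> 0" for k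
      proof -
        have "nat (k + 1) = Suc 0 \<longleftrightarrow> k = 0" "nat (k + 1) \<noteq> 0" using that by auto
        then show ?thesis using that by (simp add: rho_top top_image_def)
      qed
      have topl: "rho (d k) (0, [:l:]) = sc l (if k = 0 then (0, [:l:]) else (c k, 0))" if "k \<ge> 0" for k
        using rho_sc[of "(0, 1)" "d k" l] top[OF that] by simp
      have br: "rho (bracket (d i) (d j)) (0, 1) = sc (of_int (j - i)) (rho (d (i + j)) (0, 1))"
        using ij by (simp add: bracket_d rho_scale)
      have w: "act N (D 0) (c k) = cscale N (l + of_int k) (c k)" if "k \<ge> 1" for k
        using cocycle that N.weight_space_eq by (auto simp: is_cocycle_def)
      have "act N (D i) (c j) - act N (D j) (c i) = cscale N (of_int (j - i)) (c (i + j))"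
        if "i \<ge> 1" "j \<ge> 1"
        using cocycle that unfolding is_cocycle_def by auto
      then show ?thesis
        using 3 unfolding defect_def br
        by (auto simp: top topl rho_N w N.cscale_add N.cscale_uminus zero_prod_def algebra_simps)
    qed
  qed
  have half: "defect x (d j) (0, 1) = 0" if "j \<ge> -1" for x j
  proof -
    have "x \<in> witt.span (d ` {-1..})" by (simp add: span_d)
    then show ?thesis
    proof (induction rule: witt.span_induct_alt)
      case base
      then show ?case using defect_add_left[of "(0, 1)" 0 0] by simp
    next
      case (step a y z)
      then show ?case using basis that by (auto simp: defect_add_left defect_scale_left)
    qed
  qed
  have "y \<in> witt.span (d ` {-1..})" by (simp add: span_d)
  then have "defect y x (0, 1) = 0"
  proof (induction rule: witt.span_induct_alt)
    case base
    then show ?case using defect_add_left[of "(0, 1)" 0 0] by simp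
  next
    case (step a y z)
    then obtain j where "j \<ge> -1" "y = d j" by auto
    then have "defect y x (0, 1) = 0"
      using half[of j x] defect_anticommute[of "(0, 1)" "d j" x] by simp
    then show ?case using step by (simp add: defect_add_left defect_scale_left)
  qed
  then show ?thesis using defect_anticommute[of "(0, 1)" x y] by simp
qed

lemma defect_zero: "v \<in> V \<Longrightarrow> defect x y v = 0"
proof -
  assume v: "v \<in> V"
  obtain n q where nq: "v = (n, q)" "n \<in> carr N" using v by (auto simp: V_def)
  have "defect x y (n, 0) = 0" for x y
    using nq(2) by (simp add: defect_def rho_N inc_bracket N.act_diff_left N.act_mult)
  moreover have "defect x y (0, q) = 0" for x y
  proof (induction q arbitrary: x y)
    case 0
    then show ?case by (simp add: defect_def zero_prod_def[symmetric])
  next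
    case (pCons a q)
    have "(0, pCons a q) = sc a (0, 1) + lower (0, q)" by (simp add: lower_def one_pCons)
    then have "defect x y (0, pCons a q) = sc a (defect x y (0, 1)) + defect x y (lower (0, q))"
      by (simp only: defect_add_right defect_sc V.sc_mem lower_mem Pair_mem N.zero_mem)
    moreover have "defect x y (lower (0, q)) = 0"
      by (subst defect_step) (simp_all add: pCons.IH, simp add: lower_def zero_prod_def)
    ultimately show ?case by (simp add: defect_top)
  qed
  ultimately show ?thesis using defect_add_right[of "(n, 0)" "(0, q)" x y] nq by simp
qed

lemma rho_bracket: "v \<in> V \<Longrightarrow> rho (bracket x y) v = rho x (rho y v) - rho y (rho x v)"
  using defect_zero[of v x y] by (simp add: defect_def)

sublocale R: lie_rep V sc rho
  by unfold_locales
    (simp_all add: rho_add_right rho_sc rho_add_left rho_scale rho_bracket)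

end

context induced
begin

lemma act_N: "n \<in> carr N \<Longrightarrow> act R.rep_module u (n, 0) = (act N u n, 0)"
proof -
  interpret K: wmod R.rep_module by (rule R.wmod_rep_module)
  have "{u. \<forall>n\<in>carr N. act R.rep_module u (n, 0) = (act N u n, 0)} = UNIV"
    by (rule subalgebra_UNIV_iff)
      (auto simp: subalgebra_def rho_N K.act_add_left N.act_add_left K.act_mult N.act_mult)
  then show "n \<in> carr N \<Longrightarrow> act R.rep_module u (n, 0) = (act N u n, 0)" by blast
qed

lemma act_ev_top: "act R.rep_module (ev q) (0, 1) = (0, q)"
proof (induction q)
  case 0
  interpret K: wmod R.rep_module by (rule R.wmod_rep_module)
  show ?case by (simp add: zero_prod_def)
next
  case (pCons a q)
  interpret K: wmod R.rep_module by (rule R.wmod_rep_module)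
  show ?case
    by (simp add: ev_pCons K.act_add_left K.act_mult pCons.IH rho_lower lower_def)
qed

lemma D_top: "j \<ge> 1 \<Longrightarrow> act R.rep_module (D j) (0, 1) = (c j, 0)"
  by (simp add: rho_top top_image_def)

lemma top_weight: "(0, 1) \<in> weight_space R.rep_module l"
  by (simp add: weight_space_def rho_top top_image_def)

end

section \<open>A criterion for category O\<close>

context wmod
begin

definition cspan :: "'v set \<Rightarrow> 'v set" where
  "cspan F = {\<Sum>b\<in>F. cscale M (k b) b | k. True}"

lemma cspanI: "(\<Sum>b\<in>F. cscale M (k b) b) \<in> cspan F"
  by (auto simp: cspan_def)

lemma cspan_add:
  "F \<subseteq> carr M \<Longrightarrow> x \<in> cspan F \<Longrightarrow> y \<in> cspan F \<Longrightarrow> x + y \<in> cspan F"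
proof -
  assume F: "F \<subseteq> carr M" and "x \<in> cspan F" "y \<in> cspan F"
  then obtain k k' where "x = (\<Sum>b\<in>F. cscale M (k b) b)" "y = (\<Sum>b\<in>F. cscale M (k' b) b)"
    by (auto simp: cspan_def)
  then have "x + y = (\<Sum>b\<in>F. cscale M (k b + k' b) b)"
    using F by (simp add: cscale_add subset_iff sum.distrib)
  then show ?thesis by (simp only: cspanI)
qed

lemma cspan_cscale: "F \<subseteq> carr M \<Longrightarrow> x \<in> cspan F \<Longrightarrow> cscale M a x \<in> cspan F"
proof -
  assume F: "F \<subseteq> carr M" and "x \<in> cspan F"
  then obtain k where "x = (\<Sum>b\<in>F. cscale M (k b) b)" by (auto simp: cspan_def)
  then have "cscale M a x = (\<Sum>b\<in>F. cscale M (a * k b) b)"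
    using F by (simp add: act_sum_right subset_iff)
  then show ?thesis by (simp only: cspanI)
qed

lemma cspan_zero: "F \<subseteq> carr M \<Longrightarrow> 0 \<in> cspan F"
  unfolding cspan_def by (intro CollectI exI[of _ "\<lambda>_. 0"]) (auto simp: subset_iff intro!: sum.neutral[symmetric])

lemma cspan_base: "finite F \<Longrightarrow> F \<subseteq> carr M \<Longrightarrow> x \<in> F \<Longrightarrow> x \<in> cspan F"
proof -
  assume F: "finite F" "F \<subseteq> carr M" "x \<in> F"
  have "(\<Sum>b\<in>F. cscale M (if b = x then 1 else 0) b) = (\<Sum>b\<in>F. if b = x then x else 0)"
    using F by (intro sum.cong) auto
  then show ?thesis using F cspanI[of "\<lambda>b. if b = x then 1 else 0" F] by simp
qed

lemma cspan_insert: "finite F \<Longrightarrow> b \<notin> F \<Longrightarrow>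
    x \<in> cspan (insert b F) \<longleftrightarrow> (\<exists>a. \<exists>y\<in>cspan F. x = cscale M a b + y)"
proof
  assume F: "finite F" "b \<notin> F" and "x \<in> cspan (insert b F)"
  then obtain k where "x = (\<Sum>c\<in>insert b F. cscale M (k c) c)" by (auto simp only: cspan_def)
  then have "x = cscale M (k b) b + (\<Sum>c\<in>F. cscale M (k c) c)" using F by simp
  then show "\<exists>a. \<exists>y\<in>cspan F. x = cscale M a b + y" using cspanI by blast
next
  assume F: "finite F" "b \<notin> F" and "\<exists>a. \<exists>y\<in>cspan F. x = cscale M a b + y"
  then obtain a k where x: "x = cscale M a b + (\<Sum>b\<in>F. cscale M (k b) b)" by (auto simp only: cspan_def)
  have "(\<Sum>c\<in>F. cscale M (k c) c) = (\<Sum>c\<in>F. cscale M ((k(b := a)) c) c)"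
    using F by (intro sum.cong) auto
  then have "x = (\<Sum>c\<in>insert b F. cscale M ((k(b := a)) c) c)" using F x by simp
  then show "x \<in> cspan (insert b F)" by (simp only: cspanI)
qed

lemma cspan_mem: "F \<subseteq> carr M \<Longrightarrow> x \<in> cspan F \<Longrightarrow> x \<in> carr M"
  unfolding cspan_def by (auto intro!: sum_mem)

lemma cspan_sum:
  "F \<subseteq> carr M \<Longrightarrow> (\<And>i. i \<in> A \<Longrightarrow> g i \<in> cspan F) \<Longrightarrow> (\<Sum>i\<in>A. g i) \<in> cspan F"
  by (induction A rule: infinite_finite_induct) (auto intro: cspan_zero cspan_add)

lemma act_cspan:
  assumes "F \<subseteq> carr M" "G \<subseteq> carr M" "\<And>b. b \<in> F \<Longrightarrow> act M u b \<in> cspan G" "x \<in> cspan F"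
  shows "act M u x \<in> cspan G"
proof -
  obtain k where "x = (\<Sum>b\<in>F. cscale M (k b) b)" using assms(4) by (auto simp only: cspan_def)
  moreover have "act M u (\<Sum>b\<in>F. cscale M (k b) b) = (\<Sum>b\<in>F. act M u (cscale M (k b) b))"
    by (rule act_sum_right) (use assms(1) in auto)
  moreover have "act M u (cscale M (k b) b) \<in> cspan G" if "b \<in> F" for b
    using cspan_cscale[OF assms(2) assms(3)[OF that]] act_cscale[of b u] that assms(1) by auto
  ultimately show ?thesis using assms(2) by (auto intro: cspan_sum)
qed

lemma cspan_mono: "finite G \<Longrightarrow> F \<subseteq> G \<Longrightarrow> G \<subseteq> carr M \<Longrightarrow> cspan F \<subseteq> cspan G"
  using act_cspan[of F G 1] cspan_base[of G] cspan_mem[of F] by (auto simp: subset_iff)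

text \<open>Induction on the spanning set: either \<open>X\<close>
  lies in the smaller span, or one element outside of it has a nonzero coordinate at \<open>b\<close> and corrects all
  others.\<close>

lemma subspace_of_cspan:
  assumes "finite F" "F \<subseteq> carr M" "X \<subseteq> cspan F" "0 \<in> X"
    "\<And>x y. x \<in> X \<Longrightarrow> y \<in> X \<Longrightarrow> x + y \<in> X" "\<And>x a. x \<in> X \<Longrightarrow> cscale M a x \<in> X"
  shows "\<exists>B. finite B \<and> B \<subseteq> X \<and> X = cspan B"
  using assms
proof (induction F arbitrary: X rule: finite_induct)
  case empty
  then have "X = cspan {}" by (auto simp: cspan_def)
  then show ?case by blast
next
  case (insert b F)
  have F: "F \<subseteq> carr M" and b: "b \<in> carr M" using insert.prems by auto
  have X: "X \<subseteq> carr M" using insert.prems(2) cspan_mem[OF insert.prems(1)] by (meson subsetD subsetI)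
  note X_add = insert.prems(4) and X_sc = insert.prems(5)
  have "\<exists>B. finite B \<and> B \<subseteq> X \<inter> cspan F \<and> X \<inter> cspan F = cspan B"
  proof (rule insert.IH[OF F])
    show "0 \<in> X \<inter> cspan F" using insert.prems(3) cspan_zero[OF F] by simp
    show "x + y \<in> X \<inter> cspan F" if "x \<in> X \<inter> cspan F" "y \<in> X \<inter> cspan F" for x y
      using that X_add cspan_add[OF F] by simp
    show "cscale M a x \<in> X \<inter> cspan F" if "x \<in> X \<inter> cspan F" for x a
      using that X_sc cspan_cscale[OF F] by simp
  qed simp
  then obtain B where B: "finite B" "B \<subseteq> X" "X \<inter> cspan F = cspan B" by blast
  show ?case
  proof (cases "X \<subseteq> cspan F")
    case True
    then show ?thesis using B by (intro exI[of _ B]) auto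
  next
    case False
    then obtain x where x: "x \<in> X" "x \<notin> cspan F" by blast
    then obtain a y where ay: "y \<in> cspan F" "x = cscale M a b + y"
      using insert.prems(2) cspan_insert[OF insert.hyps] by blast
    have a: "a \<noteq> 0" using ay x b by auto
    have xB: "x \<notin> B" using x(2) B(3) cspan_base[OF B(1) order_trans[OF B(2) X]] by blast
    have "X = cspan (insert x B)"
    proof (intro equalityI subsetI)
      fix z assume z: "z \<in> X"
      then obtain e w where ew: "w \<in> cspan F" "z = cscale M e b + w"
        using insert.prems(2) cspan_insert[OF insert.hyps] by blast
      let ?r = "z + cscale M (- (e / a)) x"
      have r: "?r = w + cscale M (- (e / a)) y"
        using a ay ew b cspan_mem[OF F ay(1)] by (simp add: act_add_right cscale_uminus act_uminus_right)
      have "?r \<in> cspan F" unfolding r by (rule cspan_add[OF F ew(1) cspan_cscale[OF F ay(1)]])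
      moreover have "?r \<in> X" using X_add[OF z X_sc[OF x(1)]] .
      ultimately have "?r \<in> cspan B" using B by blast
      moreover have "z = cscale M (e / a) x + ?r" using x X by (simp add: cscale_uminus subset_iff)
      ultimately show "z \<in> cspan (insert x B)" unfolding cspan_insert[OF B(1) xB] by blast
    next
      fix z assume "z \<in> cspan (insert x B)"
      then obtain e w where "w \<in> cspan B" "z = cscale M e x + w" unfolding cspan_insert[OF B(1) xB] by blast
      moreover from this have "w \<in> X" using B(3) by blast
      ultimately show "z \<in> X" using X_add[OF X_sc[OF x(1)]] by simp
    qed
    then show ?thesis using B x by (intro exI[of _ "insert x B"]) auto
  qed
qed

definition weight_decomposable :: "'v \<Rightarrow> bool" where
  "weight_decomposable x \<longleftrightarrow> (\<exists>g :: complex \<Rightarrow>\<^sub>0 'v.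
    (\<forall>l. Poly_Mapping.lookup g l \<in> weight_space M l) \<and> x = (\<Sum>l\<in>Poly_Mapping.keys g. Poly_Mapping.lookup g l))"

lemma weight_decomposable_weight_vector: "x \<in> weight_space M l \<Longrightarrow> weight_decomposable x"
  unfolding weight_decomposable_def
  by (intro exI[of _ "Poly_Mapping.single l x"]) (auto simp: lookup_single when_def)

lemma weight_decomposable_add:
  assumes "weight_decomposable x" "weight_decomposable y"
  shows "weight_decomposable (x + y)"
proof -
  obtain g h :: "complex \<Rightarrow>\<^sub>0 'v" where
    g: "\<And>l. Poly_Mapping.lookup g l \<in> weight_space M l" "x = (\<Sum>l\<in>Poly_Mapping.keys g. Poly_Mapping.lookup g l)"
    and h: "\<And>l. Poly_Mapping.lookup h l \<in> weight_space M l" "y = (\<Sum>l\<in>Poly_Mapping.keys h. Poly_Mapping.lookup h l)"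
    using assms unfolding weight_decomposable_def by blast
  let ?S = "Poly_Mapping.keys g \<union> Poly_Mapping.keys h"
  have ext: "(\<Sum>l\<in>Poly_Mapping.keys k. Poly_Mapping.lookup k l) = (\<Sum>l\<in>?S. Poly_Mapping.lookup k l)"
    if "Poly_Mapping.keys k \<subseteq> ?S" for k :: "complex \<Rightarrow>\<^sub>0 'v"
    using that by (intro sum.mono_neutral_left) (auto simp: in_keys_iff)
  have "x + y = (\<Sum>l\<in>Poly_Mapping.keys (g + h). Poly_Mapping.lookup (g + h) l)"
    unfolding g(2) h(2) ext[OF keys_add[of g h]] ext[OF Un_upper1] ext[OF Un_upper2]
    by (simp add: lookup_add sum.distrib)
  then show ?thesis
    unfolding weight_decomposable_def using g h
    by (intro exI[of _ "g + h"]) (simp add: lookup_add weight_space_add)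
qed

lemma weight_decomposable_ev:
  assumes "x \<in> weight_space M l"
  shows "weight_decomposable (act M (ev p) x)"
proof -
  have "weight_decomposable (\<Sum>n\<in>A. cscale M (coeff p n) (act M (D (-1) ^ n) x))" if "finite A" for A
    using that
  proof (induction A rule: finite_induct)
    case empty
    then show ?case using weight_decomposable_weight_vector[OF weight_space_zero] by simp
  next
    case (insert n A)
    then show ?case
      using weight_decomposable_weight_vector[OF weight_space_cscale[OF weight_space_D_power[OF assms]]]
      by (auto intro: weight_decomposable_add)
  qed
  then show ?thesis using weight_space_mem[OF assms] by (simp add: act_ev)
qed

lemma W_plus_stable:
  assumes S: "S \<subseteq> carr M" "0 \<in> S" "\<And>x y. x \<in> S \<Longrightarrow> y \<in> S \<Longrightarrow> x + y \<in> S"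
      "\<And>x a. x \<in> S \<Longrightarrow> cscale M a x \<in> S"
    and D: "\<And>x i. x \<in> S \<Longrightarrow> i \<ge> 1 \<Longrightarrow> act M (D i) x \<in> S" and x: "x \<in> S" and u: "u \<in> U_sub W_plus"
  shows "act M u x \<in> S"
proof -
  let ?A = "{u. \<forall>x\<in>S. act M u x \<in> S}"
  have "subalgebra ?A"
    using S by (auto simp: subalgebra_def act_add_left act_mult subset_iff)
  moreover have "inc ` W_plus \<subseteq> ?A"
  proof (intro image_subsetI CollectI ballI)
    fix y x assume y: "y \<in> W_plus" and x: "x \<in> S"
    show "act M (inc y) x \<in> S"
      using y unfolding W_plus_def
    proof (induction rule: witt.span_induct_alt)
      case base
      have "inc 0 = 0" using inc_add[of 0 0] by simp
      then show ?case using S x by auto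
    next
      case (step a y z)
      then show ?case using S(1) x D[OF x] by (auto simp: inc_add inc_scale act_add_left act_mult subset_iff intro!: S(3,4))
    qed
  qed
  ultimately have "U_sub W_plus \<subseteq> ?A" unfolding U_sub_def by (rule hull_minimal[rotated])
  then show ?thesis using u x by blast
qed

text \<open>By \<open>[d\<^sub>j, d\<^sub>-\<^sub>1] = - (j + 1) d\<^sub>j\<^sub>-\<^sub>1\<close>; the index \<open>j = 0\<close> has to be included, since it is reached from \<open>j = 1\<close>.\<close>

lemma D_power_filtration:
  assumes T: "\<And>n. T n \<subseteq> carr M" "\<And>n x y. x \<in> T n \<Longrightarrow> y \<in> T n \<Longrightarrow> x + y \<in> T n"
      "\<And>n x a. x \<in> T n \<Longrightarrow> cscale M a x \<in> T n"
      "\<And>n x. x \<in> T n \<Longrightarrow> x \<in> T (Suc n)" "\<And>n x. x \<in> T n \<Longrightarrow> act M (D (-1)) x \<in> T (Suc n)"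
    and w: "w \<in> carr M" "\<And>j. j \<ge> 0 \<Longrightarrow> act M (D j) w \<in> T 0" and j: "j \<ge> 0"
    and T0: "\<And>n. act M (D (-1) ^ n) w \<in> T n"
  shows "act M (D j) (act M (D (-1) ^ n) w) \<in> T n"
  using j
proof (induction n arbitrary: j)
  case 0
  then show ?case using w by simp
next
  case (Suc n)
  let ?x = "act M (D (-1) ^ n) w"
  have eq: "act M (D j) (act M (D (-1) ^ Suc n) w) =
      act M (D (-1)) (act M (D j) ?x) + cscale M (of_int (- 1 - j)) (act M (D (j - 1)) ?x)"
    using D_D[of j "-1" ?x] Suc.prems w(1) by (simp add: act_mult)
  have low: "act M (D (j - 1)) ?x \<in> T (Suc n)"
  proof (cases "j = 0")
    case True
    then show ?thesis using T(5)[OF T0] by simp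
  next
    case False
    then show ?thesis using Suc by (intro T(4)) simp
  qed
  show ?case unfolding eq by (rule T(2)[OF T(5)[OF Suc.IH[OF Suc.prems]] T(3)[OF low]])
qed

end

text \<open>A common shape of all extensions that have to be realized: the submodule is generated by the highest weight vector
  \<open>w1\<close>, and \<open>w2\<close> maps to a highest weight vector of the quotient. The uniform degree bound makes the raising operators
  move \<open>w2\<close> only into a finite dimensional space. The notion is invariant under isomorphism.\<close>

definition two_generated :: "'k::ab_group_add wmod \<Rightarrow> bool" where
  "two_generated K \<longleftrightarrow> wmod K \<and> (\<exists>w1 w2 k1 k2 P B. w1 \<in> weight_space K k1 \<and> w2 \<in> weight_space K k2 \<and>
     (\<forall>j\<ge>1. act K (D j) w1 = 0) \<and>
     (\<forall>j\<ge>1. act K (D j) w2 = act K (ev (P j)) w1 \<and> degree (P j) \<le> B) \<and>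
     (\<forall>x\<in>carr K. \<exists>p q. x = act K (ev p) w1 + act K (ev q) w2))"

lemma two_generatedI:
  assumes "wmod K" "w1 \<in> weight_space K k1" "w2 \<in> weight_space K k2"
    "\<And>j. j \<ge> 1 \<Longrightarrow> act K (D j) w1 = 0"
    "\<And>j. j \<ge> 1 \<Longrightarrow> act K (D j) w2 = act K (ev (P j)) w1" "\<And>j::int. j \<ge> 1 \<Longrightarrow> degree (P j) \<le> B"
    "\<And>x. x \<in> carr K \<Longrightarrow> \<exists>p q. x = act K (ev p) w1 + act K (ev q) w2"
  shows "two_generated K"
  unfolding two_generated_def
  by (rule conjI[OF assms(1)], rule exI[of _ w1], rule exI[of _ w2], rule exI[of _ k1], rule exI[of _ k2],
      rule exI[of _ P], rule exI[of _ B]) (simp add: assms)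

text \<open>The spans of \<open>d\<^sub>-\<^sub>1\<^sup>i w1\<close> with \<open>i \<le> B + n\<close> and \<open>d\<^sub>-\<^sub>1\<^sup>i w2\<close> with \<open>i \<le> n\<close> are stable under the raising operators and
  exhaust \<open>K\<close>, which gives the finiteness condition; the weight decomposition is visible on these vectors.\<close>

lemma category_O_two_generated:
  fixes K :: "'k::ab_group_add wmod"
  assumes "two_generated K"
  shows "category_O K"
proof -
  obtain w1 w2 k1 k2 P B where K: "wmod K" and w: "w1 \<in> weight_space K k1" "w2 \<in> weight_space K k2"
    and D1: "\<And>j. j \<ge> 1 \<Longrightarrow> act K (D j) w1 = 0"
    and D2: "\<And>j. j \<ge> 1 \<Longrightarrow> act K (D j) w2 = act K (ev (P j)) w1" "\<And>j::int. j \<ge> 1 \<Longrightarrow> degree (P j) \<le> B"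
    and gen: "\<And>x. x \<in> carr K \<Longrightarrow> \<exists>p q. x = act K (ev p) w1 + act K (ev q) w2"
    using assms unfolding two_generated_def by metis
  interpret wmod K by fact
  have wK [simp]: "w1 \<in> carr K" "w2 \<in> carr K" using w weight_space_mem by auto
  have "finitely_generated K"
    unfolding finitely_generated_def
  proof (intro exI[of _ "{w1, w2}"] conjI allI impI)
    fix S assume S: "submodule K S" "{w1, w2} \<subseteq> S"
    have "act K (ev p) w1 + act K (ev q) w2 \<in> S" for p q
      using S by (auto simp: submodule_def add_subgroup_def)
    then have "carr K \<subseteq> S" using gen by force
    then show "S = carr K" using S by (auto simp: submodule_def)
  qed auto
  moreover have "weight_module K"
  proof (rule weight_moduleI, fold weight_decomposable_def)
    fix x assume "x \<in> carr K"
    then show "weight_decomposable x"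
      using gen w weight_decomposable_add weight_decomposable_ev by metis
  qed
  moreover have "finite_dimensional K {act K u x | u. u \<in> U_sub W_plus}" if x: "x \<in> carr K" for x
  proof -
    \<comment> \<open>the submodule of \<open>w1\<close> has its own filtration, because \<open>d\<^sub>j\<close> must not raise the bound \<open>B + n\<close>\<close>
    define L1 where "L1 n = (\<lambda>i. act K (D (-1) ^ i) w1) ` {..n}" for n :: nat
    define L2 where "L2 n = (\<lambda>i. act K (D (-1) ^ i) w2) ` {..n}" for n :: nat
    define T where "T n = L1 (B + n) \<union> L2 n" for n
    have L1: "finite (L1 n)" "L1 n \<subseteq> carr K" and T: "finite (T n)" "T n \<subseteq> carr K" for n
      by (auto simp: L1_def L2_def T_def)
    have mem1: "i \<le> n \<Longrightarrow> act K (D (-1) ^ i) w1 \<in> cspan (L1 n)" for i n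
      by (rule cspan_base[OF L1]) (auto simp: L1_def)
    have mem1': "i \<le> B + n \<Longrightarrow> act K (D (-1) ^ i) w1 \<in> cspan (T n)"
      and mem2: "i \<le> n \<Longrightarrow> act K (D (-1) ^ i) w2 \<in> cspan (T n)" for i n
      by (rule cspan_base[OF T], simp add: L1_def L2_def T_def)+
    have ev1: "degree p \<le> n \<Longrightarrow> act K (ev p) w1 \<in> cspan (L1 n)" for p n
      by (auto simp: act_ev intro!: cspan_sum[OF L1(2)] cspan_cscale[OF L1(2)] mem1)
    have ev1': "degree p \<le> B + n \<Longrightarrow> act K (ev p) w1 \<in> cspan (T n)"
      and ev2: "degree p \<le> n \<Longrightarrow> act K (ev p) w2 \<in> cspan (T n)" for p n
      by (auto simp: act_ev intro!: cspan_sum[OF T(2)] cspan_cscale[OF T(2)] mem1' mem2)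
    have L1_lower: "act K (D (-1)) y \<in> cspan (L1 (Suc n))" if "y \<in> cspan (L1 n)" for y n
    proof (rule act_cspan[OF L1(2) L1(2) _ that])
      fix b assume "b \<in> L1 n"
      then obtain i where "i \<le> n" "b = act K (D (-1) ^ i) w1" by (auto simp: L1_def)
      then show "act K (D (-1)) b \<in> cspan (L1 (Suc n))" using mem1[of "Suc i" "Suc n"] by (simp add: act_mult)
    qed
    have T_lower: "act K (D (-1)) y \<in> cspan (T (Suc n))" if "y \<in> cspan (T n)" for y n
    proof (rule act_cspan[OF T(2) T(2) _ that])
      fix b assume "b \<in> T n"
      then consider i where "i \<le> B + n" "b = act K (D (-1) ^ i) w1" | i where "i \<le> n" "b = act K (D (-1) ^ i) w2"
        by (auto simp: T_def L1_def L2_def)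
      then show "act K (D (-1)) b \<in> cspan (T (Suc n))"
      proof cases
        case 1
        then show ?thesis using mem1'[of "Suc i" "Suc n"] by (simp add: act_mult)
      next
        case 2
        then show ?thesis using mem2[of "Suc i" "Suc n"] by (simp add: act_mult)
      qed
    qed
    have L1_mono: "cspan (L1 m) \<subseteq> cspan (L1 n)" if "m \<le> n" for m n
      by (rule cspan_mono[OF L1(1) _ L1(2)]) (use that in \<open>auto simp: L1_def\<close>)
    have T_mono: "cspan (T m) \<subseteq> cspan (T n)" if "m \<le> n" for m n
      by (rule cspan_mono[OF T(1) _ T(2)]) (use that in \<open>auto simp: T_def L1_def L2_def\<close>)
    have L1_T: "cspan (L1 m) \<subseteq> cspan (T n)" if "m \<le> B + n" for m n
      by (rule cspan_mono[OF T(1) _ T(2)]) (use that in \<open>auto simp: T_def L1_def\<close>)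
    have D0: "act K (D j) w1 \<in> cspan (L1 0)" if "j \<ge> 0" for j
      using ev1[of "[:k1:]" 0] ev1[of 0 0] weight_space_eq[OF w(1)] D1[of j] that
      by (cases "j = 0") (auto simp: ev_pCons)
    have D0': "act K (D j) w2 \<in> cspan (T 0)" if "j \<ge> 0" for j
      using ev2[of "[:k2:]" 0] ev1'[of "P j" 0] weight_space_eq[OF w(2)] D2[of j] that
      by (cases "j = 0") (auto simp: ev_pCons)
    have F1: "act K (D j) (act K (D (-1) ^ n) w1) \<in> cspan (L1 n)" if "j \<ge> 0" for j n
      by (rule D_power_filtration[where T = "\<lambda>n. cspan (L1 n)"])
        (use that D0 mem1 L1_lower subsetD[OF L1_mono[OF le_SucI[OF order_refl]]] in
          \<open>auto intro: cspan_add[OF L1(2)] cspan_cscale[OF L1(2)] cspan_mem[OF L1(2)]\<close>)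
    have F2: "act K (D j) (act K (D (-1) ^ n) w2) \<in> cspan (T n)" if "j \<ge> 0" for j n
      by (rule D_power_filtration[where T = "\<lambda>n. cspan (T n)"])
        (use that D0' mem2 T_lower subsetD[OF T_mono[OF le_SucI[OF order_refl]]] in
          \<open>auto intro: cspan_add[OF T(2)] cspan_cscale[OF T(2)] cspan_mem[OF T(2)]\<close>)
    obtain p q where pq: "x = act K (ev p) w1 + act K (ev q) w2" using gen[OF x] by blast
    define n where "n = max (degree p) (degree q)"
    have xT: "x \<in> cspan (T n)"
      unfolding pq by (intro cspan_add[OF T(2)] ev1' ev2) (auto simp: n_def)
    have D_T: "act K (D j) y \<in> cspan (T n)" if y: "y \<in> cspan (T n)" and j: "j \<ge> 1" for y j
    proof (rule act_cspan[OF T(2) T(2) _ y])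
      fix b assume "b \<in> T n"
      then consider i where "i \<le> B + n" "b = act K (D (-1) ^ i) w1" | i where "i \<le> n" "b = act K (D (-1) ^ i) w2"
        by (auto simp: T_def L1_def L2_def)
      then show "act K (D j) b \<in> cspan (T n)"
      proof cases
        case 1
        then show ?thesis using subsetD[OF L1_T[OF 1(1)] F1] j by simp
      next
        case 2
        then show ?thesis using subsetD[OF T_mono[OF 2(1)] F2] j by simp
      qed
    qed
    let ?X = "{act K u x | u. u \<in> U_sub W_plus}"
    have TK: "cspan (T n) \<subseteq> carr K" using cspan_mem[OF T(2)] by blast
    have "act K u x \<in> cspan (T n)" if "u \<in> U_sub W_plus" for u
      by (rule W_plus_stable[OF TK cspan_zero[OF T(2)] cspan_add[OF T(2)] cspan_cscale[OF T(2)] D_T xT that])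
    then have XT: "?X \<subseteq> cspan (T n)" by blast
    have sub: "subalgebra (U_sub W_plus)" by (rule subalgebra_U_sub)
    have "\<exists>B. finite B \<and> B \<subseteq> ?X \<and> ?X = cspan B"
    proof (rule subspace_of_cspan[OF T XT])
      show "0 \<in> ?X" using x scal_in_U_sub[of 0 W_plus] by (intro CollectI exI[of _ 0]) simp
      fix y assume "y \<in> ?X"
      then obtain u where u: "u \<in> U_sub W_plus" "y = act K u x" by blast
      show "cscale K a y \<in> ?X" for a
        using u x sub scal_in_U_sub[of a W_plus]
        by (intro CollectI exI[of _ "scal a * u"]) (auto simp: act_mult subalgebra_def)
      fix z assume "z \<in> ?X"
      then obtain u' where u': "u' \<in> U_sub W_plus" "z = act K u' x" by blast
      show "y + z \<in> ?X"
        using u u' x sub by (intro CollectI exI[of _ "u + u'"]) (auto simp: act_add_left subalgebra_def)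
    qed
    then show ?thesis unfolding finite_dimensional_def cspan_def by blast
  qed
  ultimately show ?thesis using w_module by (auto simp: category_O_def)
qed

section \<open>Realizing cocycles by extensions in category O\<close>

lemma two_generated_transfer:
  fixes K :: "'k::ab_group_add wmod" and K' :: "'l::ab_group_add wmod"
  assumes "two_generated K" "w_hom K K' g" "bij_betw g (carr K) (carr K')" "wmod K'"
  shows "two_generated K'"
proof -
  obtain w1 w2 k1 k2 P B where K: "wmod K" and w: "w1 \<in> weight_space K k1" "w2 \<in> weight_space K k2"
    and D1: "\<And>j. j \<ge> 1 \<Longrightarrow> act K (D j) w1 = 0"
    and D2: "\<And>j. j \<ge> 1 \<Longrightarrow> act K (D j) w2 = act K (ev (P j)) w1" "\<And>j::int. j \<ge> 1 \<Longrightarrow> degree (P j) \<le> B"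
    and gen: "\<And>x. x \<in> carr K \<Longrightarrow> \<exists>p q. x = act K (ev p) w1 + act K (ev q) w2"
    using assms(1) unfolding two_generated_def by metis
  interpret g: w_morphism K K' g
    using K assms by (simp add: w_morphism_def w_morphism_axioms_def)
  have wK [simp]: "w1 \<in> carr K" "w2 \<in> carr K" using w g.K.weight_space_mem by auto
  have gen': "\<exists>p q. x = act K' (ev p) (g w1) + act K' (ev q) (g w2)" if x: "x \<in> carr K'" for x
  proof -
    have "x \<in> g ` carr K" using x assms(3) by (simp add: bij_betw_def)
    then obtain y where y: "y \<in> carr K" "x = g y" by (rule imageE)
    obtain p q where "y = act K (ev p) w1 + act K (ev q) w2" using gen[OF y(1)] by blast
    then show ?thesis unfolding y(2) by (intro exI[of _ p] exI[of _ q]) (simp add: g.add g.act)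
  qed
  have 1: "act K' (D j) (g w1) = 0" if "j \<ge> 1" for j
    using g.act[OF wK(1), of "D j"] D1[OF that] by simp
  have 2: "act K' (D j) (g w2) = act K' (ev (P j)) (g w1)" if "j \<ge> 1" for j
    using g.act[OF wK(2), of "D j"] g.act[OF wK(1), of "ev (P j)"] D2(1)[OF that] by simp
  show ?thesis
    by (rule two_generatedI[OF assms(4) g.weight[OF w(1)] g.weight[OF w(2)] 1 2 D2(2) gen'])
qed

text \<open>The middle term may live on any type; it is copied into the universe on which extensions are taken.\<close>

lemma (in presented) realize_extension:
  fixes N :: "'n::ab_group_add wmod" and K :: "'k::ab_group_add wmod"
  assumes "wmod N" "short_exact N M (K, i, p)" "ext_cocycle m l a N (K, i, p) c" "two_generated K"
  shows "\<exists>E\<in>extensions_O M N. ext_cocycle m l a N E c"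
proof -
  interpret N: wmod N by fact
  interpret E: w_extension N K M i p by (rule w_extensionI) (fact | rule wmod_axioms)+
  obtain K' :: "universe wmod" and f where K': "w_module K'" and f: "w_hom K' K f" "bij_betw f (carr K') (carr K)"
    using category_O_universe[OF category_O_two_generated[OF assms(4)]] by blast
  interpret f: w_morphism K' K f
    using K' f by unfold_locales auto
  define g where "g = inv_into (carr K') f"
  have gf: "g (f x) = x" if "x \<in> carr K'" for x
    using that f(2) by (simp add: g_def bij_betw_inv_into_left)
  have fg: "f (g x) = x" and g_mem: "g x \<in> carr K'" if "x \<in> carr K" for x
    using that f(2) by (auto simp: g_def bij_betw_inv_into_right bij_betw_imp_surj_on inv_into_into)
  have f_inj: "x = y" if "f x = f y" "x \<in> carr K'" "y \<in> carr K'" for x y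
    using that gf by metis
  have g: "w_hom K K' g"
    unfolding w_hom_def
  proof (intro conjI ballI allI)
    show "g ` carr K \<subseteq> carr K'" using g_mem by blast
    fix x assume x: "x \<in> carr K"
    show "g (act K u x) = act K' u (g x)" for u
      by (rule f_inj) (use x g_mem fg in \<open>simp_all add: f.act\<close>)
    fix y assume y: "y \<in> carr K"
    show "g (x + y) = g x + g y"
      by (rule f_inj) (use x y g_mem fg in \<open>simp_all add: f.add\<close>)
  qed
  have g_bij: "bij_betw g (carr K) (carr K')"
    unfolding g_def by (rule bij_betw_inv_into[OF f(2)])
  interpret g: w_morphism K K' g
    using K' g by unfold_locales auto
  have "two_generated K'"
    by (rule two_generated_transfer[OF assms(4) g g_bij]) (use K' in \<open>simp add: wmod_def\<close>)
  then have O: "category_O K'" by (rule category_O_two_generated)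
  have "short_exact N M (K', g \<circ> i, p \<circ> f)"
    unfolding short_exact_def split_conv
  proof (intro conjI K')
    show "w_hom N K' (g \<circ> i)" by (auto simp: w_hom_def E.i.add E.i.act g.add g.act)
    show "w_hom K' M (p \<circ> f)" by (auto simp: w_hom_def E.p.add E.p.act f.add f.act)
    show "inj_on (g \<circ> i) (carr N)"
    proof (rule inj_onI)
      fix x y assume xy: "x \<in> carr N" "y \<in> carr N" "(g \<circ> i) x = (g \<circ> i) y"
      then have "f (g (i x)) = f (g (i y))" by simp
      then show "x = y" using xy by (simp add: fg E.i_eq_iff)
    qed
    show "(g \<circ> i) ` carr N = {k \<in> carr K'. (p \<circ> f) k = 0}"
    proof (intro equalityI subsetI)
      fix k assume k: "k \<in> {k \<in> carr K'. (p \<circ> f) k = 0}"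
      then obtain n where "n \<in> carr N" "f k = i n" using E.kernel[of "f k"] by auto
      then show "k \<in> (g \<circ> i) ` carr N" using k gf[of k] by (intro image_eqI[of _ _ n]) auto
    qed (auto simp: fg)
    show "(p \<circ> f) ` carr K' = carr M"
    proof (intro equalityI subsetI)
      fix x assume "x \<in> carr M"
      then obtain k where "k \<in> carr K" "p k = x" using E.surj by blast
      then show "x \<in> (p \<circ> f) ` carr K'" by (intro image_eqI[of _ _ "g k"]) (auto simp: fg)
    qed auto
  qed
  then have "(K', g \<circ> i, p \<circ> f) \<in> extensions_O M N" using O by (simp add: extensions_O_def)
  moreover have "ext_cocycle m l a N (K', g \<circ> i, p \<circ> f) c"
  proof -
    obtain v where v: "v \<in> weight_space K l" "p v = m" "\<forall>j\<ge>a. c j \<in> carr N \<and> i (c j) = act K (D j) v"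
      using assms(3) by (auto simp: ext_cocycle_def)
    have vK: "v \<in> carr K" using v(1) by (rule E.K.weight_space_mem)
    show ?thesis
      unfolding ext_cocycle_def split_conv
      by (intro bexI[of _ "g v"]) (use v vK in \<open>auto simp: fg g.act g.weight\<close>)
  qed
  ultimately show ?thesis by blast
qed

context simple_hw_module
begin

lemma free: "l \<noteq> 0 \<Longrightarrow> free_hw_module M v l"
  by unfold_locales (use carr_ev ev_eq_0_iff v_nonzero in auto)

lemma presented_nonzero: "l \<noteq> 0 \<Longrightarrow> presented M v l 1"
proof
  assume l: "l \<noteq> 0"
  show "u \<in> left_ideal (hw_relations 1 l)" if u: "act M u v = 0" for u
  proof -
    obtain p j where j: "j \<in> left_ideal (hw_relations 1 l)" "u = ev p + j"
      using hw_ideal_complement by blast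
    have "act M j v = 0" by (rule left_ideal_kills[OF hw_relations_kill v_mem j(1)])
    then have "p = 0" using u j(2) ev_eq_0_iff[OF l v_nonzero] by (simp add: act_add_left)
    then show ?thesis using j by simp
  qed
qed (use v_weight carr_orbit hw_relations_kill in auto)

lemma presented_zero: "l = 0 \<Longrightarrow> presented M v l (-1)"
proof
  assume l: "l = 0"
  show kill: "act M r v = 0" if "r \<in> hw_relations (-1) l" for r
    using that D_v_trivial[OF l] l by (auto simp: hw_relations_def act_diff_left)
  show "u \<in> left_ideal (hw_relations (-1) l)" if u: "act M u v = 0" for u
  proof -
    obtain c j where j: "j \<in> left_ideal (hw_relations (-1) 0)" "u = scal c + j"
      using trivial_ideal_complement by blast
    have "act M j v = 0"
      by (rule left_ideal_kills[OF kill v_mem]) (use j l in auto)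
    then have "c = 0" using u j(2) v_nonzero by (simp add: act_add_left cscale_eq_0_iff)
    then show ?thesis using j l by simp
  qed
qed (use v_weight carr_orbit in auto)

text \<open>The extension is the induced module. Its map onto \<open>M\<close> forgets \<open>N\<close> and sends \<open>t\<^sup>m\<close> to \<open>d\<^sub>-\<^sub>1\<^sup>m v\<close>; it is a homomorphism
  because the left ideal of the highest weight relations moves the generator into \<open>N\<close>.\<close>

lemma realize_cocycle:
  fixes N :: "'n::ab_group_add wmod"
  assumes l: "l \<noteq> 0" and N: "simple_hw_module N w k" and c: "is_cocycle 1 l N c"
    and P: "\<And>j::int. j \<ge> 1 \<Longrightarrow> c j = act N (ev (P j)) w" "\<And>j::int. j \<ge> 1 \<Longrightarrow> degree (P j) \<le> B"
  shows "\<exists>E\<in>extensions_O M N. ext_cocycle v l 1 N E c"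
proof -
  interpret pr: presented M v l 1 using l by (rule presented_nonzero)
  interpret N: simple_hw_module N w k by fact
  interpret I: induced N l c by unfold_locales fact
  define K where "K = I.R.rep_module"
  interpret K: wmod K unfolding K_def by (rule I.R.wmod_rep_module)
  have carrK: "carr K = carr N \<times> UNIV" unfolding K_def I.R.carr_rep_module unfolding I.V_def ..
  have actN: "act K u (n, 0) = (act N u n, 0)" if "n \<in> carr N" for u n
    unfolding K_def using that by (rule I.act_N)
  have ev_top: "act K (ev q) (0, 1) = (0, q)" for q unfolding K_def by (rule I.act_ev_top)
  have D_top: "act K (D j) (0, 1) = (c j, 0)" if "j \<ge> 1" for j unfolding K_def using that by (rule I.D_top)
  have top_weight: "(0, 1) \<in> weight_space K l" unfolding K_def by (rule I.top_weight)
  have top [simp]: "(0, 1) \<in> carr K" using top_weight by (rule K.weight_space_mem)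
  have c_mem: "c j \<in> carr N" if "j \<ge> 1" for j using that by (rule I.c_mem)
  have ideal: "\<exists>n\<in>carr N. act K j (0, 1) = (n, 0)" if "j \<in> left_ideal (hw_relations 1 l)" for j
    using that
  proof (induction rule: left_ideal.induct)
    case zero
    then show ?case by (intro bexI[of _ 0]) (auto simp: zero_prod_def[symmetric])
  next
    case (add x y)
    then obtain n n' where "n \<in> carr N" "n' \<in> carr N" "act K x (0, 1) = (n, 0)" "act K y (0, 1) = (n', 0)" by blast
    then show ?case by (intro bexI[of _ "n + n'"]) (auto simp: K.act_add_left)
  next
    case (generator r u)
    have "\<exists>n\<in>carr N. act K r (0, 1) = (n, 0)"
    proof (cases "r = D 0 - scal l")
      case True
      then have "act K r (0, 1) = 0" using K.weight_space_eq[OF top_weight] by (simp add: K.act_diff_left)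
      then show ?thesis by (intro bexI[of _ 0]) (auto simp: zero_prod_def)
    next
      case False
      then obtain j where "j \<ge> 1" "r = D j" using generator by (auto simp: hw_relations_def)
      then show ?thesis using D_top c_mem by auto
    qed
    then obtain n where "n \<in> carr N" "act K r (0, 1) = (n, 0)" by blast
    then show ?case by (intro bexI[of _ "act N u n"]) (auto simp: K.act_mult actN)
  qed
  define i where "i n = (n, 0 :: complex poly)" for n :: 'n
  define p where "p k = act M (ev (snd k)) v" for k :: "'n \<times> complex poly"
  have "short_exact N M (K, i, p)"
    unfolding short_exact_def split_conv
  proof (intro conjI K.w_module)
    show "w_hom N K i" by (auto simp: w_hom_def i_def carrK actN)
    show "w_hom K M p"
      unfolding w_hom_def
    proof (intro conjI ballI allI)
      show "p ` carr K \<subseteq> carr M" by (auto simp: p_def)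
      fix x assume x: "x \<in> carr K"
      obtain n q where nq: "x = (n, q)" "n \<in> carr N" using x by (auto simp: carrK)
      show "p (x + y) = p x + p y" for y by (simp add: p_def ev_add act_add_left)
      fix u
      obtain q' j where j: "j \<in> left_ideal (hw_relations 1 l)" "u * ev q = ev q' + j"
        using hw_ideal_complement by blast
      obtain n' where n': "act K j (0, 1) = (n', 0)" using ideal[OF j(1)] by blast
      have "x = (n, 0) + act K (ev q) (0, 1)" using nq by (simp add: ev_top)
      moreover have "(n, 0) \<in> carr K" using nq by (simp add: carrK)
      ultimately have "act K u x = act K u (n, 0) + act K (u * ev q) (0, 1)"
        by (simp add: K.act_add_right K.act_mult)
      also have "\<dots> = (act N u n + n', q')"
        unfolding j(2) using nq n' by (simp add: K.act_add_left actN ev_top)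
      finally have "p (act K u x) = act M (ev q') v" by (simp add: p_def)
      moreover have "act M u (p x) = act M (ev q' + j) v"
        unfolding j(2)[symmetric] using nq by (simp add: p_def act_mult)
      moreover have "act M j v = 0" by (rule left_ideal_kills[OF hw_relations_kill v_mem j(1)])
      ultimately show "p (act K u x) = act M u (p x)" by (simp add: act_add_left)
    qed
    show "inj_on i (carr N)" by (auto simp: inj_on_def i_def)
    show "i ` carr N = {k \<in> carr K. p k = 0}"
    proof (intro equalityI subsetI)
      fix k assume "k \<in> {k \<in> carr K. p k = 0}"
      then obtain n q where nq: "k = (n, q)" "n \<in> carr N" "act M (ev q) v = 0" by (auto simp: carrK p_def)
      from nq(3) have "q = 0" by (simp only: ev_eq_0_iff[OF l v_nonzero])
      then show "k \<in> i ` carr N" using nq by (simp add: i_def)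
    qed (auto simp: i_def p_def carrK)
    show "p ` carr K = carr M"
    proof (intro equalityI subsetI)
      fix x assume "x \<in> carr M"
      then obtain q where "x = act M (ev q) v" using carr_ev by blast
      then show "x \<in> p ` carr K" by (intro image_eqI[of _ _ "(0, q)"]) (auto simp: p_def carrK)
    qed (auto simp: p_def)
  qed
  moreover have "ext_cocycle v l 1 N (K, i, p) c"
    unfolding ext_cocycle_def split_conv using top_weight D_top c_mem
    by (intro bexI[of _ "(0, 1)"]) (auto simp: p_def i_def)
  moreover have "two_generated K"
  proof (rule two_generatedI[OF K.wmod_axioms _ top_weight, where P = P and B = B])
    show "(w, 0) \<in> weight_space K k"
      using N.weight_space_eq[OF N.v_weight] by (simp add: weight_space_def carrK actN)
    show "act K (D j) (w, 0) = 0" if "j \<ge> 1" for j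
      using N.raise_v[OF that] by (simp add: actN zero_prod_def)
    show "act K (D j) (0, 1) = act K (ev (P j)) (w, 0)" "degree (P j) \<le> B" if "j \<ge> 1" for j
      using that P by (auto simp: D_top actN)
    show "\<exists>p q. x = act K (ev p) (w, 0) + act K (ev q) (0, 1)" if "x \<in> carr K" for x
    proof -
      obtain n q where nq: "x = (n, q)" "n \<in> carr N" using \<open>x \<in> carr K\<close> by (auto simp: carrK)
      obtain p where "n = act N (ev p) w" using N.carr_ev[OF nq(2)] by blast
      then show ?thesis using nq by (intro exI[of _ p] exI[of _ q]) (simp add: actN ev_top)
    qed
  qed
  ultimately show ?thesis by (rule pr.realize_extension[OF N.wmod_axioms])
qed

lemma realize_split:
  fixes N :: "'n::ab_group_add wmod"
  assumes l: "l = 0" and N: "simple_hw_module N w k"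
  shows "\<exists>E\<in>extensions_O M N. ext_cocycle v l (-1) N E (\<lambda>_. 0)"
proof -
  interpret pr: presented M v l "-1" using l by (rule presented_zero)
  interpret N: simple_hw_module N w k by fact
  define K where "K = prod_module N M"
  interpret K: wmod K unfolding K_def by (rule wmod_prod_module) (rule N.wmod_axioms wmod_axioms)+
  have carrK: "carr K = carr N \<times> carr M" and actK: "act K u (x, y) = (act N u x, act M u y)" for u x y
    by (simp_all add: K_def prod_module_def)
  define i where "i n = (n, 0 :: 'a)" for n :: 'n
  have "short_exact N M (K, i, snd)"
    unfolding short_exact_def split_conv
    by (intro conjI K.w_module)
      (use N.zero_mem in \<open>auto simp: w_hom_def i_def carrK actK inj_on_def image_iff simp del: N.zero_mem\<close>)
  moreover have "ext_cocycle v l (-1) N (K, i, snd) (\<lambda>_. 0)"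
    unfolding ext_cocycle_def split_conv
    using weight_space_eq[OF v_weight] pr.D_m
    by (intro bexI[of _ "(0, v)"]) (auto simp: i_def weight_space_def carrK actK)
  moreover have "two_generated K"
  proof (rule two_generatedI[OF K.wmod_axioms, where P = "\<lambda>_. 0" and B = 0])
    show "(w, 0) \<in> weight_space K k" "(0, v) \<in> weight_space K l"
      using N.weight_space_eq[OF N.v_weight] weight_space_eq[OF v_weight]
      by (auto simp: weight_space_def carrK actK)
    show "act K (D j) (w, 0) = 0" "act K (D j) (0, v) = act K (ev 0) (w, 0)" if "j \<ge> 1" for j
      using N.raise_v[OF that] raise_v[OF that] by (simp_all add: actK zero_prod_def)
    show "\<exists>p q. x = act K (ev p) (w, 0) + act K (ev q) (0, v)" if "x \<in> carr K" for x
    proof -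
      obtain n y where x: "x = (n, y)" "n \<in> carr N" "y \<in> carr M" using \<open>x \<in> carr K\<close> by (auto simp: carrK)
      obtain p where "n = act N (ev p) w" using N.carr_ev[OF x(2)] by blast
      moreover obtain q where "y = act M (ev q) v" using carr_ev[OF x(3)] by blast
      ultimately show ?thesis using x by (intro exI[of _ p] exI[of _ q]) (simp add: actK)
    qed
  qed simp
  ultimately show ?thesis by (rule pr.realize_extension[OF N.wmod_axioms])
qed

text \<open>The Verma module of weight \<open>0\<close> is \<open>\<complex>[t]\<close>, obtained as the module induced from the zero module. Its maximal submodule \<open>t \<complex>[t]\<close> is generated
  by the singular vector \<open>t\<close> of weight \<open>-1\<close>, and \<open>d\<^sub>-\<^sub>1\<close> sends the generator to it. The factor \<open>s\<close> is placed in the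
  inclusion of \<open>N\<close>.\<close>

lemma realize_verma_zero:
  fixes N :: "'n::ab_group_add wmod"
  assumes l: "l = 0" and N: "simple_hw_module N w (-1)" and s: "s \<noteq> 0"
  shows "\<exists>E\<in>extensions_O M N. ext_cocycle v l (-1) N E (\<lambda>j. if j = -1 then cscale N s w else 0)"
proof -
  interpret pr: presented M v l "-1" using l by (rule presented_zero)
  interpret N: simple_hw_module N w "-1" by fact
  interpret NF: free_hw_module N w "-1" by (rule N.free) simp
  define Z :: "complex wmod" where "Z = \<lparr>carr = {0}, act = (\<lambda>_ _. 0)\<rparr>"
  interpret Z: wmod Z
    by unfold_locales (simp add: Z_def left_module_def add_subgroup_def)
  interpret I: induced Z 0 "\<lambda>_. 0"
    by unfold_locales (auto simp: is_cocycle_def Z_def weight_space_def)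
  define K where "K = I.R.rep_module"
  interpret K: wmod K unfolding K_def by (rule I.R.wmod_rep_module)
  have carrK: "carr K = {0} \<times> UNIV" unfolding K_def I.R.carr_rep_module unfolding I.V_def by (simp add: Z_def)
  have ev_top: "act K (ev q) (0, 1) = (0, q)" for q unfolding K_def by (rule I.act_ev_top)
  have D_top: "act K (D j) (0, 1) = 0" if "j \<ge> 1" for j
    unfolding K_def zero_prod_def using that by (rule I.D_top)
  have top_weight: "(0, 1) \<in> weight_space K 0" unfolding K_def by (rule I.top_weight)
  interpret T: free_hw_module K "(0, 1)" 0
    by unfold_locales (use top_weight D_top ev_top in \<open>auto simp: carrK zero_prod_def\<close>)
  have lower_top: "act K (D (-1)) (0, 1) = (0, [:0, 1:])"
    using ev_top[of "[:0, 1:]"] by (simp add: ev_pCons scal_1)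
  define w' where "w' = cscale K (1 / s) (0, [:0, 1:])"
  have w'_f: "w' = cscale K (- 1 / s) (T.f 1)"
    using T.D_power_v[of 1] by (simp add: w'_def lower_top[symmetric])
  have ev_w': "act K (ev q) w' = cscale K (1 / s) (0, pCons 0 q)" for q
  proof -
    have "act K (ev q) (0, [:0, 1:]) = act K (ev q * ev [:0, 1:]) (0, 1)" by (simp add: K.act_mult ev_top)
    also have "ev q * ev [:0, 1:] = ev (pCons 0 q)"
    proof -
      have "ev q * D (-1) = D (-1) * ev q"
        by (induction q) (simp_all add: ev_pCons distrib_left distrib_right scal_commute mult.assoc)
      then show ?thesis by (simp add: ev_pCons scal_1)
    qed
    finally show ?thesis unfolding w'_def by (subst K.act_cscale) (simp_all add: carrK ev_top)
  qed
  have "hw_vector K w' (-1)"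
  proof
    show "w' \<in> weight_space K (-1)"
      unfolding w'_f using T.f_weight[of 1] by (intro K.weight_space_cscale) simp
    show "act K (D i) w' = 0" if "i \<ge> 1" for i
      unfolding w'_f using T.D_f[of i 1] that by (cases "i = 1") (auto simp: K.D_cscale T.f_neg)
  qed
  then obtain i where i: "w_hom N K i" and i_ev: "\<And>q. i (act N (ev q) w) = act K (ev q) w'"
    using NF.extend_hom by blast
  interpret i: w_morphism N K i using i by unfold_locales
  have "hw_vector M v 0" using hw_vector_axioms l by simp
  then obtain p where p: "w_hom K M p" and p_ev: "\<And>q. p (act K (ev q) (0, 1)) = act M (ev q) v"
    using T.extend_hom by blast
  have p_q: "p (0, q) = cscale M (coeff q 0) v" for q
  proof -
    have "act M (D (-1) * u) v = 0" for u
    proof -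
      obtain c where "act M u v = cscale M c v" using carr_trivial[OF l, of "act M u v"] by auto
      then show ?thesis using D_v_trivial[OF l, of "-1"] by (simp add: act_mult D_cscale)
    qed
    then have "act M (ev q) v = cscale M (coeff q 0) v"
      by (cases q) (simp add: ev_pCons act_add_left)
    then show ?thesis using p_ev[of q] by (simp add: ev_top)
  qed
  have sc: "cscale K a (0, q) = (0, smult a q)" for a q
    using ev_top[of "smult a q"] ev_top[of q] by (simp add: ev_smult K.act_mult)
  have "short_exact N M (K, i, p)"
    unfolding short_exact_def split_conv
  proof (intro conjI K.w_module i p)
    show "inj_on i (carr N)"
    proof (rule inj_onI)
      fix x y assume xy: "x \<in> carr N" "y \<in> carr N" "i x = i y"
      obtain q where q: "x - y = act N (ev q) w" using N.carr_ev[of "x - y"] xy by auto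
      have "i (x - y) = 0" using xy by (simp add: i.diff)
      then have "smult (1 / s) (pCons 0 q) = 0" unfolding q i_ev ev_w' sc by (simp add: zero_prod_def)
      then have "q = 0" using s by simp
      then show "x = y" using q by simp
    qed
    show "i ` carr N = {k \<in> carr K. p k = 0}"
    proof (intro equalityI subsetI)
      fix k assume "k \<in> i ` carr N"
      then obtain x where x: "x \<in> carr N" "k = i x" by blast
      then obtain q where "x = act N (ev q) w" using N.carr_ev by blast
      then have "k = (0, smult (1 / s) (pCons 0 q))" using x i_ev ev_w' sc by simp
      then show "k \<in> {k \<in> carr K. p k = 0}" by (simp add: carrK p_q)
    next
      fix k assume "k \<in> {k \<in> carr K. p k = 0}"
      then obtain q where k: "k = (0, q)" "p (0, q) = 0" by (auto simp: carrK)
      then have "coeff q 0 = 0" using v_nonzero by (simp add: p_q cscale_eq_0_iff)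
      then obtain r where r: "q = pCons 0 r" by (cases q) auto
      have "i (act N (ev (smult s r)) w) = k" unfolding i_ev ev_w' sc k r using s by simp
      then show "k \<in> i ` carr N" by (metis N.act_mem N.v_mem imageI)
    qed
    show "p ` carr K = carr M"
    proof (intro equalityI subsetI)
      fix x assume "x \<in> carr M"
      then obtain c where "x = cscale M c v" using carr_trivial[OF l] by blast
      then show "x \<in> p ` carr K" by (intro image_eqI[of _ _ "(0, [:c:])"]) (auto simp: p_q carrK)
    qed (auto simp: p_q carrK)
  qed
  moreover have "ext_cocycle v l (-1) N (K, i, p) (\<lambda>j. if j = -1 then cscale N s w else 0)"
    unfolding ext_cocycle_def split_conv
  proof (intro bexI[of _ "(0, 1)"] conjI allI impI)
    show "(0, 1) \<in> weight_space K l" using top_weight l by simp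
    show "p (0, 1) = v" by (simp add: p_q)
    fix j :: int assume j: "j \<ge> -1"
    show "(if j = -1 then cscale N s w else 0) \<in> carr N" by simp
    have "i (cscale N s w) = act K (D (-1)) (0, 1)"
      using i_ev[of "[:s:]"] s ev_w'[of "[:s:]"] by (simp add: ev_pCons sc lower_top)
    moreover have "act K (D j) (0, 1) = 0" if "j \<noteq> -1"
      using j that D_top[of j] K.weight_space_eq[OF top_weight] by (cases "j = 0") auto
    ultimately show "i (if j = -1 then cscale N s w else 0) = act K (D j) (0, 1)" by simp
  qed
  moreover have "two_generated K"
  proof (rule two_generatedI[OF K.wmod_axioms top_weight K.weight_space_zero[of 0], where P = "\<lambda>_. 0" and B = 0])
    show "\<exists>p q. x = act K (ev p) (0, 1) + act K (ev q) 0" if "x \<in> carr K" for x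
      using that by (auto simp: carrK ev_top)
  qed (use D_top in auto)
  ultimately show ?thesis by (rule pr.realize_extension[OF N.wmod_axioms])
qed

end

section \<open>The cocycle equations between two Verma modules\<close>

text \<open>The cocycle identity at the indices \<open>i, j\<close> for \<open>c\<^sub>j = g\<^sub>j f\<^sub>k\<^sub>-\<^sub>j\<close>, with the common vector \<open>f\<^sub>k\<^sub>-\<^sub>i\<^sub>-\<^sub>j\<close> removed.\<close>

definition density_eq :: "complex \<Rightarrow> complex \<Rightarrow> (int \<Rightarrow> complex) \<Rightarrow> int \<Rightarrow> int \<Rightarrow> bool" where
  "density_eq l k g i j \<longleftrightarrow>
     g j * (of_int (i + j) - k + of_int (i + 1) * l) - g i * (of_int (i + j) - k + of_int (j + 1) * l)
     = of_int (j - i) * g (i + j)"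

text \<open>The determinant of \<open>(g\<^sub>1, g\<^sub>2)\<close> and the first two coordinates \<open>(1 - k + 2 l, 2 - k + 3 l)\<close> of the coboundary of \<open>f\<^sub>k\<close>.\<close>

definition invariant :: "complex \<Rightarrow> complex \<Rightarrow> (int \<Rightarrow> complex) \<Rightarrow> complex" where
  "invariant l k g = g 1 * (2 - k + 3 * l) - g 2 * (1 - k + 2 * l)"

text \<open>The brackets \<open>[d\<^sub>1, d\<^sub>4]\<close> and \<open>[d\<^sub>2, d\<^sub>3]\<close> give two formulas for \<open>g\<^sub>5\<close>. Their difference is linear in \<open>(g\<^sub>1, g\<^sub>2)\<close> and
  vanishes on the coboundary, hence is a multiple of the determinant.\<close>

lemma degree_five:
  assumes "density_eq l k g 1 2" "density_eq l k g 1 3" "density_eq l k g 1 4" "density_eq l k g 2 3"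
  shows "invariant l k g * ((2 * l - k + 1)\<^sup>2 - 3 * k - 1) = 0"
proof -
  have 1: "g 3 = g 2 * (3 - k + 2 * l) - g 1 * (3 - k + 3 * l)"
    and 2: "2 * g 4 = g 3 * (4 - k + 2 * l) - g 1 * (4 - k + 4 * l)"
    and 3: "3 * g 5 = g 4 * (5 - k + 2 * l) - g 1 * (5 - k + 5 * l)"
    and 4: "g 5 = g 3 * (5 - k + 3 * l) - g 2 * (5 - k + 4 * l)"
    using assms by (simp_all add: density_eq_def)
  have "6 * (g 3 * (5 - k + 3 * l) - g 2 * (5 - k + 4 * l)) =
      (g 3 * (4 - k + 2 * l) - g 1 * (4 - k + 4 * l)) * (5 - k + 2 * l) - 2 * (g 1 * (5 - k + 5 * l))"
    using 2 3 4 by algebra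
  then show ?thesis unfolding invariant_def using 1 by algebra
qed

text \<open>As in degree five, but with \<open>[d\<^sub>1, d\<^sub>6]\<close> and \<open>[d\<^sub>2, d\<^sub>5]\<close>; the multiple of the determinant obtained is
  \<open>k (1 - k) / 40\<close> modulo the relation \<open>s\<close>.\<close>

lemma degree_seven:
  assumes "density_eq l k g 1 2" "density_eq l k g 1 3" "density_eq l k g 1 4" "density_eq l k g 1 5"
    "density_eq l k g 1 6" "density_eq l k g 2 5" and s: "(2 * l - k + 1)\<^sup>2 = 3 * k + 1"
  shows "invariant l k g * (k * (k - 1)) = 0"
proof -
  have 1: "g 3 = g 2 * (3 - k + 2 * l) - g 1 * (3 - k + 3 * l)"
    and 2: "g 4 = (g 3 * (4 - k + 2 * l) - g 1 * (4 - k + 4 * l)) / 2"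
    and 3: "g 5 = (g 4 * (5 - k + 2 * l) - g 1 * (5 - k + 5 * l)) / 3"
    and 4: "g 6 = (g 5 * (6 - k + 2 * l) - g 1 * (6 - k + 6 * l)) / 4"
    and 5: "5 * g 7 = g 6 * (7 - k + 2 * l) - g 1 * (7 - k + 7 * l)"
    and 6: "3 * g 7 = g 5 * (7 - k + 3 * l) - g 2 * (7 - k + 6 * l)"
    using assms by (simp_all add: density_eq_def)
  have e: "3 * (g 6 * (7 - k + 2 * l) - g 1 * (7 - k + 7 * l)) = 5 * (g 5 * (7 - k + 3 * l) - g 2 * (7 - k + 6 * l))"
    using 5 6 by algebra
  \<comment> \<open>in terms of \<open>s\<close> and \<open>k\<close> the relation allows to eliminate \<open>s\<^sup>2\<close>\<close>
  define s where "s = 2 * l - k + 1"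
  have l: "l = (s + k - 1) / 2" by (simp add: s_def)
  have s2: "s * s = 3 * k + 1" using s by (simp add: s_def power2_eq_square)
  show ?thesis
    using e s2 unfolding invariant_def 4 3 2 1 l by (simp add: field_simps) algebra
qed

text \<open>The quadratic relation of degree five also makes the two formulas for \<open>g\<^sub>6\<close> agree, so there is no new
  condition for \<open>k = 6\<close>.\<close>

lemma degree_six:
  assumes "density_eq l k g 1 2" "density_eq l k g 1 3" "density_eq l k g 1 4" "density_eq l k g 1 5"
    and s: "(2 * l - k + 1)\<^sup>2 = 3 * k + 1"
  shows "density_eq l k g 2 3" "density_eq l k g 2 4"
proof -
  have 1: "g 3 = g 2 * (3 - k + 2 * l) - g 1 * (3 - k + 3 * l)"
    and 2: "g 4 = (g 3 * (4 - k + 2 * l) - g 1 * (4 - k + 4 * l)) / 2"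
    and 3: "g 5 = (g 4 * (5 - k + 2 * l) - g 1 * (5 - k + 5 * l)) / 3"
    and 4: "g 6 = (g 5 * (6 - k + 2 * l) - g 1 * (6 - k + 6 * l)) / 4"
    using assms by (simp_all add: density_eq_def)
  show "density_eq l k g 2 3"
    using s unfolding density_eq_def by (simp add: 3 2 1 field_simps) algebra
  show "density_eq l k g 2 4"
    using s unfolding density_eq_def by (simp add: 4 3 2 1 field_simps) algebra
qed

lemma density_eq_sym: "density_eq l k g i j \<longleftrightarrow> density_eq l k g j i"
proof -
  have "density_eq l k g j i" if "density_eq l k g i j" for i j
  proof -
    let ?A = "g j * (of_int (i + j) - k + of_int (i + 1) * l)"
    let ?B = "g i * (of_int (i + j) - k + of_int (j + 1) * l)"
    have "?B - ?A = - (?A - ?B)" by (simp only: minus_diff_eq)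
    also have "?A - ?B = of_int (j - i) * g (i + j)" using that by (simp only: density_eq_def)
    also have "- (of_int (j - i) * g (i + j)) = of_int (i - j) * g (i + j)"
      by (simp add: algebra_simps)
    finally have "?B - ?A = of_int (i - j) * g (i + j)" .
    then show ?thesis unfolding density_eq_def by (simp only: add.commute[of j i])
  qed
  then show ?thesis by blast
qed

lemma density_eq_self: "density_eq l k g i i"
  by (simp add: density_eq_def)

text \<open>Twice the second entry minus three times the first is \<open>k + 1\<close>.\<close>

lemma coboundary_pair_nonzero:
  fixes l :: complex and k :: int
  assumes "k \<ge> 0"
  shows "1 - of_int k + 2 * l \<noteq> 0 \<or> 2 - of_int k + 3 * l \<noteq> 0"
proof (rule ccontr)
  assume "\<not> ?thesis"
  then have z: "1 - of_int k + 2 * l = 0" "2 - of_int k + 3 * l = 0" by auto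
  have "of_int (k + 1) = 2 * (2 - of_int k + 3 * l) - 3 * (1 - of_int k + 2 * l)" by simp
  then have "of_int (k + 1) = (0::complex)" unfolding z by simp
  then show False using assms by (simp only: of_int_eq_0_iff)
qed

text \<open>Choose \<open>g\<^sub>1, g\<^sub>2\<close> with the required determinant and define the others by the equations with \<open>i = 1\<close>. For \<open>k \<le> 6\<close> the
  only further equations are those at \<open>(2, 3)\<close> and \<open>(2, 4)\<close>.\<close>

lemma density_solution:
  fixes l y :: complex and k :: int
  assumes "k \<in> {2, 3, 4} \<or> k \<in> {5, 6} \<and> (2 * l - of_int k + 1)\<^sup>2 = 3 * of_int k + 1"
  obtains g where "invariant l (of_int k) g = y"
    "\<And>i j. i \<ge> 1 \<Longrightarrow> j \<ge> 1 \<Longrightarrow> i + j \<le> k \<Longrightarrow> density_eq l (of_int k) g i j"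
proof -
  let ?k = "of_int k :: complex"
  obtain g1 g2 where g12: "g1 * (2 - ?k + 3 * l) - g2 * (1 - ?k + 2 * l) = y"
  proof (cases "2 - ?k + 3 * l = 0")
    case True
    then have "1 - ?k + 2 * l \<noteq> 0" using coboundary_pair_nonzero[of k l] assms by auto
    then show thesis using that[of 0 "- y / (1 - ?k + 2 * l)"] by simp
  next
    case False
    then show thesis using that[of "y / (2 - ?k + 3 * l)" 0] by simp
  qed
  define g3 where "g3 = g2 * (3 - ?k + 2 * l) - g1 * (3 - ?k + 3 * l)"
  define g4 where "g4 = (g3 * (4 - ?k + 2 * l) - g1 * (4 - ?k + 4 * l)) / 2"
  define g5 where "g5 = (g4 * (5 - ?k + 2 * l) - g1 * (5 - ?k + 5 * l)) / 3"
  define g6 where "g6 = (g5 * (6 - ?k + 2 * l) - g1 * (6 - ?k + 6 * l)) / 4"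
  \<comment> \<open>the value at indices other than \<open>1, \<dots>, 6\<close> is arbitrary\<close>
  define g where "g j = (if j = 1 then g1 else if j = 2 then g2 else if j = 3 then g3
      else if j = 4 then g4 else if j = 5 then g5 else g6)" for j :: int
  have inv: "invariant l ?k g = y" using g12 by (simp add: invariant_def g_def)
  have e1: "density_eq l ?k g 1 2" "density_eq l ?k g 1 3" "density_eq l ?k g 1 4" "density_eq l ?k g 1 5"
    by (simp_all add: density_eq_def g_def g3_def[symmetric])
      (simp_all add: g4_def g5_def g6_def)
  have e2: "density_eq l ?k g 2 3" "density_eq l ?k g 2 4" if "k \<ge> 5"
    using degree_six[OF e1] assms that by auto
  have ordered: "density_eq l ?k g i j" if ij: "1 \<le> i" "i < j" "i + j \<le> k" for i j
  proof -
    have k: "k \<le> 6" using assms by auto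
    consider "i = 1" "j = 2" | "i = 1" "j = 3" | "i = 1" "j = 4" | "i = 1" "j = 5"
      | "i = 2" "j = 3" | "i = 2" "j = 4"
      using ij k by linarith
    then show ?thesis
      using e1 e2 ij by cases simp_all
  qed
  have "density_eq l ?k g i j" if "i \<ge> 1" "j \<ge> 1" "i + j \<le> k" for i j
  proof (cases i j rule: linorder_cases)
    case less
    then show ?thesis using ordered that by simp
  next
    case equal
    then show ?thesis by (simp add: density_eq_self)
  next
    case greater
    then show ?thesis using ordered[of j i] that density_eq_sym[of l ?k g i j] by simp
  qed
  with inv show thesis by (rule that)
qed

lemma invariant_vanishes:
  fixes l :: complex and k :: int
  assumes g: "\<And>i j. i \<ge> 1 \<Longrightarrow> j \<ge> 1 \<Longrightarrow> i + j \<le> k \<Longrightarrow> density_eq l (of_int k) g i j"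
    and k: "k \<ge> 5" and no: "k \<ge> 7 \<or> (2 * l - of_int k + 1)\<^sup>2 \<noteq> 3 * of_int k + 1"
  shows "invariant l (of_int k) g = 0"
proof (cases "(2 * l - of_int k + 1)\<^sup>2 = 3 * of_int k + (1::complex)")
  case False
  have "invariant l (of_int k) g * ((2 * l - of_int k + 1)\<^sup>2 - 3 * of_int k - 1) = 0"
    by (rule degree_five) (use g k in auto)
  moreover have "(2 * l - of_int k + 1)\<^sup>2 - 3 * of_int k - (1::complex) \<noteq> 0"
    using False by (simp add: algebra_simps)
  ultimately show ?thesis by simp
next
  case True
  then have k7: "k \<ge> 7" using no by simp
  have "invariant l (of_int k) g * (of_int k * (of_int k - 1)) = 0"
    by (rule degree_seven) (use g k7 True in auto)
  moreover have "of_int k * (of_int k - 1) = (of_int (k * (k - 1)) :: complex)" by simp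
  moreover have "k * (k - 1) \<noteq> 0" using k7 by simp
  ultimately show ?thesis by (metis mult_eq_0_iff of_int_eq_0_iff)
qed

section \<open>Computation of the extension spaces\<close>

context wmod
begin

text \<open>Meaningful when \<open>y\<close> is a multiple of \<open>x\<close>.\<close>

definition coef :: "'v \<Rightarrow> 'v \<Rightarrow> complex" where
  "coef x y = (SOME t. y = cscale M t x)"

lemma coef_cscale:
  assumes "x \<in> carr M" "x \<noteq> 0"
  shows "coef x (cscale M t x) = t"
proof -
  have "s = t" if "cscale M t x = cscale M s x" for s
  proof -
    have "cscale M (s - t) x = 0" using assms that by (simp add: cscale_diff)
    then show ?thesis using assms by (simp add: cscale_eq_0_iff)
  qed
  then show ?thesis unfolding coef_def by (intro some_equality) auto
qed

end

text \<open>The situation in which a cocycle is determined up to coboundaries by one value on a line.\<close>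

lemma (in presented) Ext1_line:
  fixes N :: "'n::ab_group_add wmod"
  assumes N: "wmod N" and w: "w \<in> carr N" "w \<noteq> 0"
    and line: "\<And>c. is_cocycle a l N c \<Longrightarrow> \<exists>t. c r = cscale N t w"
    and cob: "\<And>c. is_cocycle a l N c \<Longrightarrow> is_coboundary a l N c \<longleftrightarrow> c r = 0"
    and onto: "\<And>y. \<exists>E\<in>extensions_O M N. \<exists>c. ext_cocycle m l a N E c \<and> c r = cscale N y w"
  shows "complex_linear_iso (Ext1_O M N) (baer_sum M N) (ext_scale M N) UNIV"
proof -
  interpret N: wmod N by fact
  show ?thesis
  proof (rule Ext1_linear_iso[where X = "\<lambda>c. N.coef w (c r)"])
    fix c assume c: "is_cocycle a l N c"
    obtain t where t: "c r = cscale N t w" using line[OF c] by blast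
    show "N.coef w (cscale N s (c r)) = s * N.coef w (c r)" for s
      using w by (simp add: t N.coef_cscale)
    show "N.coef w (c r) = 0 \<longleftrightarrow> is_coboundary a l N c"
      unfolding cob[OF c] using w by (simp add: t N.coef_cscale N.cscale_eq_0_iff)
    fix c' assume c': "is_cocycle a l N c'"
    obtain t' where t': "c' r = cscale N t' w" using line[OF c'] by blast
    show "N.coef w (c r + c' r) = N.coef w (c r) + N.coef w (c' r)"
      using w by (simp add: t t' N.coef_cscale flip: N.cscale_add)
  next
    fix y
    obtain E c where "E \<in> extensions_O M N" "ext_cocycle m l a N E c" "c r = cscale N y w"
      using onto by blast
    then show "\<exists>E\<in>extensions_O M N. \<exists>c. ext_cocycle m l a N E c \<and> N.coef w (c r) = y"
      using w by (intro bexI[of _ E] exI[of _ c]) (simp_all add: N.coef_cscale)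
  qed (simp_all add: N.wmod_axioms)
qed

lemma (in hw_vector) f_eq_ev: "\<exists>p. degree p \<le> nat m \<and> f m = act M (ev p) v"
proof (cases "m < 0")
  case True
  then show ?thesis by (intro exI[of _ 0]) (simp add: f_neg)
next
  case False
  define a where "a = ((-1) ^ nat m / fact (nat m) :: complex)"
  have "ev (monom a n) = scal a * D (-1) ^ n" for n
  proof (induction n)
    case (Suc n)
    have "D (-1) * (scal a * D (-1) ^ n) = scal a * (D (-1) * D (-1) ^ n)"
      by (metis mult.assoc scal_commute)
    then show ?case using Suc by (simp add: monom_Suc ev_pCons)
  qed (simp add: monom_0 ev_pCons)
  then show ?thesis
    using False by (intro exI[of _ "monom a (nat m)"]) (simp add: f_def act_mult degree_monom_le a_def)
qed

context simple_hw_module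
begin

lemma Ext1_zero:
  fixes N :: "'n::ab_group_add wmod"
  assumes N: "simple_hw_module N w lam" and a: "a = (if l = 0 then -1 else 1)"
    and cob: "\<And>c. is_cocycle a l N c \<Longrightarrow> is_coboundary a l N c"
  shows "complex_linear_iso (Ext1_O M N) (baer_sum M N) (ext_scale M N) {0}"
proof -
  interpret N: simple_hw_module N w lam by fact
  interpret presented M v l a
    using presented_zero presented_nonzero a by (cases "l = 0") simp_all
  have "\<exists>E\<in>extensions_O M N. ext_cocycle v l a N E (\<lambda>_. 0)"
  proof (cases "l = 0")
    case True
    then show ?thesis using realize_split[OF _ N] a by simp
  next
    case False
    have "is_cocycle 1 l N (\<lambda>_. 0)" by (simp add: is_cocycle_def)
    from realize_cocycle[OF False N this, of "\<lambda>_. 0" 0] show ?thesis using False a by simp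
  qed
  then show ?thesis
    by (intro Ext1_linear_iso[where X = "\<lambda>_. 0"]) (use N.wmod_axioms cob in auto)
qed

text \<open>The vectors \<open>c\<^sub>j\<close> have weight \<open>j\<close>, so they vanish unless \<open>lam\<close> is an integer \<open>k \<ge> 1\<close>. In that case
  \<open>f (k + 1)\<close> is a multiple of \<open>d\<^sub>-\<^sub>1 f k\<close>, so \<open>c\<^sub>-\<^sub>1\<close> can be removed by a coboundary, and the cocycle identity at
  \<open>(-1, j)\<close> together with the injectivity of \<open>d\<^sub>-\<^sub>1\<close> removes the others one after another.\<close>

lemma Ext1_of_trivial:
  fixes N :: "'n::ab_group_add wmod"
  assumes N: "simple_hw_module N w lam" and l: "l = 0" and lam: "lam \<noteq> -1"
  shows "complex_linear_iso (Ext1_O M N) (baer_sum M N) (ext_scale M N) {0}"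
proof (rule Ext1_zero[OF N])
  interpret N: simple_hw_module N w lam by fact
  fix c assume c: "is_cocycle (-1) l N c"
  have c0: "c 0 = 0" using c by (simp add: is_cocycle_def)
  have wt: "c j \<in> weight_space N (of_int j)" if "j \<ge> -1" for j
    using c that l by (auto simp: is_cocycle_def)
  have cmem: "c j \<in> carr N" if "j \<ge> -1" for j using wt[OF that] by (rule N.weight_space_mem)
  show "is_coboundary (-1) l N c"
  proof (cases "\<exists>k\<ge>1. lam = of_int k")
    case False
    have "c j = 0" if j: "j \<ge> -1" for j
    proof (cases "j = 0")
      case True
      then show ?thesis using c0 by simp
    next
      case j0: False
      show ?thesis
      proof (cases "lam = 0")
        case True
        then show ?thesis using N.weight_space_trivial[OF True wt[OF j]] j0 by simp
      next
        case lam0: False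
        have "of_int j \<noteq> lam - of_nat n" for n
        proof
          assume "of_int j = lam - of_nat n"
          then have e: "lam = of_int (j + int n)" by (simp add: algebra_simps)
          consider "j + int n = -1" | "j + int n = 0" | "j + int n \<ge> 1" using j by linarith
          then show False using e lam lam0 False by cases auto
        qed
        then show ?thesis by (rule N.weight_space_outside[OF lam0 wt[OF j]])
      qed
    qed
    then show ?thesis by (auto simp: is_coboundary_def intro!: bexI[of _ 0])
  next
    case True
    then obtain k where k: "k \<ge> 1" "lam = of_int k" by blast
    have lam0: "lam \<noteq> 0" using k by auto
    have "c (-1) \<in> weight_space N (lam - of_int (k + 1))" using wt[of "-1"] k by simp
    then obtain t where t: "c (-1) = cscale N t (N.f (k + 1))" using N.weight_space_f[OF lam0] by blast
    \<comment> \<open>chosen such that \<open>d\<^sub>-\<^sub>1 n = c\<^sub>-\<^sub>1\<close>\<close>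
    define n where "n = cscale N (- t / of_int (k + 1)) (N.f k)"
    have nw: "n \<in> weight_space N 0"
      unfolding n_def using N.f_weight[of k] k by (intro N.weight_space_cscale) simp
    have n: "n \<in> carr N" using nw by (rule N.weight_space_mem)
    have k1: "of_int (k + 1) \<noteq> (0::complex)" using k by (simp only: of_int_eq_0_iff)
    have low: "c (-1) = act N (D (-1)) n"
    proof -
      have "- t / a * - a = t" if "a \<noteq> 0" for a using that by simp
      from this[OF k1] show ?thesis
        unfolding n_def t by (simp only: N.D_cscale[OF N.f_mem] N.lower_f N.cscale_cscale[OF N.f_mem])
    qed
    have rest: "c j = act N (D j) n" if "j \<ge> 0" for j
      using that
    proof (induction j rule: int_ge_induct)
      case base
      then show ?case using c0 N.weight_space_eq[OF nw] n by simp
    next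
      case (step j)
      define e where "e = c (j + 1) - act N (D (j + 1)) n"
      have cm: "c (j + 1) \<in> carr N" using cmem step by simp
      have "act N (D (-1)) (c (j + 1)) - act N (D (j + 1)) (c (-1)) = cscale N (of_int (j + 2)) (c j)"
      proof -
        have "\<forall>i\<ge>-1. \<forall>j\<ge>-1. i + j \<ge> -1 \<longrightarrow>
            act N (D i) (c j) - act N (D j) (c i) = cscale N (of_int (j - i)) (c (i + j))"
          using c by (simp add: is_cocycle_def)
        from this[rule_format, of "-1" "j + 1"] show ?thesis using step(1) by (simp add: algebra_simps)
      qed
      moreover have "act N (D (-1)) (act N (D (j + 1)) n) =
          act N (D (j + 1)) (act N (D (-1)) n) + cscale N (of_int (j + 2)) (act N (D j) n)"
        using N.D_D[of "-1" "j + 1" n] n step(1) by (simp add: algebra_simps)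
      ultimately have "act N (D (-1)) e = 0"
        unfolding e_def using cm n low step(2) by (simp add: N.act_diff_right diff_eq_eq add.commute)
      moreover have "e \<in> weight_space N (lam - of_int (k - (j + 1)))"
        unfolding e_def using wt[of "j + 1"] N.weight_space_D[OF nw, of "j + 1"] step(1) k
        by (intro N.weight_space_diff) simp_all
      then obtain s where s: "e = cscale N s (N.f (k - (j + 1)))" using N.weight_space_f[OF lam0] by blast
      ultimately have z: "cscale N (s * - of_int (k - j)) (N.f (k - j)) = 0"
        by (simp add: N.D_cscale N.lower_f)
      have "e = 0"
      proof (cases "k - (j + 1) < 0")
        case True
        then show ?thesis using s by (simp add: N.f_neg)
      next
        case False
        then have "N.f (k - j) \<noteq> 0" using N.f_nonzero[OF lam0 N.v_nonzero, of "k - j"] by simp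
        moreover have "of_int (k - j) \<noteq> (0::complex)" using False by (simp only: of_int_eq_0_iff)
        ultimately have "s = 0" using z by (auto simp: N.cscale_eq_0_iff)
        then show ?thesis using s by simp
      qed
      then show ?case by (simp add: e_def)
    qed
    have "c j = act N (D j) n" if "j \<ge> -1" for j
      using low rest[of j] that by (cases "j = -1") auto
    then show ?thesis using nw l by (auto simp: is_coboundary_def)
  qed
qed (simp add: l)

text \<open>The weights of \<open>N\<close> are \<open>-1, -2, \<dots>\<close>, so only \<open>c\<^sub>-\<^sub>1\<close> survives, and there is no vector of weight \<open>0\<close> to make a
  coboundary.\<close>

lemma Ext1_of_trivial_minus_one:
  fixes N :: "'n::ab_group_add wmod"
  assumes N: "simple_hw_module N w (-1)" and l: "l = 0"
  shows "complex_linear_iso (Ext1_O M N) (baer_sum M N) (ext_scale M N) UNIV"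
proof -
  interpret N: simple_hw_module N w "-1" by fact
  interpret presented M v l "-1" using l by (rule presented_zero)
  have upper: "c j = 0" if "is_cocycle (-1) l N c" "j \<ge> 0" for c j
  proof (rule N.weight_space_outside[where k = "of_int j"])
    show "c j \<in> weight_space N (of_int j)" using that l by (auto simp: is_cocycle_def)
    show "of_int j \<noteq> (- 1 - of_nat n :: complex)" for n
    proof
      assume "of_int j = (- 1 - of_nat n :: complex)"
      then have "of_int j = (of_int (- 1 - int n) :: complex)" by simp
      then show False using that(2) by (simp only: of_int_eq_iff)
    qed
  qed simp
  show ?thesis
  proof (rule Ext1_line[OF N.wmod_axioms N.v_mem N.v_nonzero, where r = "-1"])
    fix c assume c: "is_cocycle (-1) l N c"
    have "c (-1) \<in> weight_space N (- 1 - of_int 0)" using c l by (auto simp: is_cocycle_def)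
    then show "\<exists>t. c (-1) = cscale N t w" using N.weight_space_f[of "c (-1)" 0] by (simp add: N.f_0)
    show "is_coboundary (-1) l N c \<longleftrightarrow> c (-1) = 0"
    proof
      assume "c (-1) = 0"
      then have "c j = 0" if "j \<ge> -1" for j using that upper[OF c, of j] by (cases "j = -1") auto
      then show "is_coboundary (-1) l N c" by (auto simp: is_coboundary_def intro!: bexI[of _ 0])
    next
      assume "is_coboundary (-1) l N c"
      then obtain n where n: "n \<in> weight_space N 0" "c (-1) = act N (D (-1)) n"
        using l by (auto simp: is_coboundary_def)
      have "0 \<noteq> (- 1 - of_nat n :: complex)" for n
      proof
        assume "0 = (- 1 - of_nat n :: complex)"
        then have "of_nat (n + 1) = (0 :: complex)" by (simp add: algebra_simps)
        then show False by (simp only: of_nat_eq_0_iff)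
      qed
      then have "n = 0" using N.weight_space_outside[OF _ n(1)] by simp
      then show "c (-1) = 0" using n by simp
    qed
  next
    fix y :: complex
    show "\<exists>E\<in>extensions_O M N. \<exists>c. ext_cocycle v l (-1) N E c \<and> c (-1) = cscale N y w"
    proof (cases "y = 0")
      case True
      then show ?thesis using realize_split[OF l N] by fastforce
    next
      case False
      then show ?thesis using realize_verma_zero[OF l N False] by fastforce
    qed
  qed
qed

text \<open>Only the vector \<open>c\<^sub>j\<close> of weight \<open>l + j = 0\<close> can be nonzero. The raising operators act by zero on \<open>N\<close>, so the
  cocycle identity kills all \<open>c\<^sub>j\<close> with \<open>j \<ge> 3\<close>, since \<open>d\<^sub>j\<close> is then a multiple of \<open>[d\<^sub>1, d\<^sub>j\<^sub>-\<^sub>1]\<close>. What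
  remains is \<open>j = 1\<close> and \<open>j = 2\<close>.\<close>

lemma Ext1_by_trivial:
  fixes N :: "'n::ab_group_add wmod"
  assumes N: "simple_hw_module N w 0" and l: "l \<noteq> 0"
  shows "complex_linear_iso (Ext1_O M N) (baer_sum M N) (ext_scale M N) (if l \<in> {-1, -2} then UNIV else {0})"
proof -
  interpret N: simple_hw_module N w 0 by fact
  interpret presented M v l 1 using l by (rule presented_nonzero)
  have zero: "c j = 0" if "is_cocycle 1 l N c" "j \<ge> 1" "l + of_int j \<noteq> 0" for c j
    using that N.weight_space_trivial[of "c j" "l + of_int j"] by (auto simp: is_cocycle_def)
  have "n = 0" if "n \<in> weight_space N l" for n
    using N.weight_space_trivial[OF _ that] l by simp
  then have no_l: "weight_space N l = {0}" by auto
  have cob_iff: "is_coboundary 1 l N c \<longleftrightarrow> (\<forall>j\<ge>1. c j = 0)" for c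
    by (simp add: is_coboundary_def no_l)
  show ?thesis
  proof (cases "l \<in> {-1, -2}")
    case False
    have "complex_linear_iso (Ext1_O M N) (baer_sum M N) (ext_scale M N) {0}"
    proof (rule Ext1_zero[OF N])
      fix c assume c: "is_cocycle 1 l N c"
      have "c j = 0" if j: "j \<ge> 1" for j
      proof (rule ccontr)
        assume cj: "c j \<noteq> 0"
        then have lj: "l = - of_int j" using zero[OF c j] by (auto simp: eq_neg_iff_add_eq_0)
        then have j3: "j \<ge> 3" using False j by (cases "j = 1 \<or> j = 2") auto
        have nz: "l + of_int i \<noteq> 0" if "i \<noteq> j" for i
          unfolding lj using that by (simp add: add_eq_0_iff)
        have "c 1 = 0" "c (j - 1) = 0"
          using j3 by (auto intro!: zero[OF c] nz simp del: of_int_diff of_int_1)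
        moreover have "act N (D 1) (c (j - 1)) - act N (D (j - 1)) (c 1) = cscale N (of_int (j - 1 - 1)) (c (1 + (j - 1)))"
          using c j3 unfolding is_cocycle_def by simp
        ultimately have "cscale N (of_int (j - 2)) (c j) = 0" by simp
        moreover have "c j \<in> carr N" using c j N.weight_space_mem by (auto simp: is_cocycle_def)
        moreover have "of_int (j - 2) \<noteq> (0::complex)" using j3 by (simp only: of_int_eq_0_iff)
        ultimately show False using cj by (simp add: N.cscale_eq_0_iff)
      qed
      then show "is_coboundary 1 l N c" by (simp add: cob_iff)
    qed (simp add: l)
    then show ?thesis using False by simp
  next
    case True
    then obtain r :: int where r: "r = 1 \<or> r = 2" "l = - of_int r"
      by (metis insertE of_int_1 of_int_numeral singletonD)
    have r1: "r \<ge> 1" using r(1) by auto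
    have "complex_linear_iso (Ext1_O M N) (baer_sum M N) (ext_scale M N) UNIV"
    proof (rule Ext1_line[OF N.wmod_axioms N.v_mem N.v_nonzero, where r = r])
      fix c assume c: "is_cocycle 1 l N c"
      then have "c r \<in> weight_space N (l + of_int r)" using r1 unfolding is_cocycle_def by blast
      then show "\<exists>t. c r = cscale N t w" by (intro N.carr_trivial N.weight_space_mem) simp_all
      have "c j = 0" if "j \<ge> 1" "j \<noteq> r" for j
        using zero[OF c that(1)] that(2) r(2) by simp
      then show "is_coboundary 1 l N c \<longleftrightarrow> c r = 0" unfolding cob_iff using r1 by auto
    next
      fix y :: complex
      define c where "c j = (if j = r then cscale N y w else 0)" for j
      have act0: "act N (D i) (c j) = 0" if "i \<ge> 1" for i j
        using N.D_v_trivial[OF refl, of i] that by (simp add: c_def N.D_cscale)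
      have c0: "cscale N (of_int (j - i)) (c (i + j)) = 0" if "i \<ge> 1" "j \<ge> 1" for i j
      proof (cases "i = j")
        case False
        then have "i + j \<noteq> r" using r(1) that by auto
        then show ?thesis by (simp add: c_def)
      qed (simp add: c_def)
      have "c j \<in> weight_space N (l + of_int j)" for j
        using N.v_weight r(2) by (auto simp: c_def intro: N.weight_space_cscale)
      then have "is_cocycle 1 l N c"
        unfolding is_cocycle_def using act0 c0 by auto
      then have "\<exists>E\<in>extensions_O M N. ext_cocycle v l 1 N E c"
        by (rule realize_cocycle[OF l N, where P = "\<lambda>j. if j = r then [:y:] else 0" and B = 0])
          (auto simp: c_def ev_pCons)
      then show "\<exists>E\<in>extensions_O M N. \<exists>c. ext_cocycle v l 1 N E c \<and> c r = cscale N y w"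
        by (metis c_def)
    qed
    then show ?thesis using True by simp
  qed
qed

text \<open>With \<open>k = lam - l\<close>, cocycles are the solutions of \<open>density_eq\<close>. For \<open>k \<ge> 2\<close> the determinant \<open>invariant\<close> vanishes
  exactly on coboundaries: if it vanishes, subtracting a coboundary makes \<open>c\<^sub>1 = c\<^sub>2 = 0\<close>, and \<open>d\<^sub>1, d\<^sub>2\<close> generate all
  \<open>d\<^sub>j\<close> with \<open>j \<ge> 1\<close>. For \<open>k = 1\<close> the single vector \<open>c\<^sub>1\<close> is a coboundary since \<open>d\<^sub>1 f\<^sub>1 = 2 lam f\<^sub>0\<close>, and for other values
  of \<open>lam - l\<close> there are no weight vectors for \<open>c\<close> to take.\<close>

lemma Ext1_verma_verma:
  fixes N :: "'n::ab_group_add wmod"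
  assumes N: "simple_hw_module N w lam" and l: "l \<noteq> 0" and lam: "lam \<noteq> 0"
  shows "complex_linear_iso (Ext1_O M N) (baer_sum M N) (ext_scale M N)
    (if lam - l \<in> {2, 3, 4} \<or> lam - l \<in> {5, 6} \<and> (2 * lam - (lam - l) + 1)\<^sup>2 = 3 * (lam - l) + 1
     then UNIV else {0})"
proof -
  interpret N: simple_hw_module N w lam by fact
  interpret presented M v l 1 using l by (rule presented_nonzero)
  note f_nz = N.f_nonzero[OF lam N.v_nonzero]
  consider "\<not> (\<exists>k\<ge>1. lam - l = of_int k)" | "lam - l = 1" | k :: int where "k \<ge> 2" "lam - l = of_int k"
  proof -
    show thesis
    proof (cases "\<exists>k\<ge>1. lam - l = of_int k")
      case False
      then show thesis by (rule that(1))
    next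
      case True
      then obtain k where k: "k \<ge> 1" "lam - l = of_int k" by blast
      then show thesis using that(2) that(3)[of k] by (cases "k = 1") auto
    qed
  qed
  then show ?thesis
  proof cases
    case 1
    have "complex_linear_iso (Ext1_O M N) (baer_sum M N) (ext_scale M N) {0}"
    proof (rule Ext1_zero[OF N])
      fix c assume c: "is_cocycle 1 l N c"
      have "c j = 0" if j: "j \<ge> 1" for j
      proof (rule N.weight_space_outside[OF lam, where k = "l + of_int j"])
        show "c j \<in> weight_space N (l + of_int j)" using c j by (auto simp: is_cocycle_def)
        show "l + of_int j \<noteq> lam - of_nat n" for n
        proof
          assume "l + of_int j = lam - of_nat n"
          then have "lam - l = of_int (j + int n)" by (simp add: algebra_simps)
          then show False using 1 j by (metis add_increasing2 of_nat_0_le_iff)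
        qed
      qed
      then show "is_coboundary 1 l N c" by (auto simp: is_coboundary_def intro!: bexI[of _ 0])
    qed (simp add: l)
    moreover have "lam - l \<notin> {2, 3, 4, 5, 6}"
      using 1 by (auto dest: spec[of _ 2] spec[of _ 3] spec[of _ 4] spec[of _ 5] spec[of _ 6])
    ultimately show ?thesis by auto
  next
    case 2
    have "complex_linear_iso (Ext1_O M N) (baer_sum M N) (ext_scale M N) {0}"
    proof (rule Ext1_zero[OF N])
      fix c assume c: "is_cocycle 1 l N c"
      have "c j \<in> weight_space N (lam - of_int (1 - j))" if "j \<ge> 1" for j
        using c that 2 by (auto simp: is_cocycle_def algebra_simps)
      then have cj: "\<exists>t. c j = cscale N t (N.f (1 - j))" if "j \<ge> 1" for j
        using N.weight_space_f[OF lam] that by blast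
      obtain t where t: "c 1 = cscale N t w" using cj[of 1] by (auto simp: N.f_0)
      define n where "n = cscale N (t / (2 * lam)) (N.f 1)"
      have "n \<in> weight_space N l"
        unfolding n_def using N.f_weight[of 1] 2 by (intro N.weight_space_cscale) (simp add: algebra_simps)
      moreover have "c j = act N (D j) n" if "j \<ge> 1" for j
      proof (cases "j = 1")
        case True
        then show ?thesis using lam by (simp add: t n_def N.D_cscale N.D_f N.f_0)
      next
        case False
        then show ?thesis using cj[OF that] that by (auto simp: n_def N.D_cscale N.D_f N.f_neg)
      qed
      ultimately show "is_coboundary 1 l N c" by (auto simp: is_coboundary_def)
    qed (simp add: l)
    then show ?thesis using 2 by simp
  next
    case (3 k)
    let ?k = "of_int k :: complex"
    have f_nz1: "N.f (k - 1) \<noteq> 0" "N.f (k - 2) \<noteq> 0" using f_nz 3 by auto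
    define X where "X c = invariant lam ?k (\<lambda>j. N.coef (N.f (k - j)) (c j))" for c
    have X_eq: "X c = invariant lam ?k g" if "\<And>j. j \<ge> 1 \<Longrightarrow> c j = cscale N (g j) (N.f (k - j))" for c g
      using f_nz1 by (simp add: X_def invariant_def that N.coef_cscale)
    have coords: "\<exists>g. \<forall>j\<ge>1. c j = cscale N (g j) (N.f (k - j))" if c: "is_cocycle 1 l N c" for c
    proof -
      have "\<exists>t. c j = cscale N t (N.f (k - j))" if "j \<ge> 1" for j
      proof (rule N.weight_space_f[OF lam])
        have e: "lam - of_int (k - j) = l + of_int j" using 3 by (simp add: algebra_simps)
        show "c j \<in> weight_space N (lam - of_int (k - j))"
          unfolding e using c that unfolding is_cocycle_def by blast
      qed
      then show ?thesis by metis
    qed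
    have commutator: "act N (D i) (cscale N (g j) (N.f (k - j))) - act N (D j) (cscale N (g i) (N.f (k - i))) =
        cscale N (g j * (of_int (i + j) - ?k + of_int (i + 1) * lam)
          - g i * (of_int (i + j) - ?k + of_int (j + 1) * lam)) (N.f (k - (i + j)))"
      if "i \<ge> 1" "j \<ge> 1" for g i j
    proof -
      have part: "act N (D i) (cscale N a (N.f (k - j))) =
          cscale N (a * (of_int (i + j) - ?k + of_int (i + 1) * lam)) (N.f (k - (i + j)))"
        if "i \<ge> 1" for i j a
      proof -
        have "i \<ge> -1" using that by simp
        moreover have "of_int (i - (k - j)) + of_int (i + 1) * lam = of_int (i + j) - ?k + of_int (i + 1) * lam"
          "k - j - i = k - (i + j)" by simp_all
        ultimately show ?thesis
          by (simp only: N.D_cscale[OF N.f_mem] N.D_f N.cscale_cscale[OF N.f_mem])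
      qed
      show ?thesis
        unfolding part[OF that(1)] part[OF that(2)] add.commute[of j i] N.cscale_diff[OF N.f_mem] ..
    qed
    have density: "density_eq lam ?k g i j"
      if c: "is_cocycle 1 l N c" and g: "\<And>j. j \<ge> 1 \<Longrightarrow> c j = cscale N (g j) (N.f (k - j))"
        and ij: "i \<ge> 1" "j \<ge> 1" "i + j \<le> k" for c g i j
    proof -
      let ?a = "g j * (of_int (i + j) - ?k + of_int (i + 1) * lam)
          - g i * (of_int (i + j) - ?k + of_int (j + 1) * lam)"
      have "act N (D i) (c j) - act N (D j) (c i) = cscale N (of_int (j - i)) (c (i + j))"
        using c ij unfolding is_cocycle_def by simp
      then have "cscale N ?a (N.f (k - (i + j))) = cscale N (of_int (j - i) * g (i + j)) (N.f (k - (i + j)))"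
        using ij commutator[OF ij(1,2), of g] g by simp
      then have "cscale N (?a - of_int (j - i) * g (i + j)) (N.f (k - (i + j))) = 0"
        by (simp only: N.cscale_diff[OF N.f_mem]) simp
      moreover have "N.f (k - (i + j)) \<noteq> 0" using f_nz ij by simp
      ultimately show ?thesis by (simp add: N.cscale_eq_0_iff density_eq_def)
    qed
    have density_cocycle: "is_cocycle 1 l N (\<lambda>j. cscale N (g j) (N.f (k - j)))"
      if g: "\<And>i j. i \<ge> 1 \<Longrightarrow> j \<ge> 1 \<Longrightarrow> i + j \<le> k \<Longrightarrow> density_eq lam ?k g i j" for g
      unfolding is_cocycle_def
    proof (intro conjI allI impI)
      fix j :: int
      have e: "l + of_int j = lam - of_int (k - j)" using 3 by (simp add: algebra_simps)
      show "cscale N (g j) (N.f (k - j)) \<in> weight_space N (l + of_int j)"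
        unfolding e by (rule N.weight_space_cscale[OF N.f_weight])
    next
      fix i j :: int assume ij: "1 \<le> i" "1 \<le> j"
      show "act N (D i) (cscale N (g j) (N.f (k - j))) - act N (D j) (cscale N (g i) (N.f (k - i))) =
          cscale N (of_int (j - i)) (cscale N (g (i + j)) (N.f (k - (i + j))))"
      proof (cases "i + j \<le> k")
        case True
        then show ?thesis using commutator[OF ij, of g] g[OF ij True] by (simp add: density_eq_def)
      next
        case False
        then show ?thesis using commutator[OF ij, of g] by (simp add: N.f_neg)
      qed
    qed simp
    let ?P = "k \<in> {2, 3, 4} \<or> k \<in> {5, 6} \<and> (2 * lam - ?k + 1)\<^sup>2 = 3 * ?k + 1"
    have "complex_linear_iso (Ext1_O M N) (baer_sum M N) (ext_scale M N) (if ?P then UNIV else {0})"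
    proof (rule Ext1_linear_iso[where X = X])
      fix c assume c: "is_cocycle 1 l N c"
      obtain g where g: "\<And>j. j \<ge> 1 \<Longrightarrow> c j = cscale N (g j) (N.f (k - j))" using coords[OF c] by blast
      have Xc: "X c = invariant lam ?k g" by (rule X_eq) (rule g)
      show "X (\<lambda>j. cscale N s (c j)) = s * X c" for s
        unfolding Xc by (subst X_eq[where g = "\<lambda>j. s * g j"]) (simp_all add: g invariant_def algebra_simps)
      show "X c \<in> (if ?P then UNIV else {0})"
      proof (cases ?P)
        case False
        then have "invariant lam ?k g = 0"
          using 3(1) by (intro invariant_vanishes density[OF c g]) auto
        then show ?thesis using False Xc by simp
      qed simp
      show "X c = 0 \<longleftrightarrow> is_coboundary 1 l N c"
      proof
        assume "is_coboundary 1 l N c"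
        then obtain n where n: "n \<in> weight_space N l" "\<And>j. j \<ge> 1 \<Longrightarrow> c j = act N (D j) n"
          by (auto simp: is_coboundary_def)
        have "l = lam - ?k" using 3 by (simp add: algebra_simps)
        then obtain t where t: "n = cscale N t (N.f k)" using N.weight_space_f[OF lam] n(1) by blast
        have "X c = invariant lam ?k (\<lambda>j. t * (of_int (j - k) + of_int (j + 1) * lam))"
          by (rule X_eq) (simp add: n(2) t N.D_cscale N.D_f)
        then show "X c = 0" by (simp add: invariant_def)
      next
        assume "X c = 0"
        then have inv: "g 1 * (2 - ?k + 3 * lam) = g 2 * (1 - ?k + 2 * lam)" by (simp add: Xc invariant_def)
        obtain t where t: "g 1 = t * (1 - ?k + 2 * lam)" "g 2 = t * (2 - ?k + 3 * lam)"
        proof (cases "1 - ?k + 2 * lam = 0")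
          case True
          then have nz: "2 - ?k + 3 * lam \<noteq> 0" using coboundary_pair_nonzero[of k lam] 3 by auto
          then have "g 1 = 0" using inv True by simp
          then show thesis using that[of "g 2 / (2 - ?k + 3 * lam)"] True nz by simp
        next
          case False
          then show thesis
            using that[of "g 1 / (1 - ?k + 2 * lam)"] inv by (simp add: field_simps)
        qed
        define n where "n = cscale N t (N.f k)"
        have "l = lam - ?k" using 3 by (simp add: algebra_simps)
        then have nw: "n \<in> weight_space N l"
          unfolding n_def using N.f_weight[of k] by (simp add: N.weight_space_cscale)
        have n: "n \<in> carr N" by (simp add: n_def)
        have c1: "c 1 = act N (D 1) n" and c2: "c 2 = act N (D 2) n"
          by (simp_all add: g t n_def N.D_cscale N.D_f)
        have "c j = act N (D j) n" if "j \<ge> 2" for j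
          using that
        proof (induction j rule: int_ge_induct)
          case base
          then show ?case by (rule c2)
        next
          case (step j)
          have "act N (D 1) (c j) - act N (D j) (c 1) = cscale N (of_int (j - 1)) (c (1 + j))"
            using c step(1) unfolding is_cocycle_def by simp
          moreover have "act N (D 1) (act N (D j) n) - act N (D j) (act N (D 1) n) =
              cscale N (of_int (j - 1)) (act N (D (1 + j)) n)"
            using N.D_D[of 1 j n] n step(1) by simp
          ultimately have e: "cscale N (of_int (j - 1)) (c (1 + j)) = cscale N (of_int (j - 1)) (act N (D (1 + j)) n)"
            using step(2) c1 by simp
          have "c (1 + j) \<in> carr N" using g step(1) by simp
          then have "cscale N (of_int (j - 1)) (c (1 + j) - act N (D (1 + j)) n) = 0"
            using e n by (subst N.act_diff_right) auto
          moreover have "of_int (j - 1) \<noteq> (0::complex)" using step(1) by (simp only: of_int_eq_0_iff)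
          ultimately have "c (1 + j) - act N (D (1 + j)) n = 0"
            using \<open>c (1 + j) \<in> carr N\<close> n by (subst (asm) N.cscale_eq_0_iff) auto
          then show ?case by (simp add: add.commute)
        qed
        then have "c j = act N (D j) n" if "j \<ge> 1" for j using that c1 by (cases "j = 1") auto
        then show "is_coboundary 1 l N c" using nw by (auto simp: is_coboundary_def)
      qed
      fix c' assume c': "is_cocycle 1 l N c'"
      obtain g' where g': "\<And>j. j \<ge> 1 \<Longrightarrow> c' j = cscale N (g' j) (N.f (k - j))" using coords[OF c'] by blast
      have Xc': "X c' = invariant lam ?k g'" by (rule X_eq) (rule g')
      show "X (\<lambda>j. c j + c' j) = X c + X c'"
        unfolding Xc Xc' by (subst X_eq[where g = "\<lambda>j. g j + g' j"])
          (simp_all add: g g' N.cscale_add invariant_def algebra_simps)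
    next
      fix y :: complex assume y: "y \<in> (if ?P then UNIV else {0})"
      obtain g where g: "invariant lam ?k g = y"
        "\<And>i j. i \<ge> 1 \<Longrightarrow> j \<ge> 1 \<Longrightarrow> i + j \<le> k \<Longrightarrow> density_eq lam ?k g i j"
      proof (cases ?P)
        case True
        then show thesis using density_solution[of k lam y] that by blast
      next
        case False
        have "y = 0" using y unfolding if_not_P[OF False] by simp
        then show thesis using that[of "\<lambda>_. 0"] by (simp add: invariant_def density_eq_def)
      qed
      let ?c = "\<lambda>j. cscale N (g j) (N.f (k - j))"
      obtain P where P: "\<And>m. degree (P m) \<le> nat m" "\<And>m. N.f m = act N (ev (P m)) w"
        using N.f_eq_ev by metis
      have "\<exists>E\<in>extensions_O M N. ext_cocycle v l 1 N E ?c"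
      proof (rule realize_cocycle[OF l N density_cocycle[OF g(2)]])
        fix j :: int assume "j \<ge> 1"
        show "cscale N (g j) (N.f (k - j)) = act N (ev (smult (g j) (P (k - j)))) w"
          by (simp add: ev_smult P(2) N.act_mult)
        show "degree (smult (g j) (P (k - j))) \<le> nat k"
          using degree_smult_le[of "g j" "P (k - j)"] P(1)[of "k - j"] \<open>j \<ge> 1\<close> by linarith
      qed
      moreover have "X ?c = y" using X_eq[of ?c g] g(1) by simp
      ultimately show "\<exists>E\<in>extensions_O M N. \<exists>c. ext_cocycle v l 1 N E c \<and> X c = y" by blast
    qed (auto simp: N.wmod_axioms)
    moreover have "?P \<longleftrightarrow> lam - l \<in> {2, 3, 4} \<or> lam - l \<in> {5, 6} \<and> (2 * lam - (lam - l) + 1)\<^sup>2 = 3 * (lam - l) + 1"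
    proof -
      have "?k = of_int r \<longleftrightarrow> k = r" for r by simp
      from this[of 2] this[of 3] this[of 4] this[of 5] this[of 6] show ?thesis
        unfolding 3(2) by simp
    qed
    ultimately show ?thesis by simp
  qed
qed

end

theorem theorem3p11:
  fixes lam mu :: complex
    and Dmu :: "'a::ab_group_add wmod" and Lmu :: "'b::ab_group_add wmod"
    and Dlam :: "'c::ab_group_add wmod" and Llam :: "'e::ab_group_add wmod"
  assumes "is_verma mu Dmu" and "is_simple_quotient Dmu Lmu"
    and "is_verma lam Dlam" and "is_simple_quotient Dlam Llam"
  shows "complex_linear_iso (Ext1_O Lmu Llam) (baer_sum Lmu Llam) (ext_scale Lmu Llam)
    (if (lam - mu \<in> {2, 3, 4} \<and> lam * mu \<noteq> 0)
        \<or> (lam, mu) \<in> {(0, -1), (0, -2), (-1, 0), (4, -1)}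
        \<or> (lam, mu) \<in> {((5 + of_real (sqrt 19)) / 2, (-7 + of_real (sqrt 19)) / 2),
                        ((5 - of_real (sqrt 19)) / 2, (-7 - of_real (sqrt 19)) / 2)}
     then UNIV else {0})"
proof -
  obtain v where v: "simple_hw_module Lmu v mu" using simple_quotient_of_verma[OF assms(1,2)] by blast
  obtain w where w: "simple_hw_module Llam w lam" using simple_quotient_of_verma[OF assms(3,4)] by blast
  interpret M: simple_hw_module Lmu v mu by fact
  let ?r = "of_real (sqrt 19) :: complex"
  have r2: "?r * ?r = 19"
  proof -
    have "?r * ?r = of_real (sqrt 19 * sqrt 19)" by (simp only: of_real_mult)
    then show ?thesis by simp
  qed
  have roots: "(lam, mu) \<in> {((5 + ?r) / 2, (-7 + ?r) / 2), ((5 - ?r) / 2, (-7 - ?r) / 2)} \<longleftrightarrow>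
      lam - mu = 6 \<and> (2 * lam - 5)\<^sup>2 = 19"
  proof
    assume "lam - mu = 6 \<and> (2 * lam - 5)\<^sup>2 = 19"
    then have "(2 * lam - 5 - ?r) * (2 * lam - 5 + ?r) = 0" and mu: "mu = lam - 6"
      using r2 by (auto simp: power2_eq_square algebra_simps)
    then consider "2 * lam - 5 - ?r = 0" | "2 * lam - 5 + ?r = 0" by auto
    then show "(lam, mu) \<in> {((5 + ?r) / 2, (-7 + ?r) / 2), ((5 - ?r) / 2, (-7 - ?r) / 2)}"
    proof cases
      case 1
      then have L: "lam = (5 + ?r) / 2" by (simp add: field_simps)
      have "mu = (-7 + ?r) / 2" unfolding mu L by (simp add: field_simps)
      with L show ?thesis by simp
    next
      case 2
      then have L: "lam = (5 - ?r) / 2" by (simp add: field_simps eq_neg_iff_add_eq_0)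
      have "mu = (-7 - ?r) / 2" unfolding mu L by (simp add: field_simps)
      with L show ?thesis by simp
    qed
  next
    assume "(lam, mu) \<in> {((5 + ?r) / 2, (-7 + ?r) / 2), ((5 - ?r) / 2, (-7 - ?r) / 2)}"
    then consider "lam = (5 + ?r) / 2" "mu = (-7 + ?r) / 2" | "lam = (5 - ?r) / 2" "mu = (-7 - ?r) / 2" by auto
    then show "lam - mu = 6 \<and> (2 * lam - 5)\<^sup>2 = 19"
    proof cases
      case 1
      have "lam - mu = 6" unfolding 1 by (simp add: field_simps)
      moreover have "2 * lam - 5 = ?r" unfolding 1 by (simp add: field_simps)
      ultimately show ?thesis using r2 by (simp add: power2_eq_square)
    next
      case 2
      have "lam - mu = 6" unfolding 2 by (simp add: field_simps)
      moreover have "2 * lam - 5 = - ?r" unfolding 2 by (simp add: field_simps)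
      ultimately show ?thesis using r2 by (simp add: power2_eq_square)
    qed
  qed
  \<comment> \<open>the exceptional pairs with \<open>\<surd>19\<close> do not occur when one weight is zero\<close>
  have r_nz: "5 + ?r \<noteq> 0" "5 - ?r \<noteq> 0" "-7 + ?r \<noteq> 0" "-7 - ?r \<noteq> 0"
  proof -
    have "(5 + ?r) * (5 - ?r) \<noteq> 0" "(-7 + ?r) * (-7 - ?r) \<noteq> 0" using r2 by (simp_all add: algebra_simps)
    then show "5 + ?r \<noteq> 0" "5 - ?r \<noteq> 0" "-7 + ?r \<noteq> 0" "-7 - ?r \<noteq> 0" by auto
  qed
  consider "mu = 0" "lam = -1" | "mu = 0" "lam \<noteq> -1" | "mu \<noteq> 0" "lam = 0" | "mu \<noteq> 0" "lam \<noteq> 0" by blast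
  then show ?thesis
  proof cases
    case 1
    then show ?thesis using M.Ext1_of_trivial_minus_one[of Llam w] w by simp
  next
    case 2
    then show ?thesis using M.Ext1_of_trivial[OF w] r_nz by auto
  next
    case 3
    then show ?thesis using M.Ext1_by_trivial[of Llam w] w r_nz by auto
  next
    case 4
    have six: "(2 * lam - (lam - mu) + 1)\<^sup>2 = 3 * (lam - mu) + 1 \<longleftrightarrow> (2 * lam - 5)\<^sup>2 = 19" if "lam - mu = 6"
      unfolding that by (simp add: algebra_simps)
    have five: "(2 * lam - (lam - mu) + 1)\<^sup>2 = 3 * (lam - mu) + 1 \<longleftrightarrow> lam = 4 \<and> mu = -1" if "lam - mu = 5"
    proof -
      have "(2 * lam - 5 + 1)\<^sup>2 = 3 * 5 + 1 \<longleftrightarrow> lam * (lam - 4) = 0"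
        by (simp add: power2_eq_square algebra_simps)
      moreover have "mu = lam - 5" using that by (simp add: algebra_simps)
      ultimately show ?thesis unfolding that using 4(2) by auto
    qed
    have "lam - mu \<in> {5, 6} \<and> (2 * lam - (lam - mu) + 1)\<^sup>2 = 3 * (lam - mu) + 1 \<longleftrightarrow>
        lam = 4 \<and> mu = -1 \<or> lam - mu = 6 \<and> (2 * lam - 5)\<^sup>2 = 19"
    proof -
      have "lam = 4 \<and> mu = -1 \<Longrightarrow> lam - mu = 5" "\<not> (lam - mu = 5 \<and> lam - mu = 6)" by auto
      then show ?thesis using five six by blast
    qed
    then show ?thesis
      using M.Ext1_verma_verma[OF w 4] 4 unfolding roots by simp
  qed
qed

end
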